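(* Let $G$ be a non-degenerate (possibly infinite) graph. The following are equivalent: (a) $G$ is $7$-ac; (b) $G$ is $\omega$-ac; (c) $|G|$ is homeomorphic to one of the six finite graphs arc, circle, lollipop, $\theta$-curve, figure-of-eight, dumbbell, or $|G|$ is homeomorphic to one of these six graphs minus possibly some endpoints.
   Context: A graph $G=(V,E)$ consists of a (possibly infinite) vertex set $V$ and a set $E\subseteq[V]^2$ of edges (vertex degrees may be infinite). It is non-degenerate if it has more than one vertex. $|G|$ denotes the $1$-complex of $G$: the quotient of $V\oplus\bigoplus_{e\in E}[0,1]_e$ ($V$ discrete) in which, for each edge $e=\{v,w\}$, $0\in[0,1]_e$ is identified with $v$ and $1\in[0,1]_e$ with $w$. An arc is a homeomorphic copy of $[0,1]$. $G$ is $n$-ac if for any choice of at most $n$ points of $|G|$ there is an arc in $|G|$ containing them, and $\omega$-ac if it is $n$-ac for all $n\in\mathbb N$. The lollipop is a circle together with an arc meeting the circle in exactly one point, which is an endpoint of the arc. A $\theta$-curve is the union of three arcs with the same two endpoints that are otherwise pairwise disjoint. The figure-of-eight is the union of two circles meeting in exactly one point. The dumbbell is the union of two disjoint circles and an arc joining a point of one to a point of the other and otherwise disjoint from both. Endpoints of these graphs are their degree-one points (both ends of the arc; the free end of the lollipop), so removing some of them yields three additional spaces: $[0,1)$, $(0,1)$ and the lollipop without its endpoint. *)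

theory Defs
  imports "HOL-Analysis.Analysis" "HOL-Library.Ramsey"
begin

section \<open>Quotient spaces\<close>

text \<open>The set \<open>f ` topspace X\<close> with the finest topology making \<open>f\<close> continuous: the quotient
  of \<open>X\<close> by the kernel of \<open>f\<close>, with \<open>f\<close> picking one representative per class.\<close>

definition quotient_topology :: "'a topology \<Rightarrow> ('a \<Rightarrow> 'b) \<Rightarrow> 'b topology" where
  "quotient_topology X f =
     topology (\<lambda>U. U \<subseteq> f ` topspace X \<and> openin X {x \<in> topspace X. f x \<in> U})"

lemma istopology_quotient:
  "istopology (\<lambda>U. U \<subseteq> f ` topspace X \<and> openin X {x \<in> topspace X. f x \<in> U})"
proof -
  have 1: "{x \<in> topspace X. f x \<in> S \<inter> T} = {x \<in> topspace X. f x \<in> S} \<inter> {x \<in> topspace X. f x \<in> T}" for S T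
    by auto
  have 2: "{x \<in> topspace X. f x \<in> \<Union> \<K>} = (\<Union>K\<in>\<K>. {x \<in> topspace X. f x \<in> K})" for \<K>
    by auto
  show ?thesis
    unfolding istopology_def 1 2 by blast
qed

lemma openin_quotient_topology:
  "openin (quotient_topology X f) U \<longleftrightarrow>
     U \<subseteq> f ` topspace X \<and> openin X {x \<in> topspace X. f x \<in> U}"
  by (simp add: quotient_topology_def istopology_quotient)

lemma topspace_quotient_topology [simp]:
  "topspace (quotient_topology X f) = f ` topspace X"
proof (rule antisym)
  show "topspace (quotient_topology X f) \<subseteq> f ` topspace X"
    using openin_topspace[of "quotient_topology X f"] by (simp only: openin_quotient_topology)
  have "{x \<in> topspace X. f x \<in> f ` topspace X} = topspace X"
    by auto
  then have "openin (quotient_topology X f) (f ` topspace X)"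
    by (simp add: openin_quotient_topology)
  then show "f ` topspace X \<subseteq> topspace (quotient_topology X f)"
    by (rule openin_subset)
qed

lemma quotient_map_quotient_topology: "quotient_map X (quotient_topology X f) f"
  by (auto simp: quotient_map_def openin_quotient_topology)


section \<open>Graphs and their 1-complexes\<close>

definition graph :: "'v set \<Rightarrow> 'v set set \<Rightarrow> bool" where
  "graph V E \<longleftrightarrow> E \<subseteq> [V]\<^bsup>2\<^esup>"

definition nondegenerate :: "'v set \<Rightarrow> bool" where
  "nondegenerate V \<longleftrightarrow> (\<exists>v\<in>V. \<exists>w\<in>V. v \<noteq> w)"

text \<open>An arbitrary choice of which end of an edge is glued to 0 and which to 1.\<close>

definition edge_start :: "'v set \<Rightarrow> 'v" where
  "edge_start e = (SOME v. v \<in> e)"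

definition edge_end :: "'v set \<Rightarrow> 'v" where
  "edge_end e = (SOME w. w \<in> e \<and> w \<noteq> edge_start e)"

lemma edge_ends:
  assumes "graph V E" "e \<in> E"
  shows "e = {edge_start e, edge_end e}" "edge_start e \<noteq> edge_end e"
proof -
  obtain v w where vw: "e = {v, w}" "v \<noteq> w"
    using assms by (auto simp: graph_def nsets_def card_2_iff)
  then have s: "edge_start e \<in> e"
    unfolding edge_start_def by (metis insertI1 someI)
  with vw have "\<exists>x. x \<in> e \<and> x \<noteq> edge_start e"
    by auto
  then have "edge_end e \<in> e \<and> edge_end e \<noteq> edge_start e"
    unfolding edge_end_def by (rule someI_ex)
  with s vw show "e = {edge_start e, edge_end e}" "edge_start e \<noteq> edge_end e"
    by auto
qed

text \<open>The discrete space \<open>V\<close> is the disjoint sum of one-point spaces \<open>{0}\<close>, so that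
  \<open>V \<oplus> \<Oplus>\<^sub>e [0,1]\<^sub>e\<close> becomes a single sum of subspaces of the reals, indexed by \<open>V <+> E\<close>:
  a vertex \<open>v\<close> is the point \<open>(Inl v, 0)\<close>, and \<open>t \<in> [0,1]\<^sub>e\<close> is the point \<open>(Inr e, t)\<close>.\<close>

definition pre_complex :: "'v set \<Rightarrow> 'v set set \<Rightarrow> (('v + 'v set) \<times> real) topology" where
  "pre_complex V E =
     sum_topology (\<lambda>i. case i of Inl v \<Rightarrow> top_of_set {0} | Inr e \<Rightarrow> top_of_set {0..1}) (V <+> E)"

fun glue :: "('v + 'v set) \<times> real \<Rightarrow> ('v + 'v set) \<times> real" where
  "glue (Inl v, t) = (Inl v, t)"
| "glue (Inr e, t) =
     (if t = 0 then (Inl (edge_start e), 0)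
      else if t = 1 then (Inl (edge_end e), 0)
      else (Inr e, t))"

definition one_complex :: "'v set \<Rightarrow> 'v set set \<Rightarrow> (('v + 'v set) \<times> real) topology" where
  "one_complex V E = quotient_topology (pre_complex V E) glue"


section \<open>Arc-connectedness\<close>

definition is_arc :: "'a topology \<Rightarrow> 'a set \<Rightarrow> bool" where
  "is_arc X A \<longleftrightarrow> A \<subseteq> topspace X \<and> subtopology X A homeomorphic_space top_of_set {0..1::real}"

definition n_ac :: "nat \<Rightarrow> 'a topology \<Rightarrow> bool" where
  "n_ac n X \<longleftrightarrow>
     (\<forall>S. S \<subseteq> topspace X \<and> finite S \<and> card S \<le> n \<longrightarrow> (\<exists>A. is_arc X A \<and> S \<subseteq> A))"

definition omega_ac :: "'a topology \<Rightarrow> bool" where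
  "omega_ac X \<longleftrightarrow> (\<forall>n. n_ac n X)"


section \<open>The six finite graphs\<close>

text \<open>Each is given as a concrete subset of the plane.\<close>

definition arc_graph :: "complex set" where
  "arc_graph = closed_segment 0 1"

definition circle_graph :: "complex set" where
  "circle_graph = sphere 0 1"

definition lollipop :: "complex set" where
  "lollipop = sphere 0 1 \<union> closed_segment 1 2"

definition theta_curve :: "complex set" where
  "theta_curve = sphere 0 1 \<union> closed_segment (-1) 1"

definition figure_of_eight :: "complex set" where
  "figure_of_eight = sphere (-1) 1 \<union> sphere 1 1"

definition dumbbell :: "complex set" where
  "dumbbell = sphere (-2) 1 \<union> sphere 2 1 \<union> closed_segment (-1) 1"

text \<open>Each graph is paired with the set of its endpoints (degree-one points).\<close>

definition six_graphs :: "(complex set \<times> complex set) set" where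
  "six_graphs =
     {(arc_graph, {0, 1}), (circle_graph, {}), (lollipop, {2}),
      (theta_curve, {}), (figure_of_eight, {}), (dumbbell, {})}"

text \<open>The models are unions of circles and arcs meeting in the prescribed way.\<close>

lemma mem_real_segment:
  "z \<in> closed_segment (of_real a) (of_real b) \<longleftrightarrow> Im z = 0 \<and> a \<le> Re z \<and> Re z \<le> b"
  if "a \<le> b" for z :: complex
proof -
  have "z \<in> closed_segment (of_real a) (of_real b) \<longleftrightarrow> z \<in> of_real ` closed_segment a b"
    by (simp add: closed_segment_of_real)
  also have "\<dots> \<longleftrightarrow> Im z = 0 \<and> a \<le> Re z \<and> Re z \<le> b"
    using that by (auto simp: closed_segment_eq_real_ivl complex_eq_iff image_iff)
  finally show ?thesis .
qed

lemma mem_sphere_complex: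
  "z \<in> sphere (of_real a) 1 \<longleftrightarrow> (Re z - a)\<^sup>2 + (Im z)\<^sup>2 = 1" for z :: complex
  by (auto simp: dist_norm cmod_def power2_commute)

lemma lollipop_shape: "sphere 0 1 \<inter> closed_segment 1 2 = {1 :: complex}"
  using mem_sphere_complex[of _ 0] mem_real_segment[of 1 2]
  by (auto simp: complex_eq_iff power2_eq_1_iff)

lemma figure_of_eight_shape: "sphere (-1) 1 \<inter> sphere 1 1 = {0 :: complex}"
proof (intro set_eqI iffI)
  fix z :: complex assume "z \<in> sphere (-1) 1 \<inter> sphere 1 1"
  then have eqs: "(Re z + 1)\<^sup>2 + (Im z)\<^sup>2 = 1" "(Re z - 1)\<^sup>2 + (Im z)\<^sup>2 = 1"
    using mem_sphere_complex[of z "-1"] mem_sphere_complex[of z 1] by simp_all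
  then have "Re z = 0"
    by (simp add: power2_eq_square algebra_simps)
  with eqs show "z \<in> {0}"
    by (simp add: complex_eq_iff)
qed auto

lemma dumbbell_shape:
  "sphere (-2) 1 \<inter> sphere 2 1 = ({} :: complex set)"
  "sphere (-2) 1 \<inter> closed_segment (-1) 1 = {-1 :: complex}"
  "sphere 2 1 \<inter> closed_segment (-1) 1 = {1 :: complex}"
proof -
  have m: "z \<in> sphere (-2) 1 \<longleftrightarrow> (Re z + 2)\<^sup>2 + (Im z)\<^sup>2 = 1"
          "z \<in> sphere 2 1 \<longleftrightarrow> (Re z - 2)\<^sup>2 + (Im z)\<^sup>2 = 1"
          "z \<in> closed_segment (-1) 1 \<longleftrightarrow> Im z = 0 \<and> -1 \<le> Re z \<and> Re z \<le> 1" for z :: complex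
    using mem_sphere_complex[of z "-2"] mem_sphere_complex[of z 2] mem_real_segment[of "-1" 1 z]
    by simp_all
  have "Re z < 0" if "(Re z + 2)\<^sup>2 + (Im z)\<^sup>2 = 1" for z
  proof -
    have "(Re z + 2)\<^sup>2 \<le> 1" using that zero_le_power2[of "Im z"] by linarith
    then show ?thesis by (simp add: abs_square_le_1)
  qed
  moreover have "Re z > 0" if "(Re z - 2)\<^sup>2 + (Im z)\<^sup>2 = 1" for z
  proof -
    have "(Re z - 2)\<^sup>2 \<le> 1" using that zero_le_power2[of "Im z"] by linarith
    then show ?thesis by (simp add: abs_square_le_1)
  qed
  ultimately show "sphere (-2) 1 \<inter> sphere 2 1 = ({} :: complex set)"
    by (force simp: m simp del: mem_sphere)
  show "sphere (-2) 1 \<inter> closed_segment (-1) 1 = {-1 :: complex}"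
       "sphere 2 1 \<inter> closed_segment (-1) 1 = {1 :: complex}"
    by (auto simp: set_eq_iff m complex_eq_iff power2_eq_1_iff simp del: mem_sphere)
qed

lemma theta_curve_shape:
  obtains g h k :: "real \<Rightarrow> complex"
  where "arc g" "arc h" "arc k"
    and "pathstart g = -1" "pathstart h = -1" "pathstart k = -1"
    and "pathfinish g = 1" "pathfinish h = 1" "pathfinish k = 1"
    and "path_image g \<inter> path_image h = {-1, 1}"
    and "path_image g \<inter> path_image k = {-1, 1}"
    and "path_image h \<inter> path_image k = {-1, 1}"
    and "theta_curve = path_image g \<union> path_image h \<union> path_image k"
proof -
  define c where "c s t = Complex (2*t - 1) (s * sqrt (1 - (2*t - 1)\<^sup>2))" for s t :: real
  have sq: "(2*t - 1)\<^sup>2 \<le> 1" if "0 \<le> t" "t \<le> 1" for t :: real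
    using that by (simp add: abs_square_le_1)
  have arcc: "arc (c s)" for s
    unfolding arc_def path_def c_def
    by (auto simp: inj_on_def intro!: continuous_intros)
  have ends: "pathstart (c s) = -1" "pathfinish (c s) = 1" for s
    by (auto simp: c_def pathstart_def pathfinish_def complex_eq_iff)
  have im: "path_image (c s) = {z. (Re z)\<^sup>2 + (Im z)\<^sup>2 = 1 \<and> 0 \<le> s * Im z}" if "s\<^sup>2 = 1" for s
  proof (intro set_eqI iffI)
    fix z assume "z \<in> path_image (c s)"
    then obtain t where t: "0 \<le> t" "t \<le> 1" "z = c s t"
      by (auto simp: path_image_def)
    have "0 \<le> s * (s * sqrt (1 - (2*t - 1)\<^sup>2))"
      using sq[OF t(1,2)] that by (simp add: power2_eq_square flip: mult.assoc)
    then show "z \<in> {z. (Re z)\<^sup>2 + (Im z)\<^sup>2 = 1 \<and> 0 \<le> s * Im z}"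
      using sq[OF t(1,2)] that by (simp add: t(3) c_def power_mult_distrib)
  next
    fix z assume "z \<in> {z. (Re z)\<^sup>2 + (Im z)\<^sup>2 = 1 \<and> 0 \<le> s * Im z}"
    then have z: "(Re z)\<^sup>2 + (Im z)\<^sup>2 = 1" "0 \<le> s * Im z" by auto
    have "(Re z)\<^sup>2 \<le> 1" using z(1) zero_le_power2[of "Im z"] by linarith
    then have r: "\<bar>Re z\<bar> \<le> 1" by (simp add: abs_square_le_1)
    have "1 - (Re z)\<^sup>2 = (s * Im z)\<^sup>2" using z that by (simp add: power_mult_distrib)
    then have "s * sqrt (1 - (Re z)\<^sup>2) = s * (s * Im z)" using z by simp
    also have "\<dots> = Im z" using that by (simp add: power2_eq_square flip: mult.assoc)
    finally have "s * sqrt (1 - (Re z)\<^sup>2) = Im z" .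
    moreover have "2 * ((Re z + 1) / 2) - 1 = Re z" by argo
    ultimately have "z = c s ((Re z + 1) / 2)"
      by (simp only: c_def complex_eq_iff complex.sel)
    moreover have "(Re z + 1) / 2 \<in> {0..1}" using r by auto
    ultimately show "z \<in> path_image (c s)"
      by (metis imageI path_image_def)
  qed
  have seg: "path_image (linepath (-1) 1) = {z::complex. Im z = 0 \<and> -1 \<le> Re z \<and> Re z \<le> 1}"
    using mem_real_segment[of "-1" 1] by auto
  have sph: "sphere 0 1 = {z::complex. (Re z)\<^sup>2 + (Im z)\<^sup>2 = 1}"
    using mem_sphere_complex[of _ 0] by (simp add: set_eq_iff del: mem_sphere)
  show thesis
  proof (rule that[of "c 1" "c (-1)" "linepath (-1) 1"])
    have "z \<in> {-1, 1} \<longleftrightarrow> (Re z)\<^sup>2 + (Im z)\<^sup>2 = 1 \<and> Im z = 0" for z :: complex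
      by (auto simp: complex_eq_iff power2_eq_1_iff)
    moreover have "-1 \<le> Re z \<and> Re z \<le> 1" if "(Re z)\<^sup>2 = 1" for z :: complex
      using that by (auto simp: power2_eq_1_iff)
    ultimately show "path_image (c 1) \<inter> path_image (c (-1)) = {-1, 1}"
         "path_image (c 1) \<inter> path_image (linepath (-1) 1) = {-1, 1}"
         "path_image (c (-1)) \<inter> path_image (linepath (-1) 1) = {-1, 1}"
      unfolding im[of 1, simplified] im[of "-1", simplified] seg by (fastforce simp: set_eq_iff)+
    show "theta_curve = path_image (c 1) \<union> path_image (c (-1)) \<union> path_image (linepath (-1) 1)"
      unfolding theta_curve_def sph im[of 1, simplified] im[of "-1", simplified] path_image_linepath
      by auto
  qed (simp_all add: arcc ends arc_linepath)
qed

end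

theory Submission
  imports Defs
begin

text \<open>Mark a set of vertices containing all those whose degree is not 2. Following edges through
  unmarked vertices decomposes a connected 1-complex into threads: open arcs ending at marked vertices
  or running off to infinity; two threads agree or are disjoint. Let an arc contain the midpoints of a
  set of threads at branch vertices. At a branch vertex at most two of the incident half-threads lie in
  the arc, every other half-thread contains an end of the arc in its thread, and so does every thread
  that runs to infinity or to a leaf. As an arc has two ends, the sum of \<open>deg v - 2\<close> over the chosen
  half-threads plus the number of dead ends is at most 2. Seven points suffice to exclude vertices of
  degree 5, a vertex of degree 4 together with another branch vertex, and three branch vertices
  (nine half-threads, two pairs of which share a thread). The few remaining patterns of threads
  are exactly the listed spaces, which are identified as quotients of the same disjoint sum of intervals.
  Conversely, in each listed space there are arcs missing only arbitrarily short open pieces.\<close>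

section \<open>The topology of the 1-complex\<close>

text \<open>The count is taken over half-threads and not over threads. A thread between two branch
  vertices is charged once from each side but costs only one of the seven points, since its two
  halves share their midpoint. Seven is the size of the worst pattern: 5 half-threads at one vertex,
  4 + 3 at two vertices, 9 - 2 midpoints at three; in each of them the sum of
  \<open>deg v - 2\<close> over the chosen half-threads is 3. What shapes the proof is that degrees
  and threads may be infinite, so the complex need be neither compact nor locally finite. Its
  topology is therefore handled through two facts only: openness can be tested along single edges or
  threads, and the image of an open thread is open, so that an arc can be compared there with an
  interval of the line. The delicate point of the count is a thread that is charged twice. The arc
  is then confined to this thread, being connected, and the thread pays with both ends. A graph
  whose degrees are all 2 has no vertex that must be marked. An arbitrary one is marked there, which
  is why the marked set is a parameter.\<close>

definition darts :: "'v set set \<Rightarrow> ('v \<times> 'v) set" where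
  "darts E = {(x, y). {x, y} \<in> E}"

text \<open>Each edge is glued along an arbitrary choice of its start. Measuring the parameter from
  the tail of a dart makes this choice invisible in all that follows, so that walks can pass an edge
  in either direction.\<close>

definition edge_pt :: "'v \<times> 'v \<Rightarrow> real \<Rightarrow> ('v + 'v set) \<times> real" where
  "edge_pt \<delta> s =
     (if s = 0 then (Inl (fst \<delta>), 0) else if s = 1 then (Inl (snd \<delta>), 0)
      else (Inr {fst \<delta>, snd \<delta>}, if edge_start {fst \<delta>, snd \<delta>} = fst \<delta> then s else 1 - s))"

text \<open>The vertex summands are one-point spaces, all of whose subsets are open, so only the
  edges impose a condition. At a vertex of infinite degree no uniformity between the incident edges
  is demanded.\<close>

lemma openin_one_complex:
  "openin (one_complex V E) U \<longleftrightarrow> U \<subseteq> topspace (one_complex V E) \<and>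
     (\<forall>e\<in>E. openin (top_of_set {0..1}) {t \<in> {0..1}. glue (Inr e, t) \<in> U})"
proof -
  have 1: "{t. (i, t) \<in> {x \<in> topspace (pre_complex V E). glue x \<in> U}} =
      (case i of Inl v \<Rightarrow> {t \<in> {0}. glue (Inl v, t) \<in> U} | Inr e \<Rightarrow> {t \<in> {0..1}. glue (Inr e, t) \<in> U})"
    if "i \<in> V <+> E" for i
    using that by (auto simp: pre_complex_def split: sum.splits)
  have 2: "openin (top_of_set {0::real}) {t \<in> {0}. glue (Inl v, t) \<in> U}" for v :: 'a
  proof -
    have "{t \<in> {0::real}. glue (Inl v, t) \<in> U} = {0} \<inter> (if (Inl v, 0) \<in> U then UNIV else {})"
      by (cases "(Inl v, 0) \<in> U") auto
    moreover have "open (if (Inl v, 0) \<in> U then UNIV else {} :: real set)"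
      by simp
    ultimately show ?thesis
      by (simp only: openin_open_Int)
  qed
  have "openin (pre_complex V E) {x \<in> topspace (pre_complex V E). glue x \<in> U} \<longleftrightarrow>
    (\<forall>i\<in>V <+> E. openin (case i of Inl v \<Rightarrow> top_of_set {0} | Inr e \<Rightarrow> top_of_set {0..1})
        {t. (i, t) \<in> {x \<in> topspace (pre_complex V E). glue x \<in> U}})"
    unfolding pre_complex_def openin_sum_topology by auto
  also have "\<dots> \<longleftrightarrow> (\<forall>i\<in>V <+> E. openin (case i of Inl v \<Rightarrow> top_of_set {0} | Inr e \<Rightarrow> top_of_set {0..1})
      (case i of Inl v \<Rightarrow> {t \<in> {0}. glue (Inl v, t) \<in> U} | Inr e \<Rightarrow> {t \<in> {0..1}. glue (Inr e, t) \<in> U}))"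
    by (intro ball_cong refl) (simp only: 1)
  also have "\<dots> \<longleftrightarrow> (\<forall>e\<in>E. openin (top_of_set {0..1}) {t \<in> {0..1}. glue (Inr e, t) \<in> U})"
    unfolding Plus_def ball_Un ball_simps(9) sum.case using 2 by blast
  finally show ?thesis
    unfolding one_complex_def openin_quotient_topology by simp
qed

lemma darts_swap [simp]: "prod.swap \<delta> \<in> darts E \<longleftrightarrow> \<delta> \<in> darts E"
  by (cases \<delta>) (auto simp: darts_def insert_commute)

locale graph_complex =
  fixes V :: "'v set" and E :: "'v set set"
  assumes graph: "graph V E"
begin

abbreviation X :: "(('v + 'v set) \<times> real) topology" where
  "X \<equiv> one_complex V E"

lemma dart_neq: "\<delta> \<in> darts E \<Longrightarrow> fst \<delta> \<noteq> snd \<delta>"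
  using graph by (auto simp: graph_def darts_def nsets_def)

lemma dart_verts: "\<delta> \<in> darts E \<Longrightarrow> fst \<delta> \<in> V" "\<delta> \<in> darts E \<Longrightarrow> snd \<delta> \<in> V"
  using graph by (auto simp: graph_def darts_def nsets_def)

lemma dart_ends:
  assumes "\<delta> \<in> darts E"
  shows "edge_start {fst \<delta>, snd \<delta>} = fst \<delta> \<and> edge_end {fst \<delta>, snd \<delta>} = snd \<delta> \<or>
    edge_start {fst \<delta>, snd \<delta>} = snd \<delta> \<and> edge_end {fst \<delta>, snd \<delta>} = fst \<delta>"
proof -
  define e where "e = {fst \<delta>, snd \<delta>}"
  have "e \<in> E"
    using assms by (auto simp: darts_def e_def)
  from edge_ends(1)[OF graph this] have "{fst \<delta>, snd \<delta>} = {edge_start e, edge_end e}"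
    unfolding e_def[symmetric] .
  from iffD1[OF doubleton_eq_iff this] show ?thesis
    unfolding e_def[symmetric] by auto
qed

lemma edge_dart:
  assumes "e \<in> E" shows "\<exists>\<delta>\<in>darts E. e = {fst \<delta>, snd \<delta>}"
proof -
  obtain a b where "e = {a, b}"
    using edge_ends(1)[OF graph assms] by blast
  then show ?thesis
    using assms by (intro bexI[of _ "(a, b)"]) (auto simp: darts_def)
qed

lemma glue_eq_edge_pt:
  assumes "\<delta> \<in> darts E"
  shows "glue (Inr {fst \<delta>, snd \<delta>}, t) = edge_pt \<delta> (if edge_start {fst \<delta>, snd \<delta>} = fst \<delta> then t else 1 - t)"
  using dart_ends[OF assms] dart_neq[OF assms] by (auto simp: edge_pt_def)

lemma edge_pt_eq_glue:
  assumes "\<delta> \<in> darts E"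
  shows "edge_pt \<delta> t = glue (Inr {fst \<delta>, snd \<delta>}, if edge_start {fst \<delta>, snd \<delta>} = fst \<delta> then t else 1 - t)"
  using dart_ends[OF assms] dart_neq[OF assms] by (auto simp: edge_pt_def)

lemma topspace_X: "topspace X = (\<lambda>v. (Inl v, 0)) ` V \<union> (\<Union>e\<in>E. (\<lambda>t. (Inr e, t)) ` {0<..<1})"
  (is "_ = ?R")
proof -
  have "glue x \<in> ?R" if x: "x \<in> topspace (pre_complex V E)" for x
  proof -
    from x consider v where "v \<in> V" "x = (Inl v, 0)" | e t where "e \<in> E" "x = (Inr e, t)" "0 \<le> t" "t \<le> 1"
      by (force simp: pre_complex_def split: sum.splits)
    then show ?thesis
    proof cases
      case (2 e t)
      then have "edge_start e \<in> V" "edge_end e \<in> V"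
        using edge_ends[OF graph 2(1)] graph by (auto simp: graph_def nsets_def)
      moreover have "(Inr e, t) \<in> (\<Union>e\<in>E. (\<lambda>t. (Inr e, t)) ` {0<..<1})" if "t \<noteq> 0" "t \<noteq> 1"
        using 2 that by force
      ultimately show ?thesis
        using 2(2) by auto
    qed auto
  qed
  moreover have "x \<in> glue ` topspace (pre_complex V E)" if "x \<in> ?R" for x
    using that by (intro image_eqI[of _ _ x]) (auto simp: pre_complex_def split: sum.splits)
  ultimately show ?thesis
    unfolding one_complex_def topspace_quotient_topology by blast
qed

lemma vertex_in_X: "v \<in> V \<Longrightarrow> (Inl v, 0) \<in> topspace X"
  by (simp add: topspace_X)

lemma X_cases:
  assumes "x \<in> topspace X"
  obtains v where "v \<in> V" "x = (Inl v, 0)"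
    | \<delta> t where "\<delta> \<in> darts E" "0 < t" "t < 1" "x = edge_pt \<delta> t"
proof -
  consider v where "v \<in> V" "x = (Inl v, 0)" | e t where "e \<in> E" "0 < t" "t < 1" "x = (Inr e, t)"
    using assms unfolding topspace_X by auto
  then show thesis
  proof cases
    case 1
    then show thesis
      using that(1) by blast
  next
    case (2 e t)
    obtain \<delta> where \<delta>: "\<delta> \<in> darts E" "e = {fst \<delta>, snd \<delta>}"
      using edge_dart[OF 2(1)] by blast
    define s where "s = (if edge_start {fst \<delta>, snd \<delta>} = fst \<delta> then t else 1 - t)"
    have "x = glue (Inr e, t)"
      using 2 by simp
    then have "x = edge_pt \<delta> s"
      unfolding \<delta>(2) glue_eq_edge_pt[OF \<delta>(1)] s_def .
    moreover have "0 < s" "s < 1"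
      using 2 by (auto simp: s_def)
    ultimately show thesis
      using that(2)[OF \<delta>(1)] by blast
  qed
qed

lemma edge_pt_in_X:
  assumes "\<delta> \<in> darts E" "0 \<le> t" "t \<le> 1" shows "edge_pt \<delta> t \<in> topspace X"
proof (cases "t = 0 \<or> t = 1")
  case True
  then show ?thesis
    using dart_verts[OF assms(1)] vertex_in_X by (auto simp: edge_pt_def)
next
  case False
  moreover have "{fst \<delta>, snd \<delta>} \<in> E"
    using assms(1) by (auto simp: darts_def)
  then have "(Inr {fst \<delta>, snd \<delta>}, s) \<in> topspace X" if "0 < s" "s < 1" for s
    unfolding topspace_X using that by (intro UnI2 UN_I) auto
  ultimately show ?thesis
    using assms by (auto simp: edge_pt_def)
qed

declare glue.simps(2) [simp del]

lemma glue_in_X: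
  assumes "e \<in> E" "t \<in> {0..1}" shows "glue (Inr e, t) \<in> topspace X"
proof -
  obtain \<delta> where \<delta>: "\<delta> \<in> darts E" "e = {fst \<delta>, snd \<delta>}"
    using edge_dart[OF assms(1)] by blast
  show ?thesis
    unfolding \<delta>(2) glue_eq_edge_pt[OF \<delta>(1)] using edge_pt_in_X[OF \<delta>(1)] assms(2) by auto
qed

lemma edge_pt_swap: "\<delta> \<in> darts E \<Longrightarrow> edge_pt (prod.swap \<delta>) t = edge_pt \<delta> (1 - t)"
  using dart_ends[of \<delta>] dart_neq[of \<delta>] by (auto simp: edge_pt_def insert_commute)

lemma edge_pt_eq_iff:
  assumes "\<delta> \<in> darts E" "\<delta>' \<in> darts E" "0 < t" "t < 1" "0 \<le> t'" "t' \<le> 1" "edge_pt \<delta> t = edge_pt \<delta>' t'"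
  shows "\<delta>' = \<delta> \<and> t' = t \<or> \<delta>' = prod.swap \<delta> \<and> t' = 1 - t"
proof -
  have t': "t' \<noteq> 0" "t' \<noteq> 1" and e: "{fst \<delta>, snd \<delta>} = {fst \<delta>', snd \<delta>'}"
    using assms by (auto simp: edge_pt_def split: if_splits)
  then consider "\<delta>' = \<delta>" | "\<delta>' = prod.swap \<delta>"
    by (cases \<delta>; cases \<delta>') (auto simp: doubleton_eq_iff)
  then show ?thesis
  proof cases
    case 1
    then show ?thesis
      using assms t' by (auto simp: edge_pt_def split: if_splits)
  next
    case 2
    then have "edge_pt \<delta> t = edge_pt \<delta> (1 - t')"
      using assms edge_pt_swap by auto
    with 2 show ?thesis
      using assms t' by (auto simp: edge_pt_def split: if_splits)
  qed
qed

lemma continuous_map_from_edge_pt: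
  assumes "\<delta> \<in> darts E" shows "continuous_map (top_of_set {0..1}) X (edge_pt \<delta>)"
proof -
  let ?r = "\<lambda>t::real. if edge_start {fst \<delta>, snd \<delta>} = fst \<delta> then t else 1 - t"
  let ?e = "{fst \<delta>, snd \<delta>}"
  have e: "?e \<in> E"
    using assms by (auto simp: darts_def)
  have "openin (top_of_set {0..1}) {t \<in> {0..1}. edge_pt \<delta> t \<in> U}" if "openin X U" for U
  proof -
    have "openin (top_of_set {0..1}) {t \<in> {0..1}. glue (Inr ?e, t) \<in> U}"
      using that e unfolding openin_one_complex by blast
    moreover have "continuous_map (top_of_set {0..1}) (top_of_set {0..1::real}) ?r"
      by (auto intro!: continuous_intros)
    ultimately have "openin (top_of_set {0..1}) {t \<in> topspace (top_of_set {0..1::real}). ?r t \<in> {t \<in> {0..1}. glue (Inr ?e, t) \<in> U}}"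
      by (rule openin_continuous_map_preimage[rotated])
    also have "{t \<in> topspace (top_of_set {0..1::real}). ?r t \<in> {t \<in> {0..1}. glue (Inr ?e, t) \<in> U}} = {t \<in> {0..1}. edge_pt \<delta> t \<in> U}"
      unfolding edge_pt_eq_glue[OF assms] by auto
    finally show ?thesis .
  qed
  then show ?thesis
    using edge_pt_in_X[OF assms] by (auto simp: continuous_map_def)
qed

text \<open>Reversing the parameter is a homeomorphism of the unit interval, so one direction of
  each edge suffices as a test. This admits families of threads that pass each edge in only one
  direction.\<close>

lemma openin_X_darts:
  assumes cov: "\<And>\<delta>. \<delta> \<in> darts E \<Longrightarrow> \<delta> \<in> \<Delta> \<or> prod.swap \<delta> \<in> \<Delta>"
    and U: "U \<subseteq> topspace X"
    and op: "\<And>\<delta>. \<delta> \<in> \<Delta> \<Longrightarrow> \<delta> \<in> darts E \<Longrightarrow> openin (top_of_set {0..1}) {t \<in> {0..1}. edge_pt \<delta> t \<in> U}"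
  shows "openin X U"
  unfolding openin_one_complex
proof (intro conjI ballI U)
  fix e assume "e \<in> E"
  then obtain \<delta>' where "\<delta>' \<in> darts E" "e = {fst \<delta>', snd \<delta>'}"
    using edge_dart by blast
  then have "\<exists>\<delta>. \<delta> \<in> darts E \<and> \<delta> \<in> \<Delta> \<and> e = {fst \<delta>, snd \<delta>}"
    using cov[of \<delta>'] by (metis darts_swap fst_swap insert_commute snd_swap)
  then obtain \<delta> where \<delta>: "\<delta> \<in> darts E" "\<delta> \<in> \<Delta>" "e = {fst \<delta>, snd \<delta>}"
    by blast
  let ?r = "\<lambda>t::real. if edge_start e = fst \<delta> then t else 1 - t"
  have "continuous_map (top_of_set {0..1}) (top_of_set {0..1::real}) ?r"
    by (auto intro!: continuous_intros)
  then have "openin (top_of_set {0..1}) {t \<in> topspace (top_of_set {0..1::real}). ?r t \<in> {t \<in> {0..1}. edge_pt \<delta> t \<in> U}}"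
    using op[OF \<delta>(2,1)] by (rule openin_continuous_map_preimage)
  also have "{t \<in> topspace (top_of_set {0..1::real}). ?r t \<in> {t \<in> {0..1}. edge_pt \<delta> t \<in> U}} = {t \<in> {0..1}. glue (Inr e, t) \<in> U}"
    unfolding \<delta>(3) glue_eq_edge_pt[OF \<delta>(1)] by auto
  finally show "openin (top_of_set {0..1}) {t \<in> {0..1}. glue (Inr e, t) \<in> U}" .
qed

lemma continuous_map_from_X:
  assumes "\<And>x. x \<in> topspace X \<Longrightarrow> f x \<in> topspace Y"
    and "\<And>e. e \<in> E \<Longrightarrow> continuous_map (top_of_set {0..1}) Y (\<lambda>t. f (glue (Inr e, t)))"
  shows "continuous_map X Y f"
  unfolding continuous_map_def
proof (intro conjI allI impI)
  fix U assume U: "openin Y U"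
  show "openin X {x \<in> topspace X. f x \<in> U}"
    unfolding openin_one_complex
  proof (intro conjI ballI)
    fix e assume e: "e \<in> E"
    then have "{t \<in> {0..1}. glue (Inr e, t) \<in> {x \<in> topspace X. f x \<in> U}} = {t \<in> {0..1}. f (glue (Inr e, t)) \<in> U}"
      using glue_in_X by blast
    with assms(2)[OF e] U show "openin (top_of_set {0..1}) {t \<in> {0..1}. glue (Inr e, t) \<in> {x \<in> topspace X. f x \<in> U}}"
      by (simp add: continuous_map_def)
  qed auto
qed (use assms in auto)

text \<open>A tent: for a vertex it falls linearly to 0 along every incident edge, for an inner
  point it lives on that one edge. Continuity is checked edge by edge, so infinitely many incident
  edges do no harm. Points are then separated by values of tents.\<close>

lemma peak_function:
  assumes "x \<in> topspace X"
  obtains f where "continuous_map X euclideanreal f" "\<And>y. y \<in> topspace X \<Longrightarrow> f y = 1 \<longleftrightarrow> y = x"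
proof -
  consider v where "v \<in> V" "x = (Inl v, 0)" | e s where "e \<in> E" "0 < s" "s < 1" "x = (Inr e, s)"
    using assms unfolding topspace_X by auto
  then show thesis
  proof cases
    case (1 v)
    define f :: "('v + 'v set) \<times> real \<Rightarrow> real" where
      "f y = (case fst y of Inl u \<Rightarrow> of_bool (u = v) |
         Inr e \<Rightarrow> if edge_start e = v then 1 - snd y else if edge_end e = v then snd y else 0)" for y
    have "continuous_map (top_of_set {0..1}) euclideanreal (\<lambda>t. f (glue (Inr e, t)))" if "e \<in> E" for e
    proof -
      have "f (glue (Inr e, t)) = (if edge_start e = v then 1 - t else if edge_end e = v then t else 0)" for t
        using edge_ends(2)[OF graph that] by (auto simp: f_def glue.simps(2))
      then show ?thesis
        by (cases "edge_start e = v"; cases "edge_end e = v") (simp_all add: continuous_intros)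
    qed
    then have "continuous_map X euclideanreal f"
      by (rule continuous_map_from_X[rotated]) auto
    moreover have "f y = 1 \<longleftrightarrow> y = x" if "y \<in> topspace X" for y
      using that 1 unfolding topspace_X by (auto simp: f_def split: if_splits)
    ultimately show thesis
      using that by blast
  next
    case (2 e0 s)
    define f :: "('v + 'v set) \<times> real \<Rightarrow> real" where
      "f y = (case fst y of Inl u \<Rightarrow> 0 |
         Inr e \<Rightarrow> if e = e0 then min (snd y / s) ((1 - snd y) / (1 - s)) else 0)" for y
    have "continuous_map (top_of_set {0..1}) euclideanreal (\<lambda>t. f (glue (Inr e, t)))" if "e \<in> E" for e
    proof -
      have "f (glue (Inr e, t)) = (if e = e0 then min (t / s) ((1 - t) / (1 - s)) else 0)" for t
        using 2 by (auto simp: f_def min_def glue.simps(2))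
      then show ?thesis
        using 2 by (cases "e = e0") (auto intro!: continuous_intros)
    qed
    then have "continuous_map X euclideanreal f"
      by (rule continuous_map_from_X[rotated]) auto
    moreover have "f y = 1 \<longleftrightarrow> y = x" if "y \<in> topspace X" for y
      using that 2 unfolding topspace_X by (auto simp: f_def min_def field_simps split: if_splits)
    ultimately show thesis
      using that by blast
  qed
qed

lemma Hausdorff_X: "Hausdorff_space X"
  unfolding Hausdorff_space_def
proof (intro allI impI, elim conjE)
  fix x y assume x: "x \<in> topspace X" and y: "y \<in> topspace X" and xy: "x \<noteq> y"
  obtain f where f: "continuous_map X euclideanreal f" "\<And>y. y \<in> topspace X \<Longrightarrow> f y = 1 \<longleftrightarrow> y = x"
    using peak_function[OF x] by metis
  then have "f x \<noteq> f y"
    using x y xy by metis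
  from hausdorff[OF this] obtain A B
    where AB: "open A" "open B" "f x \<in> A" "f y \<in> B" "A \<inter> B = {}"
    by metis
  have "openin X {z \<in> topspace X. f z \<in> A}" "openin X {z \<in> topspace X. f z \<in> B}"
    using f(1) AB by (auto simp: continuous_map_def)
  then show "\<exists>U V. openin X U \<and> openin X V \<and> x \<in> U \<and> y \<in> V \<and> disjnt U V"
    using AB x y by (intro exI[of _ "{z \<in> topspace X. f z \<in> A}"] exI[of _ "{z \<in> topspace X. f z \<in> B}"])
      (auto simp: disjnt_iff)
qed

text \<open>A set of vertices meets every edge in at most its two ends.\<close>

lemma closedin_vertices:
  assumes "W \<subseteq> (\<lambda>v. (Inl v, 0)) ` V" shows "closedin X W"
proof -
  have "openin X (topspace X - W)"
    unfolding openin_one_complex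
  proof (intro conjI ballI)
    fix e assume e: "e \<in> E"
    have "finite {t \<in> {0..1}. glue (Inr e, t) \<in> W}"
      by (rule finite_subset[of _ "{0, 1}"]) (use assms in \<open>auto simp: glue.simps(2)\<close>)
    then have "closedin (top_of_set {0..1}) {t \<in> {0..1}. glue (Inr e, t) \<in> W}"
      by (intro closed_subset finite_imp_closed) auto
    then have "openin (top_of_set {0..1}) ({0..1} - {t \<in> {0..1}. glue (Inr e, t) \<in> W})"
      by (simp add: closedin_def)
    also have "{0..1} - {t \<in> {0..1}. glue (Inr e, t) \<in> W} = {t \<in> {0..1}. glue (Inr e, t) \<in> topspace X - W}"
      using glue_in_X[OF e] by blast
    finally show "openin (top_of_set {0..1}) {t \<in> {0..1}. glue (Inr e, t) \<in> topspace X - W}" .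
  qed auto
  moreover have "W \<subseteq> topspace X"
    using assms topspace_X by auto
  ultimately show ?thesis
    by (simp add: closedin_def)
qed

end

section \<open>Threads\<close>

definition nbrs :: "'v set set \<Rightarrow> 'v \<Rightarrow> 'v set" where
  "nbrs E v = {w. {v, w} \<in> E}"

text \<open>The marked set contains every vertex of degree other than 2 but may contain more,
  because a 2-regular graph has to be cut open somewhere. Since \<open>card\<close> of an infinite
  set is 0, vertices of infinite degree are always marked.\<close>

locale threads = graph_complex V E for V :: "'v set" and E +
  fixes M :: "'v set"
  assumes M_sub: "M \<subseteq> V"
    and deg2: "\<And>v. v \<in> V \<Longrightarrow> v \<notin> M \<Longrightarrow> card (nbrs E v) = 2"
begin

text \<open>Going straight on at the head of a dart. The choice is meaningful at an unmarked head,
  where exactly one neighbour other than the tail exists.\<close>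

definition next_dart :: "'v \<times> 'v \<Rightarrow> 'v \<times> 'v" where
  "next_dart \<delta> = (snd \<delta>, SOME z. {snd \<delta>, z} \<in> E \<and> z \<noteq> fst \<delta>)"

lemma fst_next_dart [simp]: "fst (next_dart \<delta>) = snd \<delta>"
  by (simp add: next_dart_def)

lemma next_dart:
  assumes "\<delta> \<in> darts E" "snd \<delta> \<notin> M"
  shows "next_dart \<delta> \<in> darts E" "snd (next_dart \<delta>) \<noteq> fst \<delta>" "nbrs E (snd \<delta>) = {fst \<delta>, snd (next_dart \<delta>)}"
proof -
  have "card (nbrs E (snd \<delta>)) = 2"
    using assms dart_verts deg2 by blast
  moreover have f: "fst \<delta> \<in> nbrs E (snd \<delta>)"
    using assms(1) by (auto simp: nbrs_def darts_def insert_commute)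
  ultimately obtain z where z: "nbrs E (snd \<delta>) = {fst \<delta>, z}" "z \<noteq> fst \<delta>"
    by (auto simp: card_2_iff doubleton_eq_iff)
  then have "z \<in> nbrs E (snd \<delta>)"
    by blast
  then have "\<exists>z. {snd \<delta>, z} \<in> E \<and> z \<noteq> fst \<delta>"
    using z by (auto simp: nbrs_def)
  from someI_ex[OF this] have *: "{snd \<delta>, snd (next_dart \<delta>)} \<in> E" "snd (next_dart \<delta>) \<noteq> fst \<delta>"
    by (auto simp: next_dart_def)
  then show "next_dart \<delta> \<in> darts E" "snd (next_dart \<delta>) \<noteq> fst \<delta>"
    by (auto simp: darts_def next_dart_def)
  have "snd (next_dart \<delta>) \<in> nbrs E (snd \<delta>)"
    using * by (auto simp: nbrs_def)
  then show "nbrs E (snd \<delta>) = {fst \<delta>, snd (next_dart \<delta>)}"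
    using z * by auto
qed

lemma dart_at:
  assumes "\<delta> \<in> darts E" "snd \<delta> \<notin> M" "\<delta>' \<in> darts E" "fst \<delta>' = snd \<delta>"
  shows "\<delta>' = next_dart \<delta> \<or> \<delta>' = prod.swap \<delta>"
proof -
  have "snd \<delta>' \<in> nbrs E (snd \<delta>)"
    using assms by (auto simp: nbrs_def darts_def)
  then have "snd \<delta>' = fst \<delta> \<or> snd \<delta>' = snd (next_dart \<delta>)"
    using next_dart(3)[OF assms(1,2)] by auto
  then show ?thesis
    using assms by (auto simp: prod_eq_iff)
qed

text \<open>At an unmarked vertex going on and turning round merely exchange the two incident edges,
  so every step of a walk can be retraced.\<close>

lemma next_dart_swap_next_dart:
  assumes "\<delta> \<in> darts E" "snd \<delta> \<notin> M"
  shows "next_dart (prod.swap (next_dart \<delta>)) = prod.swap \<delta>"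
proof -
  let ?\<epsilon> = "prod.swap (next_dart \<delta>)"
  have \<epsilon>: "?\<epsilon> \<in> darts E" "snd ?\<epsilon> \<notin> M"
    using next_dart(1)[OF assms] assms by simp_all
  have "nbrs E (snd \<delta>) = {snd (next_dart \<delta>), snd (next_dart ?\<epsilon>)}"
    using next_dart(3)[OF \<epsilon>] by simp
  then have "snd (next_dart ?\<epsilon>) = fst \<delta>"
    using next_dart(2)[OF assms] next_dart(3)[OF assms] by (auto simp: doubleton_eq_iff)
  then show ?thesis
    by (simp add: prod_eq_iff)
qed

lemma next_dart_inj:
  assumes "\<delta> \<in> darts E" "snd \<delta> \<notin> M" "\<delta>' \<in> darts E" "snd \<delta>' \<notin> M" "next_dart \<delta> = next_dart \<delta>'"
  shows "\<delta> = \<delta>'"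
  by (metis assms next_dart_swap_next_dart swap_swap)

text \<open>The half-threads: a thread seen from one of its marked ends is named by its first
  dart.\<close>

definition D :: "('v \<times> 'v) set" where "D = {\<delta> \<in> darts E. fst \<delta> \<in> M}"

definition walk :: "'v \<times> 'v \<Rightarrow> nat \<Rightarrow> 'v \<times> 'v" where "walk d i = (next_dart ^^ i) d"

text \<open>The positions that belong to the thread. A later value of \<open>walk\<close>, past the
  first arrival at a marked vertex, carries no meaning.\<close>

definition idx :: "'v \<times> 'v \<Rightarrow> nat set" where "idx d = {i. \<forall>j<i. snd (walk d j) \<notin> M}"

definition fin :: "'v \<times> 'v \<Rightarrow> bool" where "fin d \<longleftrightarrow> (\<exists>i. snd (walk d i) \<in> M)"

text \<open>The index of the last dart, so a finite thread has \<open>len d + 1\<close> edges.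
  Meaningful under \<open>fin d\<close>.\<close>

definition len :: "'v \<times> 'v \<Rightarrow> nat" where "len d = (LEAST i. snd (walk d i) \<in> M)"

text \<open>The same thread seen from its other end; meaningful under \<open>fin d\<close>.\<close>

definition rv :: "'v \<times> 'v \<Rightarrow> 'v \<times> 'v" where "rv d = prod.swap (walk d (len d))"

lemma walk_0 [simp]: "walk d 0 = d"
  by (simp add: walk_def)

lemma walk_Suc: "walk d (Suc i) = next_dart (walk d i)"
  by (simp add: walk_def)

lemma fst_walk_Suc [simp]: "fst (walk d (Suc i)) = snd (walk d i)"
  by (simp add: walk_Suc)

lemma idx_0 [simp]: "0 \<in> idx d"
  by (simp add: idx_def)

lemma idx_Suc: "Suc i \<in> idx d \<longleftrightarrow> i \<in> idx d \<and> snd (walk d i) \<notin> M"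
  by (auto simp: idx_def less_Suc_eq)

lemma len_last: "fin d \<Longrightarrow> snd (walk d (len d)) \<in> M"
  unfolding fin_def len_def by (rule LeastI_ex)

lemma idx_fin: "fin d \<Longrightarrow> i \<in> idx d \<longleftrightarrow> i \<le> len d"
proof
  assume "fin d" and i: "i \<in> idx d"
  then have "snd (walk d (len d)) \<in> M"
    by (intro len_last)
  with i show "i \<le> len d"
    by (auto simp: idx_def not_less[symmetric])
next
  assume "i \<le> len d"
  then have "snd (walk d j) \<notin> M" if "j < i" for j
    unfolding len_def using that by (intro not_less_Least) simp
  then show "i \<in> idx d"
    by (simp add: idx_def)
qed

lemma idx_inf: "\<not> fin d \<Longrightarrow> i \<in> idx d"
  by (auto simp: idx_def fin_def)

lemma len_eqI:
  assumes "i \<in> idx d" "snd (walk d i) \<in> M" shows "fin d \<and> len d = i"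
proof -
  have f: "fin d"
    using assms by (auto simp: fin_def)
  then have "i \<le> len d"
    using assms(1) idx_fin by blast
  moreover have "len d \<le> i"
    unfolding len_def using assms(2) by (rule Least_le)
  ultimately show ?thesis
    using f by simp
qed

lemma walk_dart: "d \<in> D \<Longrightarrow> i \<in> idx d \<Longrightarrow> walk d i \<in> darts E"
proof (induction i)
  case 0
  then show ?case by (simp add: D_def)
next
  case (Suc i)
  then show ?case
    using next_dart(1)[of "walk d i"] by (simp add: idx_Suc walk_Suc)
qed

lemma D_M: "d \<in> D \<Longrightarrow> fst d \<in> M"
  by (auto simp: D_def)

text \<open>Two walks through a common dart are traced back together, since \<open>next_dart\<close>
  is injective at unmarked heads. They reach their starts simultaneously, because a first dart has a
  marked tail and all later ones have unmarked tails.\<close>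

lemma walk_eq:
  assumes "d \<in> D" "d' \<in> D" "i \<in> idx d" "j \<in> idx d'" "walk d i = walk d' j"
  shows "d = d' \<and> i = j"
  using assms(3-5)
proof (induction i arbitrary: j)
  case 0
  show ?case
  proof (cases j)
    case (Suc j')
    then have "snd (walk d' j') \<notin> M" "fst d = snd (walk d' j')"
      using 0 by (auto simp: idx_Suc)
    then show ?thesis
      using D_M[OF assms(1)] by simp
  qed (use 0 in simp)
next
  case (Suc i)
  show ?case
  proof (cases j)
    case 0
    then have "snd (walk d i) \<notin> M" "fst d' = snd (walk d i)"
      using Suc.prems by (auto simp: idx_Suc dest: arg_cong[of _ _ fst])
    then show ?thesis
      using D_M[OF assms(2)] by simp
  next
    case j: (Suc j')
    have i: "i \<in> idx d" "snd (walk d i) \<notin> M" and j': "j' \<in> idx d'" "snd (walk d' j') \<notin> M"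
      using Suc.prems unfolding j idx_Suc by blast+
    have "next_dart (walk d i) = next_dart (walk d' j')"
      using Suc.prems unfolding j walk_Suc by blast
    then have "walk d i = walk d' j'"
      using next_dart_inj[OF walk_dart[OF assms(1) i(1)] i(2) walk_dart[OF assms(2) j'(1)] j'(2)] by blast
    then show ?thesis
      using Suc.IH[OF i(1) j'(1)] j by simp
  qed
qed

text \<open>A step back on \<open>d'\<close> is a step forward on \<open>d\<close>, so the induction
  on \<open>j\<close> pushes the meeting to the start of \<open>d'\<close>. The tail there is
  marked, and hence it is where \<open>d\<close> ends.\<close>

lemma walk_swap:
  assumes "d \<in> D" "d' \<in> D" "i \<in> idx d" "j \<in> idx d'" "prod.swap (walk d i) = walk d' j"
  shows "fin d \<and> d' = rv d \<and> i + j = len d"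
  using assms(3-5)
proof (induction j arbitrary: i)
  case 0
  then have "snd (walk d i) \<in> M"
    using D_M[OF assms(2)] by (metis walk_0 fst_swap)
  then show ?case
    using len_eqI[OF 0(1)] 0 by (auto simp: rv_def)
next
  case (Suc j)
  have j: "j \<in> idx d'" "snd (walk d' j) \<notin> M" "snd (walk d i) = snd (walk d' j)"
    using Suc.prems by (auto simp: idx_Suc dest: arg_cong[of _ _ fst])
  have di: "walk d i \<in> darts E" "snd (walk d i) \<notin> M" and dj: "walk d' j \<in> darts E"
    using Suc.prems j walk_dart assms by auto
  have "next_dart (prod.swap (next_dart (walk d i))) = next_dart (walk d' j)"
    using next_dart_swap_next_dart[OF di] Suc.prems by (simp add: walk_Suc)
  then have "prod.swap (next_dart (walk d i)) = walk d' j"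
    using next_dart_inj next_dart(1)[OF di] di dj j by (metis darts_swap fst_next_dart snd_swap)
  then show ?case
    using Suc.IH[of "Suc i"] j di Suc.prems by (auto simp: idx_Suc walk_Suc)
qed

text \<open>Reversal is a fixed-point-free involution on the finite half-threads. The later parity
  arguments rest on this pairing, which also keeps the two halves of a loop apart.\<close>

lemma rv:
  assumes "d \<in> D" "fin d"
  shows "rv d \<in> D" "k \<le> len d \<Longrightarrow> k \<in> idx (rv d) \<and> walk (rv d) k = prod.swap (walk d (len d - k))"
    "fin (rv d)" "len (rv d) = len d" "rv (rv d) = d" "rv d \<noteq> d"
proof -
  have dart: "walk d k \<in> darts E" if "k \<le> len d" for k
    using assms walk_dart idx_fin that by blast
  show D: "rv d \<in> D"
    using assms dart len_last by (auto simp: D_def rv_def)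
  have *: "k \<in> idx (rv d) \<and> walk (rv d) k = prod.swap (walk d (len d - k))" if "k \<le> len d" for k
    using that
  proof (induction k)
    case 0
    then show ?case
      by (simp add: rv_def)
  next
    case (Suc k)
    define m where "m = len d - Suc k"
    have m: "len d - k = Suc m" "m < len d"
      using Suc.prems by (auto simp: m_def)
    then have "Suc m \<in> idx d"
      using assms idx_fin by auto
    then have "snd (walk d m) \<notin> M"
      by (simp add: idx_Suc)
    moreover have "walk (rv d) k = prod.swap (walk d (Suc m))"
      using Suc m by auto
    ultimately show ?case
      using Suc m next_dart_swap_next_dart[of "walk d m"] dart[of m] by (auto simp: idx_Suc walk_Suc m_def[symmetric])
  qed
  then show "k \<le> len d \<Longrightarrow> k \<in> idx (rv d) \<and> walk (rv d) k = prod.swap (walk d (len d - k))"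
    by blast
  have "snd (walk (rv d) (len d)) \<in> M"
    using * assms D_M by simp
  then show "fin (rv d)" and l: "len (rv d) = len d"
    using len_eqI[of "len d" "rv d"] * by auto
  then show "rv (rv d) = d"
    unfolding rv_def[of "rv d"] using * by simp
  show "rv d \<noteq> d"
  proof
    assume eq: "rv d = d"
    \<comment> \<open>A thread equal to its reversal would fold in the middle. With an odd number
      \<open>len d + 1\<close> of edges the middle dart would be its own reverse, with an even
      number the two middle darts would backtrack.\<close>
    consider m where "len d = 2 * m" | m where "len d = Suc (2 * m)"
      by (metis evenE oddE Suc_eq_plus1)
    then show False
    proof cases
      case (1 m)
      then have "walk d m = prod.swap (walk d m)"
        using *[of m] eq by auto
      then show False
        using dart_neq[OF dart[of m]] 1 by (metis fst_swap le_add1 mult_2)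
    next
      case (2 m)
      then have "walk d m = prod.swap (walk d (Suc m))"
        using *[of m] eq by (simp add: Suc_diff_le)
      then have "walk d m = prod.swap (next_dart (walk d m))"
        unfolding walk_Suc .
      moreover have "Suc m \<in> idx d"
        using assms 2 idx_fin by auto
      ultimately show False
        using next_dart(2)[of "walk d m"] dart[of m] 2 by (metis fst_swap idx_Suc le_add1 le_SucI mult_2)
    qed
  qed
qed

text \<open>An unmarked vertex is the head of exactly two darts.\<close>

lemma head_eq:
  assumes "d \<in> D" "d' \<in> D" "i \<in> idx d" "j \<in> idx d'" "snd (walk d i) = snd (walk d' j)" "snd (walk d i) \<notin> M"
  shows "d' = d \<and> j = i \<or> fin d \<and> d' = rv d \<and> Suc (i + j) = len d"
proof -
  have di: "walk d i \<in> darts E" and dj: "walk d' j \<in> darts E"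
    using assms walk_dart by auto
  from dart_at[OF di assms(6), of "prod.swap (walk d' j)"]
  consider "prod.swap (walk d' j) = next_dart (walk d i)" | "walk d' j = walk d i"
    using assms dj by (auto simp: prod_eq_iff)
  then show ?thesis
  proof cases
    case 1
    then have "prod.swap (walk d (Suc i)) = walk d' j"
      by (metis walk_Suc swap_swap)
    moreover have "Suc i \<in> idx d"
      using assms by (simp add: idx_Suc)
    ultimately show ?thesis
      using walk_swap[OF assms(1,2), of "Suc i" j] assms(4) by simp
  next
    case 2
    then show ?thesis
      using walk_eq[OF assms(1-4)] by auto
  qed
qed

end

section \<open>Parametrised threads\<close>

context threads begin

text \<open>Unit speed: edge number \<open>i\<close> occupies the interval from \<open>i\<close> to
  \<open>i + 1\<close>.\<close>

definition raw :: "'v \<times> 'v \<Rightarrow> real \<Rightarrow> ('v + 'v set) \<times> real" where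
  "raw d t = edge_pt (walk d (nat \<lfloor>t\<rfloor>)) (t - real (nat \<lfloor>t\<rfloor>))"

definition rdom :: "'v \<times> 'v \<Rightarrow> real set" where
  "rdom d = (if fin d then {0..1 + real (len d)} else {0..})"

definition tdom :: "'v \<times> 'v \<Rightarrow> real set" where
  "tdom d = (if fin d then {0..1} else {0..<1})"

text \<open>All threads are rescaled to live on [0,1] or [0,1): finite ones linearly, infinite ones
  through t/(1-t), which maps [0,1) onto the half-line. So 1/2 is an inner parameter of every thread
  and can serve as its midpoint; for finite threads reversal fixes it.\<close>

definition par :: "'v \<times> 'v \<Rightarrow> real \<Rightarrow> real" where
  "par d t = (if fin d then t * (1 + real (len d)) else t / (1 - t))"

definition ipar :: "'v \<times> 'v \<Rightarrow> real \<Rightarrow> real" where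
  "ipar d u = (if fin d then u / (1 + real (len d)) else u / (1 + u))"

definition curve :: "'v \<times> 'v \<Rightarrow> real \<Rightarrow> ('v + 'v set) \<times> real" where
  "curve d t = raw d (par d t)"

lemma edge_pt_0 [simp]: "edge_pt \<delta> 0 = (Inl (fst \<delta>), 0)" and edge_pt_1 [simp]: "edge_pt \<delta> 1 = (Inl (snd \<delta>), 0)"
  by (simp_all add: edge_pt_def)

lemma raw_seg:
  assumes "0 \<le> s" "s \<le> 1" shows "raw d (real i + s) = edge_pt (walk d i) s"
proof (cases "s = 1")
  case True
  \<comment> \<open>At s = 1 the floor has already moved on to the next edge, whose tail is the head
    of edge \<open>i\<close>.\<close>
  then have *: "real i + s = real (Suc i)"
    by simp
  show ?thesis
    unfolding * raw_def floor_of_nat nat_int using True by simp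
next
  case False
  then have "nat \<lfloor>real i + s\<rfloor> = i"
    using assms by (simp add: floor_eq_iff nat_eq_iff)
  then show ?thesis
    by (simp add: raw_def)
qed

lemma par_dom: "t \<in> tdom d \<Longrightarrow> par d t \<in> rdom d"
  by (auto simp: tdom_def rdom_def par_def mult_le_cancel_right1)

lemma ipar_rdom: "u \<in> rdom d \<Longrightarrow> ipar d u \<in> tdom d"
  by (auto simp: tdom_def rdom_def ipar_def)

lemma par_ipar: "u \<in> rdom d \<Longrightarrow> par d (ipar d u) = u"
  by (auto simp: rdom_def par_def ipar_def field_simps)

lemma ipar_par: "t \<in> tdom d \<Longrightarrow> ipar d (par d t) = t"
  by (auto simp: tdom_def par_def ipar_def field_simps)

lemma par_inj: "t \<in> tdom d \<Longrightarrow> t' \<in> tdom d \<Longrightarrow> par d t = par d t' \<Longrightarrow> t = t'"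
  by (metis ipar_par)

lemma open_dom: "0 < t \<Longrightarrow> t < 1 \<Longrightarrow> t \<in> tdom d"
  by (simp add: tdom_def)

lemma zero_dom [simp]: "0 \<in> tdom d"
  by (simp add: tdom_def)

lemma one_dom [simp]: "1 \<in> tdom d \<longleftrightarrow> fin d"
  by (simp add: tdom_def)

lemma tdom_cases:
  assumes "t \<in> tdom d"
  obtains "t = 0" | "t = 1" "fin d" | "0 < t" "t < 1"
  using assms by (cases "t = 0"; cases "t = 1") (auto simp: tdom_def split: if_splits)

lemma seg_rdom:
  assumes "i \<in> idx d" "0 \<le> s" "s \<le> 1" shows "real i + s \<in> rdom d"
proof (cases "fin d")
  case True
  then have "i \<le> len d"
    using assms idx_fin by blast
  then show ?thesis
    using True assms by (simp add: rdom_def)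
qed (use assms in \<open>simp add: rdom_def\<close>)

lemma rdom_seg:
  assumes "u \<in> rdom d" obtains i s where "i \<in> idx d" "0 \<le> s" "s \<le> 1" "u = real i + s"
proof (cases "fin d \<and> u = 1 + real (len d)")
  case True
  then show thesis
    using that[of "len d" 1] idx_fin[of d "len d"] by simp
next
  case False
  then have u: "0 \<le> u" "fin d \<Longrightarrow> u < 1 + real (len d)"
    using assms by (auto simp: rdom_def split: if_splits)
  have "nat \<lfloor>u\<rfloor> \<le> len d" if "fin d"
    using u(2)[OF that] by linarith
  then have "nat \<lfloor>u\<rfloor> \<in> idx d"
    using idx_fin idx_inf by blast
  then show thesis
    using that[of "nat \<lfloor>u\<rfloor>" "u - real (nat \<lfloor>u\<rfloor>)"] u(1) by linarith
qed

lemma curve_0 [simp]: "curve d 0 = (Inl (fst d), 0)"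
  by (simp add: curve_def par_def raw_def)

lemma curve_1: "fin d \<Longrightarrow> curve d 1 = (Inl (fst (rv d)), 0)"
  using raw_seg[of 1 d "len d"] by (simp add: curve_def par_def rv_def add.commute)

text \<open>In the vertex case \<open>Suc i \<in> idx d\<close> records that the vertex passed is
  unmarked. This is what separates inner points from the ends of threads.\<close>

lemma curve_inner:
  assumes "0 < t" "t < 1"
  obtains (edge) i s where "i \<in> idx d" "0 < s" "s < 1" "par d t = real i + s" "curve d t = edge_pt (walk d i) s"
    | (vertex) i where "Suc i \<in> idx d" "par d t = real (Suc i)" "curve d t = (Inl (snd (walk d i)), 0)"
proof -
  have t: "t \<in> tdom d"
    using assms open_dom by blast
  obtain i s where ia: "i \<in> idx d" "0 \<le> s" "s \<le> 1" "par d t = real i + s"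
    using rdom_seg[OF par_dom[OF t]] .
  have c: "curve d t = edge_pt (walk d i) s"
    unfolding curve_def ia(4) using ia by (intro raw_seg)
  consider "s = 0" | "s = 1" | "0 < s" "s < 1"
    using ia by linarith
  then show thesis
  proof cases
    case 1
    have "par d t \<noteq> 0"
      using assms by (simp add: par_def)
    then have "i \<noteq> 0"
      using ia(4) 1 by auto
    then show thesis
      using vertex[of "i - 1"] ia 1 c by (cases i) auto
  next
    case 2
    have "Suc i \<in> idx d"
    proof (cases "fin d")
      case True
      then have "par d t < 1 + real (len d)"
        using assms by (simp add: par_def)
      then show ?thesis
        using ia(4) 2 True idx_fin by auto
    qed (rule idx_inf)
    then show thesis
      using vertex[of i] ia 2 c by auto
  next
    case 3
    then show thesis
      using edge ia c by blast
  qed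
qed

lemma curve_inner_notM:
  assumes "0 < t" "t < 1" "v \<in> M" shows "curve d t \<noteq> (Inl v, 0)"
proof (cases rule: curve_inner[OF assms(1,2), of d])
  case (1 i s)
  then show ?thesis by (simp add: edge_pt_def)
next
  case (2 i)
  then show ?thesis
    using assms(3) by (auto simp: idx_Suc)
qed

text \<open>A common inner point lies inside an edge or at an unmarked vertex. In the first case the
  two walks share a dart up to reversal, in the second they share a head; both force the threads to
  be equal or opposite, and \<open>par\<close> then determines the parameter.\<close>

lemma curve_eq_inner:
  assumes "d \<in> D" "d' \<in> D" "0 < s" "s < 1" "t \<in> tdom d'" "curve d s = curve d' t"
  shows "d' = d \<and> t = s \<or> fin d \<and> d' = rv d \<and> t = 1 - s"
proof -
  have sd: "s \<in> tdom d"
    using assms open_dom by blast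
  have same: "t = s" if "d' = d" "par d' t = par d s"
    using par_inj[OF sd, of t] that assms(5) by auto
  \<comment> \<open>Positions measured from opposite ends add up to the number of edges.\<close>
  have opp: "t = 1 - s" if "fin d" "d' = rv d" "par d' t + par d s = 1 + real (len d)"
  proof -
    have "t * (1 + real (len d)) + s * (1 + real (len d)) = 1 + real (len d)"
      using that rv[OF assms(1)] by (simp add: par_def)
    then have "(t + s - 1) * (1 + real (len d)) = 0"
      by (simp add: algebra_simps)
    then show ?thesis by simp
  qed
  show ?thesis
  proof (cases rule: tdom_cases[OF assms(5)])
    case 1
    then show ?thesis
      using curve_inner_notM[OF assms(3,4), of "fst d'"] D_M assms by auto
  next
    case 2
    then show ?thesis
      using curve_inner_notM[OF assms(3,4), of "fst (rv d')"] D_M rv(1) curve_1 assms by metis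
  next
    case t: 3
    show ?thesis
    proof (cases rule: curve_inner[OF assms(3,4), of d])
      case e: (1 i a)
      show ?thesis
      proof (cases rule: curve_inner[OF t, of d'])
        case e': (1 j b)
        have "walk d i \<in> darts E" "walk d' j \<in> darts E"
          using walk_dart e e' assms by auto
        from edge_pt_eq_iff[OF this e(2,3), of b] e e' assms(6)
        consider "walk d' j = walk d i" "b = a" | "walk d' j = prod.swap (walk d i)" "b = 1 - a"
          by force
        then show ?thesis
        proof cases
          case 1
          then have "d = d' \<and> i = j"
            using walk_eq[OF assms(1,2) e(1) e'(1)] by simp
          then have "d' = d" "par d' t = par d s"
            using e(4) e'(4) 1(2) by auto
          then show ?thesis
            using same by blast
        next
          case 2
          then have "fin d \<and> d' = rv d \<and> i + j = len d"
            using walk_swap[OF assms(1,2) e(1) e'(1)] by simp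
          then have f: "fin d" "d' = rv d" and "par d' t + par d s = 1 + real (len d)"
            unfolding e(4) e'(4) 2(2) by auto
          then show ?thesis
            using opp by blast
        qed
      next
        case (2 j)
        then show ?thesis
          using e assms(6) by (simp add: edge_pt_def)
      qed
    next
      case v: (2 i)
      show ?thesis
      proof (cases rule: curve_inner[OF t, of d'])
        case (1 j b)
        then show ?thesis
          using v assms(6) by (simp add: edge_pt_def)
      next
        case v': (2 j)
        have "snd (walk d i) = snd (walk d' j)" "snd (walk d i) \<notin> M" "i \<in> idx d" "j \<in> idx d'"
          using v v' assms(6) by (auto simp: idx_Suc)
        then consider "d' = d" "j = i" | "fin d" "d' = rv d" "Suc (i + j) = len d"
          using head_eq[OF assms(1,2)] by blast
        then show ?thesis
        proof cases
          case 1
          then have "par d' t = par d s"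
            unfolding v(2) v'(2) by simp
          then show ?thesis
            using same 1 by blast
        next
          case 2
          then have "par d' t + par d s = 1 + real (len d)"
            unfolding v(2) v'(2) by (simp flip: 2(3))
          then show ?thesis
            using opp 2 by blast
        qed
      qed
    qed
  qed
qed

lemma curve_rv:
  assumes "d \<in> D" "fin d" "0 \<le> t" "t \<le> 1"
  shows "curve (rv d) t = curve d (1 - t)"
proof -
  have "1 - t \<in> tdom d"
    using assms by (simp add: tdom_def)
  then obtain i s where ia: "i \<in> idx d" "0 \<le> s" "s \<le> 1" "par d (1 - t) = real i + s"
    using rdom_seg[OF par_dom] by metis
  then have i: "i \<le> len d"
    using assms idx_fin by blast
  have "(1 - t) * (1 + real (len d)) = real i + s"
    using ia(4) assms(2) by (simp add: par_def)
  then have "t * (1 + real (len d)) = real (len d - i) + (1 - s)"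
    using i by (simp add: of_nat_diff left_diff_distrib)
  then have "par (rv d) t = real (len d - i) + (1 - s)"
    using rv(3,4)[OF assms(1,2)] by (simp add: par_def)
  then have "curve (rv d) t = edge_pt (walk (rv d) (len d - i)) (1 - s)"
    unfolding curve_def using raw_seg[of "1 - s"] ia by simp
  also have "\<dots> = edge_pt (prod.swap (walk d i)) (1 - s)"
    using rv(2)[OF assms(1,2), of "len d - i"] i by simp
  also have "\<dots> = edge_pt (walk d i) s"
    using edge_pt_swap walk_dart ia assms by simp
  also have "\<dots> = curve d (1 - t)"
    unfolding curve_def ia(4) using ia raw_seg by simp
  finally show ?thesis .
qed

text \<open>The marked vertex at an end of the thread, meant for the parameters 0 and 1
  only.\<close>

definition ev :: "'v \<times> 'v \<Rightarrow> real \<Rightarrow> 'v" where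
  "ev d t = (if t = 0 then fst d else fst (rv d))"

text \<open>The complete list of coincidences. Apart from reversal, points are identified only at
  marked vertices, so the space is determined by the pattern in which the ends of threads
  meet.\<close>

lemma curve_eq_iff:
  assumes "d \<in> D" "d' \<in> D" "s \<in> tdom d" "t \<in> tdom d'"
  shows "curve d s = curve d' t \<longleftrightarrow> d' = d \<and> t = s \<or> fin d \<and> d' = rv d \<and> t = 1 - s \<or>
    s \<in> {0, 1} \<and> t \<in> {0, 1} \<and> ev d s = ev d' t" (is "_ \<longleftrightarrow> ?R")
proof -
  have ends: "curve d s = (Inl (ev d s), 0) \<and> ev d s \<in> M" if "d \<in> D" "s \<in> tdom d" "s = 0 \<or> s = 1" for d s
    using that curve_1[of d] D_M[of d] D_M[of "rv d"] rv(1)[of d] by (auto simp: ev_def)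
  consider "s = 0 \<or> s = 1" | "t = 0 \<or> t = 1" "0 < s" "s < 1" | "0 < s" "s < 1" "0 < t" "t < 1"
    using tdom_cases assms by metis
  then show ?thesis
  proof cases
    case 1
    show ?thesis
    proof (cases "t = 0 \<or> t = 1")
      case True
      have "ev d s = ev d' t" if "fin d" "d' = rv d" "t = 1 - s"
        using that 1 rv(5)[OF assms(1)] by (auto simp: ev_def)
      then show ?thesis
        using 1 True ends[OF assms(1,3) 1] ends[OF assms(2,4) True] by auto
    next
      case False
      then have "0 < t" "t < 1"
        using assms(4) tdom_cases by metis+
      then show ?thesis
        using curve_inner_notM[of t "ev d s" d'] ends[OF assms(1,3) 1] 1 by auto
    qed
  next
    case 2
    then show ?thesis
      using curve_inner_notM[of s "ev d' t" d] ends[OF assms(2,4) 2(1)] by auto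
  next
    case 3
    then show ?thesis
      using curve_eq_inner[OF assms(1,2) 3(1,2) assms(4)] curve_rv[OF assms(1), of t] by auto
  qed
qed

text \<open>An infinite thread consists of infinitely many closed segments, so pasting needs their
  local finiteness: only segments with \<open>i < x + 1\<close> meet the parameters below
  \<open>x + 1\<close>.\<close>

lemma continuous_raw:
  assumes "d \<in> D" shows "continuous_map (top_of_set (rdom d)) X (raw d)"
proof (rule pasting_lemma_locally_finite[where I = "idx d" and T = "\<lambda>i. {real i..real i + 1}"
      and f = "\<lambda>i t. edge_pt (walk d i) (t - real i)"])
  fix x assume "x \<in> topspace (top_of_set (rdom d))"
  then have "openin (top_of_set (rdom d)) (rdom d \<inter> {..<x + 1}) \<and> x \<in> rdom d \<inter> {..<x + 1}"
    by (auto intro!: openin_open_Int)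
  moreover have "finite {i \<in> idx d. {real i..real i + 1} \<inter> (rdom d \<inter> {..<x + 1}) \<noteq> {}}"
  proof (rule finite_subset)
    show "{i \<in> idx d. {real i..real i + 1} \<inter> (rdom d \<inter> {..<x + 1}) \<noteq> {}} \<subseteq> {..nat \<lceil>x + 1\<rceil>}"
      by auto linarith
  qed simp
  ultimately show "\<exists>U. openin (top_of_set (rdom d)) U \<and> x \<in> U \<and> finite {i \<in> idx d. {real i..real i + 1} \<inter> U \<noteq> {}}"
    by blast
next
  fix i assume i: "i \<in> idx d"
  show "closedin (top_of_set (rdom d)) {real i..real i + 1}"
  proof (rule closed_subset)
    show "{real i..real i + 1} \<subseteq> rdom d"
    proof
      fix u assume "u \<in> {real i..real i + 1}"
      then show "u \<in> rdom d"
        using seg_rdom[OF i, of "u - real i"] by simp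
    qed
  qed simp
  have "continuous_map (top_of_set (rdom d \<inter> {real i..real i + 1})) (top_of_set {0..1}) (\<lambda>t. t - real i)"
    by (auto intro!: continuous_intros)
  then have "continuous_map (top_of_set (rdom d \<inter> {real i..real i + 1})) X (edge_pt (walk d i) \<circ> (\<lambda>t. t - real i))"
    using continuous_map_compose continuous_map_from_edge_pt walk_dart[OF assms i] by blast
  then show "continuous_map (subtopology (top_of_set (rdom d)) {real i..real i + 1}) X (\<lambda>t. edge_pt (walk d i) (t - real i))"
    by (simp add: subtopology_subtopology o_def)
next
  fix i j x
  assume "i \<in> idx d" "j \<in> idx d" "x \<in> topspace (top_of_set (rdom d)) \<inter> {real i..real i + 1} \<inter> {real j..real j + 1}"
  then show "edge_pt (walk d i) (x - real i) = edge_pt (walk d j) (x - real j)"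
    using raw_seg[of "x - real i" d i] raw_seg[of "x - real j" d j] by auto
next
  fix x assume "x \<in> topspace (top_of_set (rdom d))"
  then have "x \<in> rdom d"
    by simp
  then obtain i s where ia: "i \<in> idx d" "0 \<le> s" "s \<le> 1" "x = real i + s"
    using rdom_seg by metis
  then show "\<exists>j. j \<in> idx d \<and> x \<in> {real j..real j + 1} \<and> raw d x = edge_pt (walk d j) (x - real j)"
    using raw_seg[of s d i] by (intro exI[of _ i]) auto
qed

lemma continuous_curve:
  assumes "d \<in> D" shows "continuous_map (top_of_set (tdom d)) X (curve d)"
proof -
  have "continuous_on (tdom d) (par d)"
    by (cases "fin d") (auto simp: par_def tdom_def intro!: continuous_intros)
  then have "continuous_map (top_of_set (tdom d)) (top_of_set (rdom d)) (par d)"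
    using par_dom by auto
  then have "continuous_map (top_of_set (tdom d)) X (raw d \<circ> par d)"
    using continuous_map_compose continuous_raw[OF assms] by blast
  then show ?thesis
    by (simp add: curve_def[abs_def] o_def)
qed

text \<open>One direction of each thread suffices, so that a covering can be a small set of
  representatives, matching the few curves that make up a plane model.\<close>

definition covering :: "('v \<times> 'v) set \<Rightarrow> bool" where
  "covering C \<longleftrightarrow> C \<subseteq> D \<and>
     (\<forall>\<delta>\<in>darts E. \<exists>d\<in>C. \<exists>i\<in>idx d. walk d i = \<delta> \<or> walk d i = prod.swap \<delta>)"

lemma coveringD: "covering C \<Longrightarrow> \<delta> \<in> darts E \<Longrightarrow> \<exists>d\<in>C. \<exists>i\<in>idx d. walk d i = \<delta> \<or> walk d i = prod.swap \<delta>"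
  by (simp add: covering_def)

lemma covering_reps:
  assumes "covering C" "J \<subseteq> D" "\<And>d. d \<in> C \<Longrightarrow> d \<in> J \<or> fin d \<and> rv d \<in> J"
  shows "covering J"
  unfolding covering_def
proof (intro conjI ballI assms(2))
  fix \<delta> assume "\<delta> \<in> darts E"
  then obtain d i where di: "d \<in> C" "i \<in> idx d" "walk d i = \<delta> \<or> walk d i = prod.swap \<delta>"
    using coveringD[OF assms(1)] by blast
  have "\<exists>i\<in>idx (rv d). walk (rv d) i = \<delta> \<or> walk (rv d) i = prod.swap \<delta>" if "fin d"
  proof -
    have "d \<in> D"
      using di assms(1) by (auto simp: covering_def)
    moreover have "i \<le> len d"
      using di that idx_fin by blast
    ultimately have "len d - i \<in> idx (rv d)" "walk (rv d) (len d - i) = prod.swap (walk d i)"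
      using rv(2)[of d "len d - i"] that by auto
    then show ?thesis
      using di by auto
  qed
  then show "\<exists>d\<in>J. \<exists>i\<in>idx d. walk d i = \<delta> \<or> walk d i = prod.swap \<delta>"
    using assms(3)[OF di(1)] di by blast
qed

text \<open>The inverse rescaling \<open>ipar\<close> places each edge continuously inside a thread
  that runs over it, so openness along the threads restricts to openness along the edges.\<close>

lemma openin_X_curve:
  assumes "covering C" "U \<subseteq> topspace X"
    and op: "\<And>d. d \<in> C \<Longrightarrow> openin (top_of_set (tdom d)) {t \<in> tdom d. curve d t \<in> U}"
  shows "openin X U"
proof (rule openin_X_darts[where \<Delta> = "\<Union>d\<in>C. walk d ` idx d"])
  fix \<delta> assume "\<delta> \<in> darts E"
  then obtain d i where di: "d \<in> C" "i \<in> idx d" "walk d i = \<delta> \<or> walk d i = prod.swap \<delta>"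
    using coveringD[OF assms(1)] by blast
  have "walk d i \<in> (\<Union>d\<in>C. walk d ` idx d)"
    using di(1) imageI[OF di(2), of "walk d"] by (rule UN_I)
  with di(3) show "\<delta> \<in> (\<Union>d\<in>C. walk d ` idx d) \<or> prod.swap \<delta> \<in> (\<Union>d\<in>C. walk d ` idx d)"
    by metis
next
  fix \<delta> assume "\<delta> \<in> (\<Union>d\<in>C. walk d ` idx d)"
  then obtain d i where di: "d \<in> C" "i \<in> idx d" "\<delta> = walk d i"
    by blast
  have seg: "real i + s \<in> rdom d" if "s \<in> {0..1}" for s
    using seg_rdom[OF di(2)] that by simp
  have "continuous_on {0..1} (\<lambda>s. ipar d (real i + s))"
    by (cases "fin d") (auto simp: ipar_def intro!: continuous_intros)
  then have "continuous_map (top_of_set {0..1}) (top_of_set (tdom d)) (\<lambda>s. ipar d (real i + s))"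
    using ipar_rdom[OF seg] by auto
  from openin_continuous_map_preimage[OF this op[OF di(1)]]
  have "openin (top_of_set {0..1}) {s \<in> {0..1}. ipar d (real i + s) \<in> {t \<in> tdom d. curve d t \<in> U}}"
    by simp
  also have "{s \<in> {0..1}. ipar d (real i + s) \<in> {t \<in> tdom d. curve d t \<in> U}} = {s \<in> {0..1}. edge_pt \<delta> s \<in> U}"
  proof -
    have "ipar d (real i + s) \<in> tdom d" "curve d (ipar d (real i + s)) = edge_pt \<delta> s" if "s \<in> {0..1}" for s
      using ipar_rdom[OF seg[OF that]] par_ipar[OF seg[OF that]] raw_seg[of s] that
      by (auto simp: curve_def di(3))
    then show ?thesis
      by auto
  qed
  finally show "openin (top_of_set {0..1}) {s \<in> {0..1}. edge_pt \<delta> s \<in> U}" .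
qed (rule assms(2))

lemma curve_in_X: "d \<in> D \<Longrightarrow> t \<in> tdom d \<Longrightarrow> curve d t \<in> topspace X"
  using continuous_curve[of d] by (auto simp: continuous_map_def)

text \<open>A vertex is reached as the end of an incident edge; this is where isolated vertices have
  to be excluded.\<close>

lemma covering_points:
  assumes "covering C" "x \<in> topspace X" and noniso: "\<And>v. v \<in> V \<Longrightarrow> \<exists>w. {v, w} \<in> E"
  shows "\<exists>d\<in>C. \<exists>t\<in>tdom d. x = curve d t"
proof -
  have "\<exists>\<delta>\<in>darts E. \<exists>s. 0 \<le> s \<and> s \<le> 1 \<and> x = edge_pt \<delta> s"
    using assms(2)
  proof (cases rule: X_cases)
    case (1 v)
    then obtain w where "{v, w} \<in> E"
      using noniso by blast
    then show ?thesis
      using 1 by (intro bexI[of _ "(v, w)"] exI[of _ 0]) (auto simp: darts_def)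
  next
    case (2 \<delta> t)
    then show ?thesis
      using less_imp_le by blast
  qed
  then obtain \<delta> s where \<delta>: "\<delta> \<in> darts E" "0 \<le> s" "s \<le> 1" "x = edge_pt \<delta> s"
    by blast
  then obtain d i where di: "d \<in> C" "i \<in> idx d" "walk d i = \<delta> \<or> walk d i = prod.swap \<delta>"
    using coveringD[OF assms(1)] by blast
  then obtain s' where s': "0 \<le> s'" "s' \<le> 1" "x = edge_pt (walk d i) s'"
  proof (elim disjE)
    assume "walk d i = prod.swap \<delta>"
    then have "x = edge_pt (walk d i) (1 - s)"
      using \<delta> edge_pt_swap by simp
    then show thesis
      using that[of "1 - s"] \<delta> by simp
  qed (use \<delta> that in blast)
  have "real i + s' \<in> rdom d"
    using seg_rdom di s' by blast
  then have "ipar d (real i + s') \<in> tdom d" "curve d (ipar d (real i + s')) = x"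
    using ipar_rdom par_ipar raw_seg s' by (auto simp: curve_def)
  then show ?thesis
    using di by blast
qed

text \<open>The complex is rebuilt from one interval for each thread in place of one for each edge.
  A finite covering thereby reduces an infinite graph to finitely many pieces.\<close>

lemma quotient_map_curve:
  assumes "covering C" and noniso: "\<And>v. v \<in> V \<Longrightarrow> \<exists>w. {v, w} \<in> E"
  shows "quotient_map (sum_topology (\<lambda>d. top_of_set (tdom d)) C) X (\<lambda>(d, t). curve d t)"
proof -
  let ?S = "sum_topology (\<lambda>d. top_of_set (tdom d)) C"
  have D: "d \<in> D" if "d \<in> C" for d
    using assms(1) that by (auto simp: covering_def)
  have im: "(\<lambda>(d, t). curve d t) ` topspace ?S = topspace X"
    using covering_points[OF assms(1) _ noniso] curve_in_X D by (auto simp: image_iff)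
  moreover have "openin ?S
      {x \<in> topspace ?S. (case x of (d, t) \<Rightarrow> curve d t) \<in> U} \<longleftrightarrow> openin X U"
    if U: "U \<subseteq> topspace X" for U
  proof -
    have "{t. (d, t) \<in> {x \<in> topspace ?S. (case x of (d, t) \<Rightarrow> curve d t) \<in> U}}
        = {t \<in> tdom d. curve d t \<in> U}" if "d \<in> C" for d
      using that by auto
    then have "openin ?S
      {x \<in> topspace ?S. (case x of (d, t) \<Rightarrow> curve d t) \<in> U} \<longleftrightarrow>
      (\<forall>d\<in>C. openin (top_of_set (tdom d)) {t \<in> tdom d. curve d t \<in> U})"
      unfolding openin_sum_topology by auto
    also have "\<dots> \<longleftrightarrow> openin X U"
      using openin_X_curve[OF assms(1) U] continuous_curve[OF D] openin_continuous_map_preimage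
      by fastforce
    finally show ?thesis .
  qed
  ultimately show ?thesis
    unfolding quotient_map_def by blast
qed

end

section \<open>Coverings and quotients\<close>

text \<open>Each quotient map factors through the other one, and the two factors are mutually
  inverse.\<close>

lemma homeomorphic_space_common_quotient:
  assumes p: "quotient_map S X p" and q: "quotient_map S Y q"
    and ker: "\<And>x y. x \<in> topspace S \<Longrightarrow> y \<in> topspace S \<Longrightarrow> p x = p y \<longleftrightarrow> q x = q y"
  shows "X homeomorphic_space Y"
proof -
  obtain f where f: "continuous_map X Y f" "\<And>x. x \<in> topspace S \<Longrightarrow> f (p x) = q x"
    using quotient_map_lift_exists[OF p quotient_imp_continuous_map[OF q]] ker by metis
  obtain g where g: "continuous_map Y X g" "\<And>x. x \<in> topspace S \<Longrightarrow> g (q x) = p x"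
    using quotient_map_lift_exists[OF q quotient_imp_continuous_map[OF p]] ker by metis
  have "\<exists>s\<in>topspace S. x = p s" if "x \<in> topspace X" for x
    using that quotient_imp_surjective_map[OF p] by blast
  moreover have "\<exists>s\<in>topspace S. y = q s" if "y \<in> topspace Y" for y
    using that quotient_imp_surjective_map[OF q] by blast
  ultimately have "homeomorphic_maps X Y f g"
    unfolding homeomorphic_maps_def using f g by metis
  then show ?thesis
    unfolding homeomorphic_space_def by blast
qed

text \<open>Connectedness enters in purely combinatorial form, as an induction principle over
  adjacency. It is derived from the existence of arcs only where the locale is interpreted.\<close>

locale connected_threads = threads V E M for V :: "'v set" and E M +
  assumes nondeg: "nondegenerate V"
    and M_nonempty: "M \<noteq> {}"
    and conn: "\<And>Z. Z \<subseteq> V \<Longrightarrow> Z \<noteq> {} \<Longrightarrow> (\<And>x y. x \<in> Z \<Longrightarrow> {x, y} \<in> E \<Longrightarrow> y \<in> Z) \<Longrightarrow> Z = V"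
begin

lemma noniso:
  assumes "v \<in> V" shows "\<exists>w. {v, w} \<in> E"
proof (rule ccontr)
  assume "\<nexists>w. {v, w} \<in> E"
  then have "{v} = V"
    using assms by (intro conn) auto
  then show False
    using nondeg unfolding nondegenerate_def by blast
qed

text \<open>The darts on threads from \<open>W\<close>, in either direction, are closed under
  passing to any dart at their head: inside a thread one goes on or turns back, at its end one
  starts a new thread from \<open>W\<close> or, at a leaf, can only turn back. By connectedness
  these are all the darts.\<close>

lemma covering_from:
  assumes W: "W \<subseteq> M" "W \<noteq> {}"
    and closed: "\<And>d. d \<in> D \<Longrightarrow> fst d \<in> W \<Longrightarrow> fin d \<Longrightarrow> fst (rv d) \<in> W \<or> card (nbrs E (fst (rv d))) = 1"
  shows "covering {d \<in> D. fst d \<in> W}"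
proof -
  define P where "P = {\<delta> \<in> darts E. \<exists>d\<in>D. fst d \<in> W \<and> (\<exists>i\<in>idx d. walk d i = \<delta> \<or> walk d i = prod.swap \<delta>)}"
  have P_I: "\<delta> \<in> P" if "\<delta> \<in> darts E" "d \<in> D" "fst d \<in> W" "i \<in> idx d" "walk d i = \<delta> \<or> walk d i = prod.swap \<delta>" for \<delta> d i
    using that unfolding P_def by blast
  have P_swap: "prod.swap \<delta> \<in> P" if "\<delta> \<in> P" for \<delta>
    using that unfolding P_def by auto
  have P_D: "\<delta> \<in> P" if "\<delta> \<in> darts E" "fst \<delta> \<in> W" for \<delta>
    using P_I[OF that(1), of \<delta> 0] that W by (auto simp: D_def)
  have step: "\<delta>' \<in> P" if \<delta>P: "\<delta> \<in> P" and \<delta>': "\<delta>' \<in> darts E" "fst \<delta>' = snd \<delta>" for \<delta> \<delta>'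
  proof -
    obtain d i where di: "d \<in> D" "fst d \<in> W" "i \<in> idx d" "walk d i = \<delta> \<or> walk d i = prod.swap \<delta>"
      using \<delta>P unfolding P_def by blast
    from di(4) show ?thesis
    proof
      assume eq: "walk d i = \<delta>"
      show ?thesis
      proof (cases "snd \<delta> \<in> M")
        case True
        then have fd: "fin d" "i = len d"
          using len_eqI[OF di(3)] eq by auto
        then have r: "fst (rv d) = snd \<delta>" "prod.swap \<delta> = rv d"
          using eq by (auto simp: rv_def)
        consider "snd \<delta> \<in> W" | "card (nbrs E (snd \<delta>)) = 1"
          using closed[OF di(1,2) fd(1)] r by auto
        then show ?thesis
        proof cases
          case 1
          then show ?thesis
            using P_D \<delta>' by simp
        next
          case 2
          then obtain x where x: "nbrs E (snd \<delta>) = {x}"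
            using card_1_singletonE by blast
          have "fst \<delta> \<in> nbrs E (snd \<delta>)" "snd \<delta>' \<in> nbrs E (snd \<delta>)"
            using walk_dart[OF di(1,3)] eq \<delta>' by (auto simp: nbrs_def darts_def insert_commute)
          then have "\<delta>' = prod.swap \<delta>"
            using x \<delta>'(2) by (auto simp: prod_eq_iff)
          then show ?thesis
            using P_swap \<delta>P by simp
        qed
      next
        case False
        then consider "\<delta>' = next_dart \<delta>" | "\<delta>' = prod.swap \<delta>"
          using dart_at[of \<delta> \<delta>'] walk_dart[OF di(1,3)] eq \<delta>' by blast
        then show ?thesis
        proof cases
          case 1
          then have "walk d (Suc i) = \<delta>'" "Suc i \<in> idx d"
            using eq False di by (auto simp: walk_Suc idx_Suc)
          then show ?thesis
            using P_I[OF \<delta>'(1) di(1,2)] by blast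
        qed (use P_swap \<delta>P in simp)
      qed
    next
      assume eq: "walk d i = prod.swap \<delta>"
      show ?thesis
      proof (cases i)
        case 0
        then have "fst \<delta>' \<in> W"
          using eq \<delta>' di by auto
        then show ?thesis
          using P_D \<delta>' by simp
      next
        case (Suc j)
        have j: "j \<in> idx d" "snd (walk d j) \<notin> M"
          using di(3) unfolding Suc idx_Suc by auto
        have "snd (walk d j) = snd \<delta>"
          using eq unfolding Suc by (metis fst_walk_Suc fst_swap)
        then consider "\<delta>' = next_dart (walk d j)" | "\<delta>' = prod.swap (walk d j)"
          using dart_at[OF walk_dart[OF di(1) j(1)] j(2) \<delta>'(1)] \<delta>'(2) by auto
        then show ?thesis
        proof cases
          case 1
          then have "walk d i = \<delta>'"
            by (simp add: Suc walk_Suc)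
          then show ?thesis
            using P_I[OF \<delta>'(1) di(1-3)] by blast
        next
          case 2
          then show ?thesis
            using P_I[OF \<delta>'(1) di(1,2) j(1)] by simp
        qed
      qed
    qed
  qed
  have "fst ` P = V"
  proof (rule conn)
    show "fst ` P \<subseteq> V"
      using dart_verts by (auto simp: P_def)
    obtain w where w: "w \<in> W"
      using W by blast
    then obtain y where "{w, y} \<in> E"
      using noniso W M_sub by blast
    then have "(w, y) \<in> P"
      using P_D w by (auto simp: darts_def)
    then show "fst ` P \<noteq> {}"
      by blast
    show "y \<in> fst ` P" if "x \<in> fst ` P" "{x, y} \<in> E" for x y
    proof -
      from that(1) obtain \<delta> where \<delta>: "\<delta> \<in> P" "x = fst \<delta>"
        by blast
      have "(x, y) \<in> P"
        using step[OF P_swap[OF \<delta>(1)], of "(x, y)"] that \<delta> by (simp add: darts_def)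
      then have "(y, x) \<in> P"
        using P_swap by force
      then show ?thesis
        by force
    qed
  qed
  have "\<delta> \<in> P" if \<delta>: "\<delta> \<in> darts E" for \<delta>
  proof -
    have "fst \<delta> \<in> fst ` P"
      using \<open>fst ` P = V\<close> dart_verts(1)[OF \<delta>] by simp
    then obtain \<epsilon> where \<epsilon>: "\<epsilon> \<in> P" "fst \<epsilon> = fst \<delta>"
      by force
    then show ?thesis
      using step[OF P_swap[OF \<epsilon>(1)] \<delta>] by simp
  qed
  then show ?thesis
    unfolding covering_def P_def by blast
qed

text \<open>Both spaces are quotients of the same sum of intervals, with equal kernels by
  \<open>ker\<close>. For the model this comes from closedness of the gluing map: there are finitely
  many curves, and each sends closed sets to closed subsets of \<open>K\<close>.\<close>

lemma homeomorphic_glued_curves: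
  fixes \<kappa> :: "'v \<times> 'v \<Rightarrow> real \<Rightarrow> 'a::t2_space"
  assumes J: "covering J" "finite J"
    and cont: "\<And>d. d \<in> J \<Longrightarrow> continuous_on {0..1} (\<kappa> d)"
    and K: "K = (\<Union>d\<in>J. \<kappa> d ` tdom d)"
    and missing: "\<And>d. d \<in> J \<Longrightarrow> \<not> fin d \<Longrightarrow> \<kappa> d 1 \<notin> K"
    and ker: "\<And>d d' s t. d \<in> J \<Longrightarrow> d' \<in> J \<Longrightarrow> s \<in> tdom d \<Longrightarrow> t \<in> tdom d' \<Longrightarrow>
      \<kappa> d s = \<kappa> d' t \<longleftrightarrow> curve d s = curve d' t"
  shows "X homeomorphic_space top_of_set K"
proof (rule homeomorphic_space_common_quotient)
  let ?S = "sum_topology (\<lambda>d. top_of_set (tdom d)) J"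
  show "quotient_map ?S X (\<lambda>(d, t). curve d t)"
    using J noniso by (intro quotient_map_curve) auto
  show "quotient_map ?S (top_of_set K) (\<lambda>(d, t). \<kappa> d t)"
  proof (rule continuous_closed_imp_quotient_map)
    have sub: "tdom d \<subseteq> {0..1}" for d
      by (auto simp: tdom_def)
    have "openin ?S
        {x \<in> topspace ?S. (case x of (d, t) \<Rightarrow> \<kappa> d t) \<in> U}"
      if U: "openin (top_of_set K) U" for U
      unfolding openin_sum_topology
    proof (intro conjI ballI)
      fix d assume d: "d \<in> J"
      have "continuous_map (top_of_set (tdom d)) (top_of_set K) (\<kappa> d)"
        using continuous_on_subset[OF cont[OF d] sub] d by (auto simp: K)
      from openin_continuous_map_preimage[OF this U]
      show "openin (top_of_set (tdom d)) {t. (d, t) \<in> {x \<in> topspace ?S.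
          (case x of (d, t) \<Rightarrow> \<kappa> d t) \<in> U}}"
        using d by simp
    qed auto
    then show "continuous_map ?S (top_of_set K) (\<lambda>(d, t). \<kappa> d t)"
      by (auto simp: continuous_map_def K)
    show "closed_map ?S (top_of_set K) (\<lambda>(d, t). \<kappa> d t)"
      unfolding closed_map_def
    proof (intro allI impI)
      fix T assume T: "closedin ?S T"
      define Td where "Td d = {t. (d, t) \<in> T}" for d
      have Td: "closedin (top_of_set (tdom d)) (Td d)" if "d \<in> J" for d
        using T that unfolding closedin_sum_topology Td_def by blast
      have TJ: "T \<subseteq> J \<times> UNIV"
        using T unfolding closedin_sum_topology by auto
      have "closedin (top_of_set K) (\<kappa> d ` Td d)" if d: "d \<in> J" for d
      proof -
        obtain C where C: "closed C" "Td d = tdom d \<inter> C"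
          using Td[OF d] by (auto simp: closedin_closed)
        have sK: "\<kappa> d ` Td d \<subseteq> K"
          using C d K by blast
        show ?thesis
        proof (cases "fin d")
          case True
          then have "compact (Td d)"
            using C by (auto simp: tdom_def compact_Int_closed)
          moreover have "continuous_on (Td d) (\<kappa> d)"
            using continuous_on_subset[OF cont[OF d]] C sub by blast
          ultimately have "closed (\<kappa> d ` Td d)"
            using compact_continuous_image compact_imp_closed by blast
          then show ?thesis
            using closed_subset sK by blast
        next
          case False
          \<comment> \<open>An infinite thread lacks the parameter 1. Adding it makes the set
            compact, and the added point \<open>\<kappa> d 1\<close> lies outside \<open>K\<close>,
            so it disappears again on intersecting with \<open>K\<close>.\<close>
          have "insert 1 (Td d) = {0..1} \<inter> insert 1 C"
            using C False by (auto simp: tdom_def)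
          then have "compact (insert 1 (Td d))"
            using C by (metis closed_insert compact_Icc compact_Int_closed)
          moreover have "continuous_on (insert 1 (Td d)) (\<kappa> d)"
            using continuous_on_subset[OF cont[OF d]] C sub by (metis \<open>insert 1 (Td d) = {0..1} \<inter> insert 1 C\<close> inf_le1)
          ultimately have "closed (\<kappa> d ` insert 1 (Td d))"
            using compact_continuous_image compact_imp_closed by blast
          moreover have "\<kappa> d ` Td d = K \<inter> \<kappa> d ` insert 1 (Td d)"
            using sK missing[OF d False] by auto
          ultimately show ?thesis
            unfolding closedin_closed by blast
        qed
      qed
      then have "closedin (top_of_set K) (\<Union>d\<in>J. \<kappa> d ` Td d)"
        using J(2) by (intro closedin_Union) auto
      also have "(\<Union>d\<in>J. \<kappa> d ` Td d) = (\<lambda>(d, t). \<kappa> d t) ` T"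
        using TJ by (force simp: Td_def image_iff)
      finally show "closedin (top_of_set K) ((\<lambda>(d, t). \<kappa> d t) ` T)" .
    qed
    show "(\<lambda>(d, t). \<kappa> d t) ` topspace ?S = topspace (top_of_set K)"
      by (force simp: K image_iff)
  qed
qed (use ker in auto)

end

section \<open>Arcs in Hausdorff spaces\<close>

locale embedded_arc =
  fixes X :: "'a topology" and g :: "real \<Rightarrow> 'a" and A :: "'a set"
  assumes Hausdorff: "Hausdorff_space X"
    and g_cont: "continuous_map (top_of_set {0..1}) X g"
    and g_inj: "inj_on g {0..1}"
    and g_image: "A = g ` {0..1}"
begin

lemma A_sub: "A \<subseteq> topspace X"
  using g_cont by (auto simp: g_image continuous_map_def)

lemma A_closed: "closedin X A"
proof -
  have "compactin X (g ` {0..1})"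
    using g_cont by (intro image_compactin[where X = "top_of_set {0..1}"]) (auto simp: compactin_subtopology)
  then show ?thesis
    using compactin_imp_closedin[OF Hausdorff] g_image by simp
qed

lemma A_connected: "connectedin X A"
  unfolding g_image using g_cont
  by (intro connectedin_continuous_map_image[where X = "top_of_set {0..1}"]) (auto simp: connectedin_subtopology)

lemma closed_trace:
  assumes "continuous_map (top_of_set S) X c"
  shows "closedin (top_of_set S) {s \<in> S. c s \<in> A}"
  using closedin_continuous_map_preimage[OF assms A_closed] by simp

text \<open>Invariance of domain in dimension one.\<close>

lemma open_trace:
  fixes S :: "real set"
  assumes inj: "inj_on c S" and op: "\<And>U. openin (top_of_set S) U \<Longrightarrow> openin X (c ` U)"
  shows "open {s \<in> S. c s \<in> g ` {0<..<1}}"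
proof -
  \<comment> \<open>The transition map from the parameter of the arc to that of the curve is defined
    on the open set \<open>Q\<close>, continuous and injective there. Its image is the trace, which
    is therefore open in the line.\<close>
  define Q where "Q = {t \<in> {0<..<1}. g t \<in> c ` S}"
  define \<phi> where "\<phi> t = inv_into S c (g t)" for t
  have pre: "open {t \<in> {0<..<1}. g t \<in> c ` U}" if "openin (top_of_set S) U" for U
  proof -
    have "openin (top_of_set {0..1}) {t \<in> topspace (top_of_set {0..1}). g t \<in> c ` U}"
      using openin_continuous_map_preimage[OF g_cont op[OF that]] .
    then obtain T where T: "open T" "{t \<in> {0..1}. g t \<in> c ` U} = {0..1} \<inter> T"
      by (auto simp: openin_open)
    have "{t \<in> {0<..<1}. g t \<in> c ` U} = {0<..<1} \<inter> {t \<in> {0..1}. g t \<in> c ` U}"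
      by auto
    also have "\<dots> = {0<..<1} \<inter> T"
      unfolding T(2) by auto
    finally show ?thesis
      using open_Int[OF open_greaterThanLessThan T(1)] by (simp only:)
  qed
  have c\<phi>: "c (\<phi> t) = g t" "\<phi> t \<in> S" if "t \<in> Q" for t
    using that by (auto simp: Q_def \<phi>_def f_inv_into_f inv_into_into)
  have "open Q"
    using pre[of S] by (simp add: Q_def)
  have "continuous_on Q \<phi>"
    unfolding continuous_on_open_vimage[OF \<open>open Q\<close>]
  proof (intro allI impI)
    fix B :: "real set" assume "open B"
    then have "open {t \<in> {0<..<1}. g t \<in> c ` (S \<inter> B)}"
      by (intro pre openin_open_Int)
    also have "{t \<in> {0<..<1}. g t \<in> c ` (S \<inter> B)} = \<phi> -` B \<inter> Q"
      using inj by (auto simp: Q_def \<phi>_def inj_on_def f_inv_into_f inv_into_into)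
    finally show "open (\<phi> -` B \<inter> Q)" .
  qed
  moreover have "inj_on \<phi> Q"
  proof (rule inj_onI)
    fix t t' assume "t \<in> Q" "t' \<in> Q" "\<phi> t = \<phi> t'"
    then have "g t = g t'" "t \<in> {0..1}" "t' \<in> {0..1}"
      using c\<phi> by (metis, auto simp: Q_def)
    then show "t = t'"
      using g_inj by (auto simp: inj_on_def)
  qed
  ultimately have "open (\<phi> ` Q)"
    using \<open>open Q\<close> invariance_of_domain by blast
  also have "\<phi> ` Q = {s \<in> S. c s \<in> g ` {0<..<1}}"
  proof (intro equalityI subsetI)
    fix s assume "s \<in> {s \<in> S. c s \<in> g ` {0<..<1}}"
    then obtain t where t: "s \<in> S" "t \<in> {0<..<1}" "c s = g t"
      by auto
    then have "t \<in> Q"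
      unfolding Q_def by (metis (mono_tags, lifting) imageI mem_Collect_eq)
    moreover have "\<phi> t = s"
      unfolding \<phi>_def using t inj by (metis inv_into_f_f)
    ultimately show "s \<in> \<phi> ` Q"
      by blast
  next
    fix s assume "s \<in> \<phi> ` Q"
    then obtain t where t: "t \<in> Q" "s = \<phi> t"
      by blast
    then have "t \<in> {0<..<1}"
      by (simp add: Q_def)
    then show "s \<in> {s \<in> S. c s \<in> g ` {0<..<1}}"
      using c\<phi>[OF t(1)] t(2) by simp
  qed
  finally show ?thesis .
qed

lemma A_cases: "x \<in> A \<Longrightarrow> x = g 0 \<or> x = g 1 \<or> x \<in> g ` {0<..<1}"
  unfolding g_image by (force simp: less_le)

text \<open>The parameters in \<open>J\<close> at which the curve lies on the arc form a closed set.
  As long as no end of the arc occurs along \<open>J\<close>, this set is open as well, and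
  \<open>J\<close> is connected.\<close>

lemma traverse:
  fixes S :: "real set"
  assumes inj: "inj_on c S" and op: "\<And>U. openin (top_of_set S) U \<Longrightarrow> openin X (c ` U)"
    and cont: "continuous_map (top_of_set S) X c"
    and J: "J \<subseteq> S" "connected J" "s0 \<in> J" "c s0 \<in> A" and ends: "g 0 \<notin> c ` J" "g 1 \<notin> c ` J"
  shows "c ` J \<subseteq> A"
proof -
  define T where "T = {s \<in> J. c s \<in> A}"
  have "c s \<in> A \<longleftrightarrow> c s \<in> g ` {0<..<1}" if "s \<in> J" for s
    using A_cases[of "c s"] imageI[OF that, of c] ends g_image by (metis greaterThanLessThan_subseteq_atLeastAtMost_iff image_mono order_refl subsetD)
  then have "T = J \<inter> {s \<in> S. c s \<in> g ` {0<..<1}}"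
    using J(1) unfolding T_def by blast
  then have "openin (top_of_set J) T"
    using open_trace[OF inj op] by (auto intro: openin_open_Int)
  moreover have "closedin (top_of_set J) T"
    unfolding T_def using J(1) by (intro closed_trace continuous_map_from_subtopology_mono[OF cont])
  ultimately have "T = {} \<or> T = J"
    using J(2) by (auto simp: connected_clopen)
  then show ?thesis
    using J by (auto simp: T_def)
qed

text \<open>If \<open>c 1\<close> were an inner point of the arc, the trace would be an open set of
  reals that contains 1 but nothing beyond 1.\<close>

lemma half_open_end:
  assumes inj: "inj_on c {0<..1}" and op: "\<And>U. openin (top_of_set {0<..1}) U \<Longrightarrow> openin X (c ` U)"
    and "c 1 \<in> A"
  shows "c (1::real) = g 0 \<or> c 1 = g 1"
proof (rule ccontr)
  let ?T = "{s \<in> {0<..1}. c s \<in> g ` {0<..<1}}"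
  assume "\<not> ?thesis"
  then have "1 \<in> ?T"
    using A_cases[OF assms(3)] by auto
  moreover have "open ?T"
    using open_trace[OF inj op] .
  ultimately obtain e where "e > 0" "ball 1 e \<subseteq> ?T"
    using openE by blast
  then have "1 + e / 2 \<in> ?T"
    by (intro subsetD[OF \<open>ball 1 e \<subseteq> ?T\<close>]) (auto simp: dist_real_def)
  then show False
    using \<open>e > 0\<close> by auto
qed

text \<open>The assumptions make \<open>A \<inter> U = A \<inter> C\<close> both open and closed in
  the connected set \<open>A\<close>.\<close>

lemma trapped:
  assumes "openin X U" "closedin X C" "U \<subseteq> C" "A \<inter> C \<subseteq> U" "A \<inter> U \<noteq> {}"
  shows "A \<subseteq> U"
proof (rule ccontr)
  assume "\<not> A \<subseteq> U"
  then have "A \<inter> (topspace X - C) \<noteq> {}"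
    using assms A_sub by blast
  moreover have "openin X (topspace X - C)"
    using assms by blast
  moreover have "A \<subseteq> U \<union> (topspace X - C)" "U \<inter> (topspace X - C) \<inter> A = {}"
    using assms A_sub by blast+
  ultimately show False
    using A_connected assms unfolding connectedin by blast
qed

text \<open>Pulled back to the parameter interval of the arc, the legs become nondegenerate
  intervals that pairwise share only the parameter of \<open>v\<close>. Among three of them two
  extend to the same side and overlap.\<close>

lemma no_triod:
  fixes c :: "'i \<Rightarrow> real \<Rightarrow> 'a"
  assumes I: "i1 \<noteq> i2" "i1 \<noteq> i3" "i2 \<noteq> i3" "{i1, i2, i3} \<subseteq> I"
    and c: "\<And>i. i \<in> I \<Longrightarrow> continuous_map (top_of_set {0..a}) X (c i)"
    and "0 < a" and v: "\<And>i. i \<in> I \<Longrightarrow> c i 0 = v"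
    and sub: "\<And>i s. i \<in> I \<Longrightarrow> 0 < s \<Longrightarrow> s \<le> a \<Longrightarrow> c i s \<in> A \<and> c i s \<noteq> v"
    and meet: "\<And>i j s t. i \<in> I \<Longrightarrow> j \<in> I \<Longrightarrow> i \<noteq> j \<Longrightarrow> 0 < s \<Longrightarrow> s \<le> a \<Longrightarrow> 0 < t \<Longrightarrow> t \<le> a \<Longrightarrow> c i s \<noteq> c j t"
  shows False
proof -
  \<comment> \<open>The legs are known to lie in the arc only away from \<open>v\<close>, but
    \<open>v\<close> is a limit of such points and the arc is closed.\<close>
  have vA: "v \<in> A"
  proof -
    have i1: "i1 \<in> I"
      using I by auto
    have "closedin (top_of_set {0..a}) {s \<in> {0..a}. c i1 s \<in> A}"
      using closed_trace[OF c[OF i1]] .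
    then have "closed {s \<in> {0..a}. c i1 s \<in> A}"
      by (metis closed_atLeastAtMost closedin_closed_trans)
    then have "closure {0<..<a} \<subseteq> {s \<in> {0..a}. c i1 s \<in> A}"
      using sub[OF i1] by (intro closure_minimal) auto
    moreover have "0 \<in> closure {0<..<a}"
      using \<open>0 < a\<close> by (simp add: closure_greaterThanLessThan)
    ultimately show ?thesis
      using v[OF i1] by auto
  qed
  define h where "h = inv_into {0..1} g"
  have gh: "g (h x) = x" "h x \<in> {0..1}" if "x \<in> A" for x
    using that unfolding g_image h_def by (rule f_inv_into_f, rule inv_into_into)
  have sA: "c i s \<in> A" if "i \<in> I" "s \<in> {0..a}" for i s
    using sub[of i s] v vA that by (cases "s = 0") auto
  have h_cont: "continuous_map (subtopology X A) (top_of_set {0..1}) h"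
  proof -
    have "homeomorphic_map (top_of_set {0..1}) (subtopology X A) g"
      using g_cont g_inj g_image Hausdorff A_sub
      by (intro continuous_imp_homeomorphic_map)
        (auto simp: compact_space_subtopology Hausdorff_space_subtopology continuous_map_in_subtopology)
    then obtain h' where h': "homeomorphic_maps (top_of_set {0..1}) (subtopology X A) g h'"
      unfolding homeomorphic_map_maps by blast
    have "h' x = h x" if "x \<in> topspace (subtopology X A)" for x
    proof -
      have "x \<in> A"
        using that by auto
      then have "h' (g (h x)) = h x"
        using h' gh(2) by (simp add: homeomorphic_maps_def)
      then show ?thesis
        using gh(1)[OF \<open>x \<in> A\<close>] by simp
    qed
    then show ?thesis
      using h' continuous_map_eq unfolding homeomorphic_maps_def by blast
  qed
  define S where "S i = (\<lambda>s. h (c i s)) ` {0..a}" for i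
  have S_conn: "is_interval (S i)" if "i \<in> I" for i
  proof -
    have "continuous_map (top_of_set {0..a}) (subtopology X A) (c i)"
      using c[OF that] sA[OF that] by (auto simp: continuous_map_in_subtopology)
    then have "continuous_map (top_of_set {0..a}) (top_of_set {0..1}) (h \<circ> c i)"
      using h_cont by (rule continuous_map_compose)
    then have "continuous_on {0..a} (\<lambda>s. h (c i s))"
      by (simp add: o_def)
    then have "connected (S i)"
      unfolding S_def by (intro connected_continuous_image) auto
    then show ?thesis
      by (simp add: is_interval_connected_1)
  qed
  have S0: "h v \<in> S i" if "i \<in> I" for i
    using v[OF that] \<open>0 < a\<close> unfolding S_def by (intro image_eqI[of _ _ 0]) auto
  have disj: "x = h v" if ij: "i \<in> I" "j \<in> I" "i \<noteq> j" and x: "x \<in> S i" "x \<in> S j" for i j x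
  proof -
    obtain s t where st: "s \<in> {0..a}" "t \<in> {0..a}" "x = h (c i s)" "x = h (c j t)"
      using x unfolding S_def by blast
    then have "c i s = c j t"
      using gh(1) sA ij by metis
    then have "s = 0 \<or> t = 0"
      using meet[OF ij, of s t] st by force
    then show ?thesis
      using v ij st by auto
  qed
  define x where "x i = h (c i a)" for i
  have x: "x i \<in> S i" "x i \<noteq> h v" if "i \<in> I" for i
  proof -
    show "x i \<in> S i"
      using \<open>0 < a\<close> by (auto simp: S_def x_def)
    show "x i \<noteq> h v"
      using sub[OF that, of a] gh(1)[of "c i a"] gh(1)[OF vA] \<open>0 < a\<close> unfolding x_def by (metis order_refl)
  qed
  have side: "\<not> (h v < x i \<and> h v < x j)" "\<not> (x i < h v \<and> x j < h v)" if ij: "i \<in> I" "j \<in> I" "i \<noteq> j" for i j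
  proof -
    have btw: "y \<in> S i" if "i \<in> I" "h v \<le> y \<and> y \<le> x i \<or> x i \<le> y \<and> y \<le> h v" for i y
      using S_conn[OF that(1)] S0[OF that(1)] x(1)[OF that(1)] that(2) unfolding is_interval_1 by blast
    show "\<not> (h v < x i \<and> h v < x j)"
    proof
      assume "h v < x i \<and> h v < x j"
      moreover from this have "min (x i) (x j) = h v"
        by (intro disj[OF ij] btw ij) auto
      ultimately show False
        by (simp add: min_def split: if_splits)
    qed
    show "\<not> (x i < h v \<and> x j < h v)"
    proof
      assume "x i < h v \<and> x j < h v"
      moreover from this have "max (x i) (x j) = h v"
        by (intro disj[OF ij] btw ij) auto
      ultimately show False
        by (simp add: max_def split: if_splits)
    qed
  qed
  show False
    using side[of i1 i2] side[of i1 i3] side[of i2 i3] x(2)[of i1] x(2)[of i2] x(2)[of i3] I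
    by (metis insert_subset neq_iff)
qed

end

lemma is_arc_embedded:
  assumes "is_arc X A" "Hausdorff_space X" obtains g where "embedded_arc X g A"
proof -
  have A: "A \<subseteq> topspace X" and "top_of_set {0..1::real} homeomorphic_space subtopology X A"
    using assms homeomorphic_space_sym unfolding is_arc_def by blast+
  then obtain g where g: "homeomorphic_map (top_of_set {0..1::real}) (subtopology X A) g"
    unfolding homeomorphic_space by blast
  have "embedded_arc X g A"
  proof
    show "continuous_map (top_of_set {0..1}) X g"
      using homeomorphic_imp_continuous_map[OF g] by (simp add: continuous_map_in_subtopology)
    show "inj_on g {0..1}"
      using homeomorphic_imp_injective_map[OF g] by simp
    show "A = g ` {0..1}"
      using homeomorphic_imp_surjective_map[OF g] A by (simp add: Int_absorb1)
  qed (rule assms(2))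
  then show thesis
    using that by blast
qed

section \<open>Counting the ends of an arc\<close>

context connected_threads begin

lemma covering_D: "covering D"
proof -
  have "covering {d \<in> D. fst d \<in> M}"
    using M_nonempty D_M rv(1) by (intro covering_from) auto
  moreover have "{d \<in> D. fst d \<in> M} = D"
    using D_M by blast
  ultimately show ?thesis
    by simp
qed

definition leaf_end :: "'v \<times> 'v \<Rightarrow> bool" where
  "leaf_end d \<longleftrightarrow> fin d \<and> card (nbrs E (fst (rv d))) = 1"

definition dead :: "'v \<times> 'v \<Rightarrow> bool" where
  "dead d \<longleftrightarrow> \<not> fin d \<or> leaf_end d"

text \<open>A leaf at the far end is included: small neighbourhoods of a leaf stay within its
  thread, so the image remains open in the complex, and an arc stopping at the leaf counts as having
  an end inside the thread.\<close>

definition tinner :: "'v \<times> 'v \<Rightarrow> real set" where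
  "tinner d = (if leaf_end d then {0<..1} else {0<..<1})"

text \<open>Counting only from non-leaves lets a thread that ends at a leaf be counted from one side
  at most. Infinite degree has \<open>card\<close> equal to 0 and thus counts as non-leaf.\<close>

definition nonleaf :: "('v \<times> 'v) set" where
  "nonleaf = {d \<in> D. card (nbrs E (fst d)) \<noteq> 1}"

lemma nonleaf_D: "d \<in> nonleaf \<Longrightarrow> d \<in> D"
  by (simp add: nonleaf_def)

lemma leaf_dart_unique:
  assumes "d \<in> D" "d' \<in> D" "fst d = fst d'" "card (nbrs E (fst d)) = 1" shows "d = d'"
proof -
  obtain x where "nbrs E (fst d) = {x}"
    using assms(4) card_1_singletonE by blast
  moreover have "snd d \<in> nbrs E (fst d)" "snd d' \<in> nbrs E (fst d)"
    using assms by (auto simp: D_def darts_def nbrs_def)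
  ultimately show ?thesis
    using assms(3) by (auto simp: prod_eq_iff)
qed

lemma inner_sub: "tinner d \<subseteq> tdom d"
  by (auto simp: tinner_def tdom_def leaf_end_def)

text \<open>Extends the uniqueness of inner points to a leaf at parameter 1. Only one half-thread
  starts at a leaf, so any thread reaching it is this one or its reversal.\<close>

lemma curve_eq_region:
  assumes "d \<in> D" "d' \<in> D" "s \<in> tinner d" "t \<in> tdom d'" "curve d s = curve d' t"
  shows "d' = d \<and> t = s \<or> fin d \<and> d' = rv d \<and> t = 1 - s"
proof (cases "s = 1")
  case True
  then have l: "fin d" "card (nbrs E (fst (rv d))) = 1"
    using assms(3) by (auto simp: tinner_def leaf_end_def split: if_splits)
  have r: "rv d \<in> D"
    using rv(1) assms l by blast
  have e: "curve d' t = (Inl (fst (rv d)), 0)"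
    using assms(5) True curve_1 l by simp
  show ?thesis
  proof (cases rule: tdom_cases[OF assms(4)])
    case 1
    then have "rv d = d'"
      using e l r assms by (intro leaf_dart_unique) auto
    then show ?thesis
      using 1 True l by auto
  next
    case 2
    then have "rv d = rv d'"
      using e l r assms rv(1)[of d'] curve_1[of d'] by (intro leaf_dart_unique) auto
    then have "d = d'"
      using rv(5) assms l 2 by metis
    then show ?thesis
      using 2 True by auto
  next
    case 3
    then show ?thesis
      using curve_inner_notM[OF 3, of "fst (rv d)"] e D_M r by blast
  qed
next
  case False
  then have "0 < s" "s < 1"
    using assms(3) by (auto simp: tinner_def split: if_splits)
  then show ?thesis
    using curve_eq_inner assms by blast
qed

lemma inj_inner:
  assumes "d \<in> D" shows "inj_on (curve d) (tinner d)"
proof (rule inj_onI)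
  fix s t assume st: "s \<in> tinner d" "t \<in> tinner d" "curve d s = curve d t"
  then have "t \<in> tdom d"
    using inner_sub by blast
  from curve_eq_region[OF assms assms st(1) this st(3)] show "s = t"
    using rv(6)[OF assms] by auto
qed

lemma continuous_inner: "d \<in> D \<Longrightarrow> S \<subseteq> tdom d \<Longrightarrow> continuous_map (top_of_set S) X (curve d)"
  using continuous_curve continuous_map_from_subtopology_mono by blast

lemma openin_inner_tdom: "openin (top_of_set (tdom d)) (tinner d)"
proof -
  have "tinner d = tdom d \<inter> (if leaf_end d then {0<..} else {0<..<1})"
    by (auto simp: tinner_def tdom_def leaf_end_def)
  then show ?thesis
    by (metis open_greaterThan open_greaterThanLessThan openin_open_Int)
qed

text \<open>Openness is tested along all half-threads. Only \<open>d\<close> and its reversal meet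
  the image, and their preimages are \<open>U\<close> and its reflection under t -> 1 - t.\<close>

lemma open_curve:
  assumes d: "d \<in> D" and U: "openin (top_of_set (tinner d)) U"
  shows "openin X (curve d ` U)"
proof (rule openin_X_curve[OF covering_D])
  have UI: "U \<subseteq> tinner d"
    using openin_imp_subset[OF U] .
  then show "curve d ` U \<subseteq> topspace X"
    using curve_in_X[OF d] inner_sub by blast
  have Ud: "openin (top_of_set (tdom d)) U"
    using U openin_inner_tdom openin_trans by blast
  fix d' assume d': "d' \<in> D"
  have mem: "curve d' t \<in> curve d ` U \<longleftrightarrow> d' = d \<and> t \<in> U \<or> fin d \<and> d' = rv d \<and> 1 - t \<in> U" if t: "t \<in> tdom d'" for t
  proof
    assume "curve d' t \<in> curve d ` U"
    then obtain s where s: "s \<in> U" "curve d s = curve d' t"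
      by fastforce
    have "s \<in> tinner d"
      using s(1) UI by blast
    from curve_eq_region[OF d d' this t s(2)] show "d' = d \<and> t \<in> U \<or> fin d \<and> d' = rv d \<and> 1 - t \<in> U"
      using s(1) by auto
  next
    assume "d' = d \<and> t \<in> U \<or> fin d \<and> d' = rv d \<and> 1 - t \<in> U"
    then show "curve d' t \<in> curve d ` U"
    proof (elim disjE conjE)
      assume "fin d" "d' = rv d" "1 - t \<in> U"
      moreover from this have "0 \<le> t" "t \<le> 1"
        using t rv(3)[OF d] by (auto simp: tdom_def)
      ultimately show ?thesis
        using curve_rv[OF d] by auto
    qed auto
  qed
  consider "d' = d" | "d' \<noteq> d" "fin d" "d' = rv d" | "d' \<noteq> d" "\<not> (fin d \<and> d' = rv d)"
    by blast
  then show "openin (top_of_set (tdom d')) {t \<in> tdom d'. curve d' t \<in> curve d ` U}"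
  proof cases
    case 1
    have "curve d' t \<in> curve d ` U \<longleftrightarrow> t \<in> U" if "t \<in> tdom d'" for t
      using mem[OF that] rv(6)[OF d] 1 by auto
    then have "{t \<in> tdom d'. curve d' t \<in> curve d ` U} = tdom d \<inter> U"
      using 1 by auto
    also have "\<dots> = U"
      using openin_imp_subset[OF Ud] by (rule Int_absorb1)
    finally show ?thesis
      using Ud 1 by simp
  next
    case 2
    have dd: "tdom d = {0..1}" "tdom d' = {0..1}"
      using 2 rv(3)[OF d] by (auto simp: tdom_def)
    have "continuous_map (top_of_set {0..1}) (top_of_set {0..1::real}) (\<lambda>t. 1 - t)"
      by (auto intro!: continuous_intros)
    from openin_continuous_map_preimage[OF this Ud[unfolded dd]]
    have "openin (top_of_set {0..1}) {t \<in> {0..1}. 1 - t \<in> U}"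
      by simp
    also have "{t \<in> {0..1}. 1 - t \<in> U} = {t \<in> tdom d'. curve d' t \<in> curve d ` U}"
    proof -
      have "curve d' t \<in> curve d ` U \<longleftrightarrow> 1 - t \<in> U" if "t \<in> tdom d'" for t
        using mem[OF that] 2 by simp
      then show ?thesis
        unfolding dd by (simp cong: conj_cong)
    qed
    finally show ?thesis
      unfolding dd .
  next
    case 3
    have "curve d' t \<notin> curve d ` U" if "t \<in> tdom d'" for t
      unfolding mem[OF that] using 3 by blast
    then have "{t \<in> tdom d'. curve d' t \<in> curve d ` U} = {}"
      by auto
    then show ?thesis
      by (simp only: openin_empty)
  qed
qed

abbreviation region :: "'v \<times> 'v \<Rightarrow> (('v + 'v set) \<times> real) set" where
  "region d \<equiv> curve d ` tinner d"

lemma region_meet: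
  assumes "d \<in> nonleaf" "d' \<in> nonleaf" "x \<in> region d" "x \<in> region d'"
  shows "d' = d \<or> fin d \<and> d' = rv d"
proof -
  obtain s t where "s \<in> tinner d" "t \<in> tinner d'" "curve d s = curve d' t"
    using assms(3,4) by auto
  then show ?thesis
    using curve_eq_region[OF nonleaf_D[OF assms(1)] nonleaf_D[OF assms(2)]] inner_sub by blast
qed

text \<open>A leaf at the far end would be the start of \<open>rv d\<close>, which
  \<open>nonleaf\<close> excludes. So a thread counted from both sides is never dead.\<close>

lemma dead_rv:
  assumes "d \<in> nonleaf" "fin d" "rv d \<in> nonleaf" shows "\<not> dead d" "\<not> dead (rv d)"
  using assms rv(3,5)[of d] by (auto simp: dead_def leaf_end_def nonleaf_def)

text \<open>Only the part before the midpoint is examined, so the two halves of a finite thread can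
  be charged independently.\<close>

definition unused :: "(('v + 'v set) \<times> real) set \<Rightarrow> 'v \<times> 'v \<Rightarrow> bool" where
  "unused A d \<longleftrightarrow> (\<exists>s. 0 < s \<and> s < 1/2 \<and> curve d s \<notin> A)"

end

section \<open>Charging the ends of an arc to half-threads\<close>

locale arc_in_complex = connected_threads V E M + arc: embedded_arc "one_complex V E" g A
  for V :: "'v set" and E M g A
begin

text \<open>The vertices along an infinite thread form an infinite closed discrete set.\<close>

lemma ray_leaves_arc:
  assumes d: "d \<in> D" and inf: "\<not> fin d"
  shows "\<exists>s. 1/2 < s \<and> s < 1 \<and> curve d s \<notin> A"
proof (rule ccontr)
  assume neg: "\<nexists>s. 1/2 < s \<and> s < 1 \<and> curve d s \<notin> A"
  \<comment> \<open>The vertex reached after \<open>i + 2\<close> edges. Its parameter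
    \<open>u / (1 + u)\<close> exceeds 1/2 only for \<open>u > 1\<close>, whence the offset
    2.\<close>
  define w where "w i = curve d (ipar d (real i + 2))" for i :: nat
  have dom: "1/2 < ipar d (real i + 2)" "ipar d (real i + 2) < 1" for i
    using inf by (auto simp: ipar_def field_simps)
  have wA: "w i \<in> A" for i
    using neg dom[of i] by (auto simp: w_def)
  have w_eq: "w i = (Inl (fst (walk d (i + 2))), 0)" for i
  proof -
    have r: "real (i + 2) + 0 \<in> rdom d"
      using inf by (simp add: rdom_def)
    have e: "real i + 2 = real (i + 2) + 0"
      by simp
    have "w i = raw d (real (i + 2) + 0)"
      unfolding w_def curve_def e par_ipar[OF r] ..
    then show ?thesis
      by (simp only: raw_seg[of 0] edge_pt_0 order_refl zero_le_one)
  qed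
  have "w i \<in> (\<lambda>v. (Inl v, 0)) ` V" for i
    unfolding w_eq using dart_verts(1)[OF walk_dart[OF d idx_inf[OF inf]]] by (intro imageI)
  then have wV: "range w \<subseteq> (\<lambda>v. (Inl v, 0)) ` V"
    by blast
  have "inj w"
  proof (rule injI)
    fix i j assume "w i = w j"
    then have "ipar d (real j + 2) = ipar d (real i + 2)"
      using curve_eq_inner[OF d d, of "ipar d (real i + 2)" "ipar d (real j + 2)"] dom[of i] dom[of j] inf
      by (auto simp: w_def open_dom)
    then have "real j + 2 = real i + 2"
      using par_ipar[of "real i + 2" d] par_ipar[of "real j + 2" d] inf by (simp add: rdom_def)
    then show "i = j"
      by simp
  qed
  define T where "T = {t \<in> {0..1}. g t \<in> range w}"
  have "range w \<subseteq> g ` T"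
    using wA unfolding arc.g_image T_def by (auto simp: image_iff) (metis atLeastAtMost_iff)
  then have "infinite T"
    using \<open>inj w\<close> by (meson finite_imageI finite_subset range_inj_infinite)
  then obtain x where x: "x \<in> {0..1}" "x islimpt T"
    using compact_eq_Bolzano_Weierstrass[of "{0..1::real}"] by (auto simp: T_def)
  \<comment> \<open>Without the value at the limit parameter \<open>x\<close> the set of vertices is
    still closed. Its preimage would be a closed set that accumulates at \<open>x\<close> and yet
    avoids it.\<close>
  let ?W = "range w - {g x}"
  let ?P = "{t \<in> {0..1}. g t \<in> ?W}"
  have "closedin X ?W"
    using wV by (intro closedin_vertices) auto
  then have "closedin (top_of_set {0..1}) ?P"
    using closedin_continuous_map_preimage[OF arc.g_cont] by fastforce
  then have "closed ?P"
    by (rule closedin_closed_trans) simp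
  moreover have "x islimpt ?P"
    unfolding islimpt_def
  proof (intro allI impI)
    fix B assume "x \<in> B" "open B"
    then obtain y where y: "y \<in> T" "y \<in> B" "y \<noteq> x"
      using x(2) unfolding islimpt_def by blast
    then have "g y \<noteq> g x"
      using arc.g_inj x(1) by (auto simp: T_def inj_on_def)
    then show "\<exists>y\<in>?P. y \<in> B \<and> y \<noteq> x"
      using y by (auto simp: T_def)
  qed
  ultimately have "x \<in> ?P"
    using closed_limpt by blast
  then show False
    by simp
qed

abbreviation end_in :: "'v \<times> 'v \<Rightarrow> bool" where
  "end_in d \<equiv> g 0 \<in> region d \<or> g 1 \<in> region d"

lemma traverse_inner:
  assumes "d \<in> D" "J \<subseteq> tinner d" "connected J" "1/2 \<in> J" "curve d (1/2) \<in> A" "\<not> end_in d"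
  shows "curve d ` J \<subseteq> A"
  using assms
  by (intro arc.traverse[where S = "tinner d" and ?s0.0 = "1/2"] inj_inner open_curve continuous_inner inner_sub) auto

lemma half_inner: "{0<..1/2} \<subseteq> tinner d" "1/2 \<in> tinner d"
  by (auto simp: tinner_def)

text \<open>With no end inside the thread, the arc would follow the whole half from the midpoint
  towards the start and miss nothing there.\<close>

lemma unused_end:
  assumes "d \<in> D" "curve d (1/2) \<in> A" "unused A d" shows "end_in d"
proof (rule ccontr)
  assume n: "\<not> end_in d"
  have "curve d ` {0<..1/2} \<subseteq> A"
    using assms half_inner n by (intro traverse_inner) auto
  then show False
    using assms(3) unfolding unused_def by force
qed

text \<open>With no end inside the thread, the arc would run from the midpoint along the entire far
  half. At a leaf it has to stop, which puts an end there after all; on an infinite thread this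
  contradicts \<open>ray_leaves_arc\<close>.\<close>

lemma dead_end:
  assumes d: "d \<in> D" "curve d (1/2) \<in> A" "dead d" shows "end_in d"
proof (rule ccontr)
  assume n: "\<not> end_in d"
  show False
  proof (cases "leaf_end d")
    case True
    then have i: "tinner d = {0<..1}"
      by (simp add: tinner_def)
    have "curve d ` {1/2..1} \<subseteq> A"
      using assms n i by (intro traverse_inner) auto
    then have "curve d 1 \<in> A"
      by force
    then have e: "curve d 1 = g 0 \<or> curve d 1 = g 1"
      using inj_inner[OF d(1)] open_curve[OF d(1)] unfolding i by (intro arc.half_open_end)
    have "curve d 1 \<in> region d"
      unfolding i by (rule imageI) simp
    with e n show False
      by metis
  next
    case False
    then have "\<not> fin d" "tinner d = {0<..<1}"
      using d(3) by (auto simp: dead_def tinner_def)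
    moreover have "curve d ` {1/2..<1} \<subseteq> A"
      using assms n False by (intro traverse_inner) (auto simp: tinner_def)
    ultimately show False
      using ray_leaves_arc[OF d(1)] by force
  qed
qed

text \<open>The arc contains the midpoint but misses a point before it; after it, either a point is
  missed or the thread stops at a leaf. Being connected, the arc is confined to the piece in
  between, with both its ends.\<close>

lemma trapped_inner:
  assumes d: "d \<in> D" "curve d (1/2) \<in> A" and s: "0 < a" "a < 1/2" "curve d a \<notin> A"
    and b: "1/2 < b" "b < 1 \<and> curve d b \<notin> A \<or> leaf_end d \<and> b = 1"
  shows "g 0 \<in> region d \<and> g 1 \<in> region d"
proof -
  let ?C = "{a..b}"
  define U where "U = (if b < 1 then {a<..<b} else {a<..1})"
  have bt: "?C \<subseteq> tinner d"
    using s b by (auto simp: tinner_def)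
  have "U = tinner d \<inter> (if b < 1 then {a<..<b} else {a<..})"
    using s b by (auto simp: U_def tinner_def)
  then have "openin (top_of_set (tinner d)) U"
    by (metis open_greaterThan open_greaterThanLessThan openin_open_Int)
  then have "openin X (curve d ` U)"
    using open_curve d by blast
  moreover have "closedin X (curve d ` ?C)"
  proof -
    have "continuous_map (top_of_set ?C) X (curve d)"
      using d(1) order_trans[OF bt inner_sub] by (rule continuous_inner)
    then have "compactin X (curve d ` ?C)"
      by (intro image_compactin[where X = "top_of_set ?C"]) (auto simp: compactin_subtopology)
    then show ?thesis
      using compactin_imp_closedin[OF Hausdorff_X] by simp
  qed
  moreover have "U \<subseteq> ?C"
    using b by (auto simp: U_def)
  moreover have "A \<inter> curve d ` ?C \<subseteq> curve d ` U"
  proof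
    fix x assume "x \<in> A \<inter> curve d ` ?C"
    then obtain t where t: "x = curve d t" "a \<le> t" "t \<le> b" "curve d t \<in> A"
      by auto
    moreover have "t \<noteq> a" "b < 1 \<Longrightarrow> t \<noteq> b"
      using t s b by auto
    ultimately have "t \<in> U"
      using b by (auto simp: U_def)
    then show "x \<in> curve d ` U"
      using t by blast
  qed
  moreover have "1/2 \<in> U"
    using s b by (auto simp: U_def)
  then have "A \<inter> curve d ` U \<noteq> {}"
    using d(2) by blast
  ultimately have "A \<subseteq> curve d ` U"
    by (intro arc.trapped[where C = "curve d ` ?C"]) auto
  also have "\<dots> \<subseteq> region d"
    using bt \<open>U \<subseteq> ?C\<close> by blast
  finally show ?thesis
    unfolding arc.g_image by auto
qed

text \<open>A thread charged from both sides pays with both ends of the arc.\<close>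

lemma both_unused:
  assumes d: "d \<in> D" "curve d (1/2) \<in> A" "fin d" "unused A d" "unused A (rv d)"
  shows "g 0 \<in> region d \<and> g 1 \<in> region d"
proof -
  obtain a where a: "0 < a" "a < 1/2" "curve d a \<notin> A"
    using d(4) unfolding unused_def by blast
  obtain b where b: "0 < b" "b < 1/2" "curve (rv d) b \<notin> A"
    using d(5) unfolding unused_def by blast
  then have "1/2 < 1 - b" "1 - b < 1 \<and> curve d (1 - b) \<notin> A"
    using curve_rv[OF d(1,3), of b] by auto
  then show ?thesis
    using trapped_inner[OF d(1,2) a] by blast
qed

lemma dead_unused:
  assumes d: "d \<in> D" "curve d (1/2) \<in> A" "dead d" "unused A d"
  shows "g 0 \<in> region d \<and> g 1 \<in> region d"
proof -
  obtain a where a: "0 < a" "a < 1/2" "curve d a \<notin> A"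
    using d(4) unfolding unused_def by blast
  show ?thesis
  proof (cases "leaf_end d")
    case True
    then show ?thesis
      using trapped_inner[OF d(1,2) a, of 1] by simp
  next
    case False
    then have "\<not> fin d"
      using d(3) by (simp add: dead_def)
    then obtain b where "1/2 < b" "b < 1" "curve d b \<notin> A"
      using ray_leaves_arc[OF d(1)] by metis
    then show ?thesis
      using trapped_inner[OF d(1,2) a] by blast
  qed
qed

lemma count_ends:
  assumes Q: "finite Q" "Q \<subseteq> nonleaf" "\<And>d. d \<in> Q \<Longrightarrow> curve d (1/2) \<in> A"
  shows "card {d \<in> Q. unused A d} + card {d \<in> Q. dead d} \<le> 2"
proof -
  define El where "El = {d \<in> Q. unused A d} \<times> {True} \<union> {d \<in> Q. dead d} \<times> {False}"
  have El_fin: "finite El"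
    using Q(1) by (simp add: El_def)
  have El_card: "card El = card {d \<in> Q. unused A d} + card {d \<in> Q. dead d}"
    unfolding El_def using Q(1) by (subst card_Un_disjoint) (auto simp: card_cartesian_product)
  have ends: "end_in (fst x)" if "x \<in> El" for x
  proof -
    have x: "fst x \<in> Q" "unused A (fst x) \<or> dead (fst x)"
      using that by (auto simp: El_def)
    then have "fst x \<in> D" "curve (fst x) (1/2) \<in> A"
      using Q nonleaf_D by blast+
    then show ?thesis
      using x(2) unused_end dead_end by metis
  qed
  have El_nonleaf: "fst x \<in> nonleaf" if "x \<in> El" for x
    using that Q by (auto simp: El_def)
  have "card El \<le> 2"
  proof (cases "\<exists>x\<in>El. \<exists>y\<in>El. x \<noteq> y \<and> region (fst x) \<inter> region (fst y) \<noteq> {}")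
    case True
    then obtain x y where xy: "x \<in> El" "y \<in> El" "x \<noteq> y" "region (fst x) \<inter> region (fst y) \<noteq> {}"
      by blast
    define d where "d = fst x"
    have d: "d \<in> nonleaf" "d \<in> D" "d \<in> Q"
      using El_nonleaf[OF xy(1)] nonleaf_D xy(1) by (auto simp: d_def El_def)
    have "fst y = d \<or> fin d \<and> fst y = rv d"
      using region_meet[OF d(1) El_nonleaf[OF xy(2)]] xy(4) by (auto simp: d_def)
    then consider "fst y = d" | "fin d" "fst y = rv d" "rv d \<in> nonleaf"
      using El_nonleaf[OF xy(2)] by auto
    then have "(g 0 \<in> region d \<and> g 1 \<in> region d) \<and> (dead d \<longrightarrow> \<not> (fin d \<and> rv d \<in> nonleaf))"
    proof cases
      case 1
      then have "dead d" "unused A d"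
        using xy(1-3) by (auto simp: El_def d_def)
      then show ?thesis
        using dead_unused d Q dead_rv(1) by blast
    next
      case 2
      then have "\<not> dead d" "\<not> dead (rv d)"
        using dead_rv[of d] d by auto
      then have "unused A d" "unused A (rv d)"
        using xy 2 by (auto simp: El_def d_def)
      then show ?thesis
        using both_unused d 2 Q \<open>\<not> dead d\<close> by blast
    qed
    then have both: "g 0 \<in> region d" "g 1 \<in> region d" and nd: "dead d \<Longrightarrow> \<not> (fin d \<and> rv d \<in> nonleaf)"
      by auto
    have z: "fst z = d \<or> fin d \<and> fst z = rv d \<and> rv d \<in> nonleaf" if "z \<in> El" for z
    proof -
      have "fst z = d \<or> fin d \<and> fst z = rv d"
        using ends[OF that] region_meet[OF d(1) El_nonleaf[OF that] both(1)]
          region_meet[OF d(1) El_nonleaf[OF that] both(2)] by argo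
      then show ?thesis
        using El_nonleaf[OF that] by metis
    qed
    have "El \<subseteq> (if dead d then {(d, True), (d, False)} else {(d, True), (rv d, True)})"
    proof
      fix z assume zE: "z \<in> El"
      show "z \<in> (if dead d then {(d, True), (d, False)} else {(d, True), (rv d, True)})"
      proof (cases "dead d")
        case True
        then have "fst z = d"
          using z[OF zE] nd by blast
        then show ?thesis
          using True by (cases z) auto
      next
        case False
        then have "\<not> dead (fst z)"
          using z[OF zE] dead_rv(2)[of d] d by auto
        then have "snd z"
          using zE by (auto simp: El_def)
        then show ?thesis
          using False z[OF zE] by (cases z) auto
      qed
    qed
    moreover have "card (if dead d then {(d, True), (d, False)} else {(d, True), (rv d, True)}) \<le> 2"
      by (simp add: card_insert_if)
    moreover have "finite (if dead d then {(d, True), (d, False)} else {(d, True), (rv d, True)})"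
      by simp
    ultimately show ?thesis
      using card_mono le_trans by blast
  next
    case False
    define f where "f x = (if g 0 \<in> region (fst x) then 0 else 1 :: nat)" for x :: "('v \<times> 'v) \<times> bool"
    have "inj_on f El"
    proof (rule inj_onI)
      fix x y assume xy: "x \<in> El" "y \<in> El" "f x = f y"
      then have "region (fst x) \<inter> region (fst y) \<noteq> {}"
        using ends[OF xy(1)] ends[OF xy(2)] by (auto simp: f_def split: if_splits)
      then show "x = y"
        using False xy by blast
    qed
    moreover have "f ` El \<subseteq> {0, 1}"
      by (auto simp: f_def)
    ultimately have "card El \<le> card {0, 1 :: nat}"
      by (intro card_inj_on_le) auto
    then show ?thesis
      by simp
  qed
  then show ?thesis
    using El_card by simp
qed

text \<open>Three half-threads contained in the arc near \<open>v\<close> would form a triod inside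
  it.\<close>

lemma used_at_vertex:
  assumes Q: "finite Q" "Q \<subseteq> nonleaf" "\<And>d. d \<in> Q \<Longrightarrow> fst d = v" and used: "\<And>d. d \<in> Q \<Longrightarrow> \<not> unused A d"
  shows "card Q \<le> 2"
proof (rule ccontr)
  assume "\<not> card Q \<le> 2"
  then have "3 \<le> card Q"
    by simp
  then obtain T where "T \<subseteq> Q" "card T = 3"
    by (meson obtain_subset_with_card_n)
  then obtain d1 d2 d3 where d: "{d1, d2, d3} \<subseteq> Q" "d1 \<noteq> d2" "d1 \<noteq> d3" "d2 \<noteq> d3"
    by (auto simp: card_3_iff)
  have QD: "i \<in> D" if "i \<in> Q" for i
    using Q that nonleaf_D by blast
  have vM: "v \<in> M"
    using d Q(3) D_M QD by (metis insert_subset)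
  show False
  proof (rule arc.no_triod[OF d(2-4,1), of "1/4" curve])
    show "continuous_map (top_of_set {0..1/4}) X (curve i)" if "i \<in> Q" for i
      using QD that by (intro continuous_inner) (auto simp: tdom_def)
    show "curve i 0 = (Inl v, 0)" if "i \<in> Q" for i
      using Q(3) that by simp
    show "curve i s \<in> A \<and> curve i s \<noteq> (Inl v, 0)" if "i \<in> Q" "0 < s" "s \<le> 1/4" for i s
      using used[OF that(1)] that curve_inner_notM[of s v i] vM by (auto simp: unused_def)
    show "curve i s \<noteq> curve j t" if "i \<in> Q" "j \<in> Q" "i \<noteq> j" "0 < s" "s \<le> 1/4" "0 < t" "t \<le> 1/4" for i j s t
      using curve_eq_inner[OF QD[OF that(1)] QD[OF that(2)], of s t] that open_dom[of t j] by auto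
  qed auto
qed

end

section \<open>The six plane graphs\<close>

definition loop :: "real \<Rightarrow> complex" where
  "loop t = cis (2 * pi * t)"

lemma continuous_on_loop [continuous_intros]: "continuous_on S loop"
  unfolding loop_def by (intro continuous_intros)

lemma loop_0 [simp]: "loop 0 = 1" and loop_1 [simp]: "loop 1 = 1" and norm_loop [simp]: "norm (loop t) = 1"
  by (simp_all add: loop_def)

lemma loop_eq_iff:
  assumes "s \<in> {0..1}" "t \<in> {0..1}"
  shows "loop s = loop t \<longleftrightarrow> s = t \<or> s \<in> {0, 1} \<and> t \<in> {0, 1}"
proof
  assume "loop s = loop t"
  then have "sin (2 * pi * s) = sin (2 * pi * t) \<and> cos (2 * pi * s) = cos (2 * pi * t)"
    by (simp add: loop_def complex_eq_iff)
  then obtain n :: int where "2 * pi * s = 2 * pi * t + 2 * pi * n"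
    unfolding sin_cos_eq_iff by blast
  then have "2 * pi * (s - t - n) = 0"
    by (simp add: algebra_simps)
  then have n: "s = t + n"
    by simp
  then have "-1 \<le> real_of_int n" "real_of_int n \<le> 1"
    using assms by auto
  then have "n = -1 \<or> n = 0 \<or> n = 1"
    by linarith
  then show "s = t \<or> s \<in> {0, 1} \<and> t \<in> {0, 1}"
    using n assms by auto
qed auto

lemma loop_eq_1_iff: "s \<in> {0..1} \<Longrightarrow> loop s = 1 \<longleftrightarrow> s = 0 \<or> s = 1"
  using loop_eq_iff[of s 0] by auto

lemma loop_image: "loop ` {0..1} = sphere 0 1" "loop ` {0..<1} = sphere 0 1"
proof -
  have "z \<in> loop ` {0..<1}" if "z \<in> sphere 0 1" for z
  proof -
    have "(Re z)\<^sup>2 + (Im z)\<^sup>2 = 1"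
      using that by (simp add: cmod_def)
    then obtain t where t: "0 \<le> t" "t < 2 * pi" "Re z = cos t" "Im z = sin t"
      using sincos_total_2pi by metis
    then show ?thesis
      by (intro image_eqI[of _ _ "t / (2 * pi)"]) (auto simp: loop_def complex_eq_iff)
  qed
  moreover have "loop ` {0..<1} \<subseteq> loop ` {0..1}"
    by (intro image_mono) auto
  moreover have "loop ` {0..1} \<subseteq> sphere 0 1"
    by auto
  ultimately show "loop ` {0..1} = sphere 0 1" "loop ` {0..<1} = sphere 0 1"
    by blast+
qed

text \<open>The two signs give circles based at \<open>c + 1\<close> and at \<open>c - 1\<close>, so
  the base point can be put where the circle touches the rest of the figure.\<close>

lemma shifted_loop_image:
  "(\<lambda>t. c + loop t) ` {0..1} = sphere c 1" "(\<lambda>t. c - loop t) ` {0..1} = sphere c 1"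
proof -
  have "(\<lambda>t. c + loop t) ` {0..1} = (+) c ` sphere 0 1"
    unfolding loop_image[symmetric] by (simp add: image_image)
  then show "(\<lambda>t. c + loop t) ` {0..1} = sphere c 1"
    by (simp add: sphere_translation[symmetric])
  have "(\<lambda>t. c - loop t) ` {0..1} = (\<lambda>z. c - z) ` sphere 0 1"
    unfolding loop_image[symmetric] by (simp add: image_image)
  also have "\<dots> = sphere c 1"
  proof (intro equalityI subsetI)
    fix z assume "z \<in> sphere c 1"
    then show "z \<in> (\<lambda>z. c - z) ` sphere 0 1"
      by (intro image_eqI[of _ _ "c - z"]) (auto simp: dist_norm norm_minus_commute)
  qed (auto simp: dist_norm)
  finally show "(\<lambda>t. c - loop t) ` {0..1} = sphere c 1" .
qed

section \<open>Arcs through finitely many points of the plane graphs\<close>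

lemma is_arc_path_image:
  fixes \<gamma> :: "real \<Rightarrow> 'a::t2_space"
  assumes "arc \<gamma>" "path_image \<gamma> \<subseteq> K"
  shows "is_arc (top_of_set K) (path_image \<gamma>)"
proof -
  have "path_image \<gamma> homeomorphic {0..1::real}"
    using homeomorphic_arc_image_interval[OF assms(1)] by simp
  then obtain f h where "homeomorphism (path_image \<gamma>) {0..1::real} f h"
    unfolding homeomorphic_def by blast
  then have "homeomorphic_maps (top_of_set (path_image \<gamma>)) (top_of_set {0..1::real}) f h"
    unfolding homeomorphism_def homeomorphic_maps_def by (simp add: image_subset_iff_funcset[symmetric])
  then have "top_of_set (path_image \<gamma>) homeomorphic_space top_of_set {0..1::real}"
    unfolding homeomorphic_space_def by blast
  then show ?thesis
    using assms(2) unfolding is_arc_def by (simp add: subtopology_subtopology Int_absorb1)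
qed

lemma omega_acI:
  fixes K :: "'a::t2_space set"
  assumes "\<And>S. finite S \<Longrightarrow> S \<subseteq> K \<Longrightarrow> \<exists>\<gamma>. arc \<gamma> \<and> path_image \<gamma> \<subseteq> K \<and> S \<subseteq> path_image \<gamma>"
  shows "omega_ac (top_of_set K)"
  unfolding omega_ac_def n_ac_def
proof (intro allI impI)
  fix n S assume "S \<subseteq> topspace (top_of_set K) \<and> finite S \<and> card S \<le> n"
  then obtain \<gamma> where "arc \<gamma>" "path_image \<gamma> \<subseteq> K" "S \<subseteq> path_image \<gamma>"
    using assms[of S] by auto
  then show "\<exists>A. is_arc (top_of_set K) A \<and> S \<subseteq> A"
    using is_arc_path_image by blast
qed

lemma n_ac_homeomorphic:
  assumes "X homeomorphic_space Y" "n_ac n X" shows "n_ac n Y"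
  unfolding n_ac_def
proof (intro allI impI, elim conjE)
  fix S assume S: "S \<subseteq> topspace Y" "finite S" "card S \<le> n"
  obtain f g where fg: "homeomorphic_maps X Y f g"
    using assms(1) unfolding homeomorphic_space_def by blast
  then have gS: "g ` S \<subseteq> topspace X" "finite (g ` S)" "card (g ` S) \<le> n"
    using S card_image_le[OF S(2), of g] by (auto simp: homeomorphic_maps_def continuous_map_def)
  then obtain A where A: "is_arc X A" "g ` S \<subseteq> A"
    using assms(2) unfolding n_ac_def by blast
  have A_sub: "A \<subseteq> topspace X"
    using A(1) by (simp add: is_arc_def)
  have "homeomorphic_map X Y f"
    using fg homeomorphic_map_maps by blast
  then have "homeomorphic_map (subtopology X A) (subtopology Y (f ` A)) f"
    using homeomorphic_map_subtopologies A_sub homeomorphic_imp_surjective_map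
    by (metis Int_absorb1 image_mono)
  then have "subtopology Y (f ` A) homeomorphic_space top_of_set {0..1::real}"
    using A(1) homeomorphic_map_imp_homeomorphic_space homeomorphic_space_sym homeomorphic_space_trans
    unfolding is_arc_def by metis
  moreover have "f ` A \<subseteq> topspace Y"
    using A_sub fg by (auto simp: homeomorphic_maps_def continuous_map_def)
  moreover have "S \<subseteq> f ` A"
  proof
    fix y assume y: "y \<in> S"
    then have "f (g y) = y"
      using fg S(1) by (auto simp: homeomorphic_maps_def)
    then show "y \<in> f ` A"
      using A(2) y by (metis image_eqI imageI subsetD)
  qed
  ultimately show "\<exists>A. is_arc Y A \<and> S \<subseteq> A"
    unfolding is_arc_def by blast
qed

lemma omega_ac_homeomorphic: "X homeomorphic_space Y \<Longrightarrow> omega_ac X \<Longrightarrow> omega_ac Y"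
  unfolding omega_ac_def using n_ac_homeomorphic by blast

text \<open>Only finitely many inner parameters lead into \<open>S\<close>, so they keep away from 0
  and 1. What lies outside [a, b] can be cut off without losing an inner point of
  \<open>S\<close>.\<close>

lemma finite_margin:
  fixes \<kappa> :: "real \<Rightarrow> 'a"
  assumes "inj_on \<kappa> {0<..<1}" "finite S"
  obtains a b where "0 < a" "a < b" "b < 1" "\<And>t. 0 < t \<Longrightarrow> t < 1 \<Longrightarrow> \<kappa> t \<in> S \<Longrightarrow> a \<le> t \<and> t \<le> b"
proof -
  \<comment> \<open>The values 1/3 and 2/3 make the set nonempty and its minimum smaller than its
    maximum.\<close>
  define F where "F = insert (1/3) (insert (2/3) {t \<in> {0<..<1}. \<kappa> t \<in> S})"
  have "finite (\<kappa> -` S \<inter> {0<..<1})"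
    using assms by (intro finite_vimage_IntI) auto
  moreover have "\<kappa> -` S \<inter> {0<..<1} = {t \<in> {0<..<1}. \<kappa> t \<in> S}"
    by auto
  ultimately have F: "finite F" "F \<noteq> {}"
    by (auto simp: F_def)
  have m: "Min F \<in> F" "Max F \<in> F"
    using F by auto
  have l: "Min F \<le> t" "t \<le> Max F" if "t \<in> F" for t
    using F that by auto
  show thesis
  proof (rule that[of "Min F" "Max F"])
    show "0 < Min F" "Max F < 1"
      using m by (auto simp: F_def)
    show "Min F < Max F"
      using l(1)[of "1/3"] l(2)[of "2/3"] by (auto simp: F_def)
    show "Min F \<le> t \<and> t \<le> Max F" if "0 < t" "t < 1" "\<kappa> t \<in> S" for t
      using l[of t] that by (auto simp: F_def)
  qed
qed

lemma arc_subpath_inj: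
  assumes "path \<gamma>" "0 \<le> u" "u < v" "v \<le> 1" "inj_on \<gamma> {u..v}"
  shows "arc (subpath u v \<gamma>)" "path_image (subpath u v \<gamma>) = \<gamma> ` {u..v}"
  using assms path_subpath[of \<gamma> u v]
  by (auto simp: arc_subpath_eq closed_segment_eq_real_ivl path_image_subpath)

text \<open>Only at a missing endpoint does the segment have to stop short; a present endpoint is
  kept.\<close>

lemma omega_ac_arc:
  assumes "R \<subseteq> {0, 1}" shows "omega_ac (top_of_set (arc_graph - R))"
proof (rule omega_acI)
  fix S assume S: "finite S" "S \<subseteq> arc_graph - R"
  have "inj_on complex_of_real {0<..<1}"
    by (auto simp: inj_on_def)
  then obtain a b where ab: "0 < a" "a < b" "b < 1"
    "\<And>t. 0 < t \<Longrightarrow> t < 1 \<Longrightarrow> complex_of_real t \<in> S \<Longrightarrow> a \<le> t \<and> t \<le> b"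
    using finite_margin[OF _ S(1)] by metis
  define lo where "lo = (if 0 \<in> R then a else 0)"
  define hi where "hi = (if 1 \<in> R then b else 1)"
  have lh: "0 \<le> lo" "lo < hi" "hi \<le> 1"
    using ab by (auto simp: lo_def hi_def)
  have ag: "z \<in> arc_graph \<longleftrightarrow> Im z = 0 \<and> 0 \<le> Re z \<and> Re z \<le> 1" for z
    using mem_real_segment[of 0 1 z] by (simp add: arc_graph_def)
  have seg: "z \<in> closed_segment (of_real lo) (of_real hi) \<longleftrightarrow> Im z = 0 \<and> lo \<le> Re z \<and> Re z \<le> hi" for z
    using mem_real_segment[of lo hi z] lh by simp
  have "arc (linepath (complex_of_real lo) (of_real hi))"
    using lh by (intro arc_linepath) simp
  moreover have "path_image (linepath (complex_of_real lo) (of_real hi)) \<subseteq> arc_graph - R"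
  proof
    fix z assume "z \<in> path_image (linepath (complex_of_real lo) (of_real hi))"
    then have z: "Im z = 0" "lo \<le> Re z" "Re z \<le> hi"
      using seg by auto
    then have "z \<notin> R"
      using assms ab by (auto simp: lo_def hi_def split: if_splits)
    then show "z \<in> arc_graph - R"
      using z lh by (simp add: ag)
  qed
  moreover have "S \<subseteq> path_image (linepath (complex_of_real lo) (of_real hi))"
  proof
    fix z assume z: "z \<in> S"
    then have "Im z = 0" "0 \<le> Re z" "Re z \<le> 1" "z \<notin> R"
      using S(2) ag by auto
    moreover from this have "z = of_real (Re z)"
      by (simp add: complex_eq_iff)
    moreover have "0 \<in> R \<Longrightarrow> Re z \<noteq> 0" "1 \<in> R \<Longrightarrow> Re z \<noteq> 1"
      using calculation by (metis of_real_0 of_real_1)+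
    moreover have "a \<le> Re z \<and> Re z \<le> b" if "Re z \<noteq> 0" "Re z \<noteq> 1"
      using ab(4)[of "Re z"] calculation(1-5) that z by (simp add: less_le)
    ultimately have "lo \<le> Re z" "Re z \<le> hi"
      using ab(1-3) by (cases "Re z = 0"; cases "Re z = 1"; simp add: lo_def hi_def)+
    then show "z \<in> path_image (linepath (complex_of_real lo) (of_real hi))"
      using seg \<open>Im z = 0\<close> by simp
  qed
  ultimately show "\<exists>\<gamma>. arc \<gamma> \<and> path_image \<gamma> \<subseteq> arc_graph - R \<and> S \<subseteq> path_image \<gamma>"
    by blast
qed

text \<open>A finite set misses an open piece just before the loop closes, and the rest of the
  circle is an arc.\<close>

lemma omega_ac_circle: "omega_ac (top_of_set circle_graph)"
proof (rule omega_acI)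
  fix S assume S: "finite S" "S \<subseteq> circle_graph"
  have "inj_on loop {0<..<1}"
    by (auto simp: inj_on_def loop_eq_iff)
  then obtain a b where ab: "0 < a" "a < b" "b < 1" "\<And>t. 0 < t \<Longrightarrow> t < 1 \<Longrightarrow> loop t \<in> S \<Longrightarrow> a \<le> t \<and> t \<le> b"
    using finite_margin[OF _ S(1)] by metis
  have "inj_on loop {0..b}"
    using ab by (auto simp: inj_on_def loop_eq_iff)
  moreover have "path loop"
    unfolding path_def by (intro continuous_intros)
  ultimately have sp: "arc (subpath 0 b loop)" "path_image (subpath 0 b loop) = loop ` {0..b}"
    using ab arc_subpath_inj[of loop 0 b] by auto
  moreover have "loop ` {0..b} \<subseteq> circle_graph"
    by (auto simp: circle_graph_def)
  moreover have "S \<subseteq> loop ` {0..b}"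
  proof
    fix z assume z: "z \<in> S"
    then have "z \<in> loop ` {0..<1}"
      using S(2) unfolding loop_image circle_graph_def by blast
    then obtain t where t: "0 \<le> t" "t < 1" "z = loop t"
      by auto
    then have "t \<le> b"
      using ab z by (cases "t = 0") auto
    then show "z \<in> loop ` {0..b}"
      using t by auto
  qed
  ultimately show "\<exists>\<gamma>. arc \<gamma> \<and> path_image \<gamma> \<subseteq> circle_graph \<and> S \<subseteq> path_image \<gamma>"
    by metis
qed

text \<open>An arc enters the first curve just after its start, crosses the middle arc, and
  stops just before the end of the last curve.\<close>

lemma omega_ac_three:
  fixes g h k :: "real \<Rightarrow> 'a::real_normed_vector"
  assumes paths: "path g" "path k" "arc h"
    and g: "inj_on g {0<..1}" and k: "inj_on k {0..<1}"
    and joins: "g 1 = pathstart h" "pathfinish h = k 0"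
    and ends: "g 0 \<in> path_image h" "k 1 \<in> path_image h"
    and gh: "\<And>s. 0 < s \<Longrightarrow> s < 1 \<Longrightarrow> g s \<notin> path_image h"
    and kh: "\<And>s. 0 < s \<Longrightarrow> s < 1 \<Longrightarrow> k s \<notin> path_image h"
    and gk: "\<And>s t. 0 < s \<Longrightarrow> s < 1 \<Longrightarrow> 0 < t \<Longrightarrow> t < 1 \<Longrightarrow> g s \<noteq> k t"
    and K: "K = g ` {0..1} \<union> path_image h \<union> k ` {0..1}"
  shows "omega_ac (top_of_set K)"
proof (rule omega_acI)
  fix S assume S: "finite S" "S \<subseteq> K"
  have "inj_on g {0<..<1}" "inj_on k {0<..<1}"
    using g k by (auto intro: inj_on_subset)
  note inj = this
  obtain a a' where a: "0 < a" "a < a'" "a' < 1" "\<And>t. 0 < t \<Longrightarrow> t < 1 \<Longrightarrow> g t \<in> S \<Longrightarrow> a \<le> t \<and> t \<le> a'"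
    using finite_margin[OF inj(1) S(1)] by metis
  obtain b' b where b: "0 < b'" "b' < b" "b < 1" "\<And>t. 0 < t \<Longrightarrow> t < 1 \<Longrightarrow> k t \<in> S \<Longrightarrow> b' \<le> t \<and> t \<le> b"
    using finite_margin[OF inj(2) S(1)] by metis
  have ab: "0 < a" "a < 1" "0 < b" "b < 1"
    "\<And>t. 0 < t \<Longrightarrow> t < 1 \<Longrightarrow> g t \<in> S \<Longrightarrow> a \<le> t" "\<And>t. 0 < t \<Longrightarrow> t < 1 \<Longrightarrow> k t \<in> S \<Longrightarrow> t \<le> b"
    using a b by auto
  let ?g = "subpath a 1 g" and ?k = "subpath 0 b k"
  have "inj_on g {a..1}" "inj_on k {0..b}"
    using ab(1-4) by (auto intro: inj_on_subset[OF g] inj_on_subset[OF k])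
  then have sp: "arc ?g" "path_image ?g = g ` {a..1}" "arc ?k" "path_image ?k = k ` {0..b}"
    using ab(1-4) paths arc_subpath_inj[of g a 1] arc_subpath_inj[of k 0 b] by auto
  have hk: "arc (h +++ ?k)"
  proof (rule arc_join[OF paths(3) sp(3)])
    show "pathfinish h = pathstart ?k"
      by (simp add: joins)
    show "path_image h \<inter> path_image ?k \<subseteq> {pathstart ?k}"
    proof
      fix x assume "x \<in> path_image h \<inter> path_image ?k"
      then obtain t where t: "0 \<le> t" "t \<le> b" "x = k t" "k t \<in> path_image h"
        using sp(4) by auto
      then have "t = 0"
        using kh[of t] ab(1-4) by force
      then show "x \<in> {pathstart ?k}"
        using t by simp
    qed
  qed
  have im_hk: "path_image (h +++ ?k) = path_image h \<union> k ` {0..b}"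
    using sp by (simp add: path_image_join joins)
  have ghk: "arc (?g +++ (h +++ ?k))"
  proof (rule arc_join[OF sp(1) hk])
    show "pathfinish ?g = pathstart (h +++ ?k)"
      by (simp add: joins)
    show "path_image ?g \<inter> path_image (h +++ ?k) \<subseteq> {pathstart (h +++ ?k)}"
    proof
      fix x assume "x \<in> path_image ?g \<inter> path_image (h +++ ?k)"
      then obtain s where s: "a \<le> s" "s \<le> 1" "x = g s" and x: "x \<in> path_image h \<union> k ` {0..b}"
        using sp(2) im_hk by auto
      have "s = 1"
      proof (rule ccontr)
        assume "s \<noteq> 1"
        then have s': "0 < s" "s < 1"
          using s ab(1-4) by auto
        with x gh s obtain t where t: "0 \<le> t" "t \<le> b" "g s = k t"
          by auto
        \<comment> \<open>The point \<open>k 0\<close> is the finish of the middle arc, which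
          \<open>g\<close> avoids in its interior.\<close>
        then have "t \<noteq> 0"
          using gh[OF s'] joins pathfinish_in_path_image by metis
        then show False
          using gk[OF s', of t] t ab(1-4) by auto
      qed
      then show "x \<in> {pathstart (h +++ ?k)}"
        using s joins by simp
    qed
  qed
  have im: "path_image (?g +++ (h +++ ?k)) = g ` {a..1} \<union> path_image h \<union> k ` {0..b}"
    using sp im_hk by (simp add: path_image_join joins Un_assoc)
  moreover have "g ` {a..1} \<union> path_image h \<union> k ` {0..b} \<subseteq> K"
    using ab(1-4) unfolding K by (intro Un_mono image_mono) auto
  moreover have "S \<subseteq> g ` {a..1} \<union> path_image h \<union> k ` {0..b}"
  proof
    fix z assume z: "z \<in> S"
    then have "z \<in> g ` {0..1} \<or> z \<in> path_image h \<or> z \<in> k ` {0..1}"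
      using S(2) unfolding K by blast
    then consider "z \<in> g ` {0..1}" | "z \<in> path_image h" | "z \<in> k ` {0..1}"
      by blast
    then show "z \<in> g ` {a..1} \<union> path_image h \<union> k ` {0..b}"
    proof cases
      case 1
      then obtain t where t: "0 \<le> t" "t \<le> 1" "z = g t"
        by auto
      show ?thesis
      proof (cases "t = 0")
        case True
        then show ?thesis
          using t ends by simp
      next
        case False
        then have "a \<le> t"
          using ab(2) ab(5)[of t] z t by (cases "t = 1") auto
        then show ?thesis
          using t by auto
      qed
    next
      case 3
      then obtain t where t: "0 \<le> t" "t \<le> 1" "z = k t"
        by auto
      show ?thesis
      proof (cases "t = 1")
        case True
        then show ?thesis
          using t ends by simp
      next
        case False
        then have "t \<le> b"
          using ab(3) ab(6)[of t] z t by (cases "t = 0") auto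
        then show ?thesis
          using t by auto
      qed
    qed auto
  qed
  ultimately show "\<exists>\<gamma>. arc \<gamma> \<and> path_image \<gamma> \<subseteq> K \<and> S \<subseteq> path_image \<gamma>"
    using ghk by metis
qed

text \<open>The arc starts on the circle just after the junction, runs around to the junction and
  continues along the stick, where it stops short only if the endpoint is missing.\<close>

lemma omega_ac_lollipop:
  assumes "R \<subseteq> {2}" shows "omega_ac (top_of_set (lollipop - R))"
proof (rule omega_acI)
  fix S assume S: "finite S" "S \<subseteq> lollipop - R"
  define tail where "tail t = complex_of_real (1 + t)" for t
  have "inj_on loop {0<..<1}" "inj_on tail {0<..<1}"
    by (auto simp: inj_on_def loop_eq_iff tail_def)
  note inj = this
  obtain a a' where a: "0 < a" "a < a'" "a' < 1" "\<And>t. 0 < t \<Longrightarrow> t < 1 \<Longrightarrow> loop t \<in> S \<Longrightarrow> a \<le> t \<and> t \<le> a'"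
    using finite_margin[OF inj(1) S(1)] by metis
  obtain b' b where b: "0 < b'" "b' < b" "b < 1" "\<And>t. 0 < t \<Longrightarrow> t < 1 \<Longrightarrow> tail t \<in> S \<Longrightarrow> b' \<le> t \<and> t \<le> b"
    using finite_margin[OF inj(2) S(1)] by metis
  have ab: "0 < a" "a < 1" "0 < b" "b < 1"
    "\<And>t. 0 < t \<Longrightarrow> t < 1 \<Longrightarrow> loop t \<in> S \<Longrightarrow> a \<le> t" "\<And>t. 0 < t \<Longrightarrow> t < 1 \<Longrightarrow> tail t \<in> S \<Longrightarrow> t \<le> b"
    using a b by auto
  define hi where "hi = (if 2 \<in> R then 1 + b else 2)"
  have hi: "1 < hi" "hi \<le> 2"
    using ab(1-4) by (auto simp: hi_def)
  let ?g = "subpath a 1 loop" and ?h = "linepath (1::complex) (of_real hi)"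
  have "inj_on loop {a..1}"
    using ab(1-4) by (auto simp: inj_on_def loop_eq_iff)
  moreover have "path loop"
    unfolding path_def by (intro continuous_intros)
  ultimately have sp: "arc ?g" "path_image ?g = loop ` {a..1}"
    using ab(1-4) arc_subpath_inj[of loop a 1] by auto
  have seg: "z \<in> path_image ?h \<longleftrightarrow> Im z = 0 \<and> 1 \<le> Re z \<and> Re z \<le> hi" for z
    using mem_real_segment[of 1 hi z] hi by simp
  have lol: "z \<in> lollipop \<longleftrightarrow> norm z = 1 \<or> Im z = 0 \<and> 1 \<le> Re z \<and> Re z \<le> 2" for z
    using mem_real_segment[of 1 2 z] by (auto simp: lollipop_def)
  have "arc (?g +++ ?h)"
  proof (rule arc_join[OF sp(1)])
    show "arc ?h"
      using hi by (intro arc_linepath) (auto simp: complex_eq_iff)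
    show "pathfinish ?g = pathstart ?h"
      by simp
    show "path_image ?g \<inter> path_image ?h \<subseteq> {pathstart ?h}"
    proof
      fix z assume z: "z \<in> path_image ?g \<inter> path_image ?h"
      then have "norm z = 1"
        using sp(2) by auto
      moreover have "Im z = 0" "1 \<le> Re z"
        using z seg by auto
      ultimately have "z = 1"
        by (simp add: complex_eq_iff cmod_def)
      then show "z \<in> {pathstart ?h}"
        by simp
    qed
  qed
  moreover have im: "path_image (?g +++ ?h) = loop ` {a..1} \<union> path_image ?h"
    using sp(2) by (simp add: path_image_join)
  have "path_image (?g +++ ?h) \<subseteq> lollipop - R"
  proof
    fix z assume "z \<in> path_image (?g +++ ?h)"
    then consider "norm z = 1" | "z \<in> path_image ?h"
      using im by auto
    then show "z \<in> lollipop - R"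
    proof cases
      case 1
      then show ?thesis
        using lol assms by auto
    next
      case 2
      then have z: "Im z = 0" "1 \<le> Re z" "Re z \<le> hi"
        using seg by auto
      then have "z \<notin> R"
        using assms ab(4) by (auto simp: hi_def split: if_splits)
      then show ?thesis
        using z hi lol by auto
    qed
  qed
  moreover have "S \<subseteq> path_image (?g +++ ?h)"
  proof
    fix z assume z: "z \<in> S"
    then have zl: "z \<in> lollipop" "z \<notin> R"
      using S(2) by auto
    show "z \<in> path_image (?g +++ ?h)"
    proof (cases "norm z = 1")
      case True
      then have "z \<in> loop ` {0..1}"
        unfolding loop_image by simp
      then obtain t where "t \<in> {0..1}" and zt: "z = loop t"
        by blast
      then have t: "0 \<le> t" "t \<le> 1"
        by auto
      have "z \<in> loop ` {a..1}"
      proof (cases "t = 0 \<or> t = 1")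
        case True
        then have "z = loop 1"
          using zt by auto
        then show ?thesis
          using ab(2) by (intro image_eqI[of _ _ 1]) simp_all
      next
        case False
        then have "a \<le> t"
          using ab(5)[of t] t z zt by simp
        then show ?thesis
          using t zt by (intro image_eqI[of _ _ t]) simp_all
      qed
      then show ?thesis
        unfolding im by blast
    next
      case False
      then have r: "Im z = 0" "1 \<le> Re z" "Re z \<le> 2"
        using zl(1) lol by auto
      have "z = tail (Re z - 1)"
        using r by (simp add: tail_def complex_eq_iff)
      then have "Re z - 1 \<le> b" if "1 < Re z" "Re z < 2"
        using ab(6)[of "Re z - 1"] z that by simp
      moreover have "Re z \<noteq> 2" if "2 \<in> R"
      proof
        assume "Re z = 2"
        then have "z = 2"
          using r by (simp add: complex_eq_iff)
        then show False
          using that zl(2) by simp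
      qed
      ultimately have "Re z \<le> hi"
        using ab(3) r by (cases "Re z = 1"; cases "Re z = 2") (auto simp: hi_def less_le)
      then show ?thesis
        unfolding im using seg r by auto
    qed
  qed
  ultimately show "\<exists>\<gamma>. arc \<gamma> \<and> path_image \<gamma> \<subseteq> lollipop - R \<and> S \<subseteq> path_image \<gamma>"
    by blast
qed

lemma omega_ac_theta: "omega_ac (top_of_set theta_curve)"
proof -
  obtain g h k :: "real \<Rightarrow> complex" where arcs: "arc g" "arc h" "arc k"
    and starts: "pathstart g = -1" "pathstart h = -1" "pathstart k = -1"
    and fins: "pathfinish g = 1" "pathfinish h = 1" "pathfinish k = 1"
    and meets: "path_image g \<inter> path_image h = {-1, 1}" "path_image g \<inter> path_image k = {-1, 1}"
      "path_image h \<inter> path_image k = {-1, 1}"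
    and K: "theta_curve = path_image g \<union> path_image h \<union> path_image k"
    by (rule theta_curve_shape)
  have inner: "\<gamma> s \<in> path_image \<gamma>" "\<gamma> s \<noteq> -1" "\<gamma> s \<noteq> 1"
    if "arc \<gamma>" "pathstart \<gamma> = -1" "pathfinish \<gamma> = 1" "0 < s" "s < 1" for \<gamma> :: "real \<Rightarrow> complex" and s
  proof -
    show "\<gamma> s \<in> path_image \<gamma>"
      using that by (auto simp: path_image_def)
    have "inj_on \<gamma> {0..1}"
      using that by (simp add: arc_def)
    then show "\<gamma> s \<noteq> -1" "\<gamma> s \<noteq> 1"
      using that unfolding pathstart_def pathfinish_def inj_on_def
      by (metis atLeastAtMost_iff less_eq_real_def less_irrefl zero_le_one)+
  qed
  show ?thesis
  \<comment> \<open>All three arcs run from -1 to 1. In the order \<open>g\<close>, \<open>h\<close>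
    backwards, \<open>k\<close> they form a single zigzag, cut off a little at its two ends.\<close>
  proof (rule omega_ac_three[of g k "reversepath h"])
    show "path g" "path k" "arc (reversepath h)"
      using arcs arc_imp_path arc_reversepath by auto
    have inj: "inj_on g {0..1}" "inj_on k {0..1}"
      using arcs by (simp_all add: arc_def)
    show "inj_on g {0<..1}"
      by (rule inj_on_subset[OF inj(1)]) auto
    show "inj_on k {0..<1}"
      by (rule inj_on_subset[OF inj(2)]) auto
    show "g 1 = pathstart (reversepath h)" "pathfinish (reversepath h) = k 0"
      using starts fins by (simp_all add: pathstart_def pathfinish_def reversepath_def)
    show "g 0 \<in> path_image (reversepath h)" "k 1 \<in> path_image (reversepath h)"
      using starts fins pathstart_in_path_image[of h] pathfinish_in_path_image[of h]
      by (simp_all add: pathstart_def pathfinish_def)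
    show "g s \<notin> path_image (reversepath h)" if "0 < s" "s < 1" for s
      unfolding path_image_reversepath using inner[OF arcs(1) starts(1) fins(1) that] meets(1) by blast
    show "k s \<notin> path_image (reversepath h)" if "0 < s" "s < 1" for s
      unfolding path_image_reversepath using inner[OF arcs(3) starts(3) fins(3) that] meets(3) by blast
    show "g s \<noteq> k t" if "0 < s" "s < 1" "0 < t" "t < 1" for s t
      using inner[OF arcs(1) starts(1) fins(1) that(1,2)] inner(1)[OF arcs(3) starts(3) fins(3) that(3,4)] meets(2)
      by (metis IntI empty_iff insert_iff)
    show "theta_curve = g ` {0..1} \<union> path_image (reversepath h) \<union> k ` {0..1}"
      unfolding K by (simp add: path_image_def[of g] path_image_def[of k])
  qed
qed

text \<open>The second circle of the figure of eight is cut into two halves.\<close>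

lemma omega_ac_figure_of_eight: "omega_ac (top_of_set figure_of_eight)"
\<comment> \<open>The right circle is based at the crossing point 0. The middle arc is the upper
  half of the left circle from 0 to -2, and the last curve is the lower half leading back to
  0.\<close>
proof (rule omega_ac_three[of "\<lambda>t. 1 - loop t" "\<lambda>t. loop (1/2 + t/2) - 1" "subpath 0 (1/2) (\<lambda>t. loop t - 1)"])
  have p: "path (\<lambda>t. loop t - 1)"
    unfolding path_def by (intro continuous_intros)
  have "inj_on (\<lambda>t. loop t - 1) {0..1/2}"
    by (auto simp: inj_on_def loop_eq_iff)
  then have sp: "arc (subpath 0 (1/2) (\<lambda>t. loop t - 1))"
    "path_image (subpath 0 (1/2) (\<lambda>t. loop t - 1)) = (\<lambda>t. loop t - 1) ` {0..1/2}"
    using arc_subpath_inj[OF p, of 0 "1/2"] by auto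
  have cross: "s = 0 \<or> s = 1" if "1 - loop s = loop t - 1" "s \<in> {0..1}" "t \<in> {0..1}" for s t
  proof -
    have "1 - loop s \<in> sphere 1 1"
      using that shifted_loop_image(2)[of 1] by blast
    moreover have "loop t - 1 \<in> sphere (-1) 1"
      using that shifted_loop_image(1)[of "-1"] by force
    ultimately have "1 - loop s \<in> sphere (-1) 1 \<inter> sphere 1 1"
      unfolding that(1) by (intro IntI)
    then have "loop s = 1"
      unfolding figure_of_eight_shape by simp
    then show ?thesis
      using loop_eq_1_iff[OF that(2)] by blast
  qed
  show "path (\<lambda>t. 1 - loop t)"
    unfolding path_def by (intro continuous_intros)
  show "path (\<lambda>t. loop (1/2 + t/2) - 1)"
    unfolding path_def loop_def by (intro continuous_intros) auto
  show "arc (subpath 0 (1/2) (\<lambda>t. loop t - 1))"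
    by (rule sp)
  show "inj_on (\<lambda>t. 1 - loop t) {0<..1}" "inj_on (\<lambda>t. loop (1/2 + t/2) - 1) {0..<1}"
    by (auto simp: inj_on_def loop_eq_iff)
  show "1 - loop 1 = pathstart (subpath 0 (1/2) (\<lambda>t. loop t - 1))"
    "pathfinish (subpath 0 (1/2) (\<lambda>t. loop t - 1)) = loop (1/2 + 0/2) - 1"
    by simp_all
  show "1 - loop 0 \<in> path_image (subpath 0 (1/2) (\<lambda>t. loop t - 1))"
    "loop (1/2 + 1/2) - 1 \<in> path_image (subpath 0 (1/2) (\<lambda>t. loop t - 1))"
    unfolding sp by (intro image_eqI[of _ _ 0]; simp)+
  show "1 - loop s \<notin> path_image (subpath 0 (1/2) (\<lambda>t. loop t - 1))" if "0 < s" "s < 1" for s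
  proof
    assume "1 - loop s \<in> path_image (subpath 0 (1/2) (\<lambda>t. loop t - 1))"
    then obtain t where "t \<in> {0..1/2}" "1 - loop s = loop t - 1"
      unfolding sp by blast
    then show False
      using cross[of s t] that by simp
  qed
  show "loop (1/2 + s/2) - 1 \<notin> path_image (subpath 0 (1/2) (\<lambda>t. loop t - 1))" if "0 < s" "s < 1" for s
  proof
    assume "loop (1/2 + s/2) - 1 \<in> path_image (subpath 0 (1/2) (\<lambda>t. loop t - 1))"
    then obtain t where "t \<in> {0..1/2}" "loop (1/2 + s/2) - 1 = loop t - 1"
      unfolding sp by blast
    then show False
      using loop_eq_iff[of "1/2 + s/2" t] that by auto
  qed
  show "1 - loop s \<noteq> loop (1/2 + t/2) - 1" if "0 < s" "s < 1" "0 < t" "t < 1" for s t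
    using cross[of s "1/2 + t/2"] that by auto
  have "{0..1} = {0..1/2} \<union> (\<lambda>t. 1/2 + t/2) ` {0..1::real}"
  proof (intro equalityI subsetI)
    fix t :: real assume "t \<in> {0..1}"
    then show "t \<in> {0..1/2} \<union> (\<lambda>t. 1/2 + t/2) ` {0..1}"
      by (cases "t \<le> 1/2") (auto intro!: image_eqI[of _ _ "2 * t - 1"] simp: field_simps)
  qed auto
  from arg_cong[OF this, of "\<lambda>S. (\<lambda>t. loop t - 1) ` S"]
  have "(\<lambda>t. loop t - 1) ` {0..1} = (\<lambda>t. loop t - 1) ` {0..1/2} \<union> (\<lambda>t. loop (1/2 + t/2) - 1) ` {0..1}"
    unfolding image_Un image_image .
  moreover have "(\<lambda>t. loop t - 1) ` {0..1} = sphere (-1) 1"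
    using shifted_loop_image(1)[of "-1"] by simp
  ultimately have "(\<lambda>t. loop t - 1) ` {0..1/2} \<union> (\<lambda>t. loop (1/2 + t/2) - 1) ` {0..1} = sphere (-1) 1"
    by (simp only:)
  then show "figure_of_eight = (\<lambda>t. 1 - loop t) ` {0..1} \<union> path_image (subpath 0 (1/2) (\<lambda>t. loop t - 1))
      \<union> (\<lambda>t. loop (1/2 + t/2) - 1) ` {0..1}"
    unfolding figure_of_eight_def sp shifted_loop_image(2)[of 1] Un_assoc by (simp only: Un_commute)
qed

lemma omega_ac_dumbbell: "omega_ac (top_of_set dumbbell)"
proof (rule omega_ac_three[of "\<lambda>t. -2 + loop t" "\<lambda>t. 2 - loop t" "linepath (-1) 1"])
  have s: "-2 + loop t \<in> sphere (-2) 1" "2 - loop t \<in> sphere 2 1" for t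
    by (auto simp: dist_norm)
  show "path (\<lambda>t. -2 + loop t)" "path (\<lambda>t. 2 - loop t)"
    unfolding path_def by (intro continuous_intros)+
  show "arc (linepath (-1) (1::complex))"
    by (intro arc_linepath) simp
  show "inj_on (\<lambda>t. -2 + loop t) {0<..1}" "inj_on (\<lambda>t. 2 - loop t) {0..<1}"
    by (auto simp: inj_on_def loop_eq_iff)
  show "-2 + loop s \<notin> path_image (linepath (-1) 1)" if "0 < s" "s < 1" for s
  proof
    assume "-2 + loop s \<in> path_image (linepath (-1) 1)"
    then have "-2 + loop s \<in> sphere (-2) 1 \<inter> closed_segment (-1) 1"
      using s(1) by (intro IntI) (simp_all only: path_image_linepath)
    then have "-2 + loop s = -1"
      unfolding dumbbell_shape(2) by (rule singletonD)
    then have "loop s = 1"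
      by (simp add: algebra_simps)
    then show False
      using loop_eq_1_iff[of s] that by auto
  qed
  show "2 - loop s \<notin> path_image (linepath (-1) 1)" if "0 < s" "s < 1" for s
  proof
    assume "2 - loop s \<in> path_image (linepath (-1) 1)"
    then have "2 - loop s \<in> sphere 2 1 \<inter> closed_segment (-1) 1"
      using s(2) by (intro IntI) (simp_all only: path_image_linepath)
    then have "2 - loop s = 1"
      unfolding dumbbell_shape(3) by (rule singletonD)
    then have "loop s = 1"
      by (simp add: algebra_simps)
    then show False
      using loop_eq_1_iff[of s] that by auto
  qed
  show "-2 + loop s \<noteq> 2 - loop t" for s t
    using dumbbell_shape(1) s(1)[of s] s(2)[of t] by (metis IntI empty_iff)
  show "dumbbell = (\<lambda>t. -2 + loop t) ` {0..1} \<union> path_image (linepath (-1) 1) \<union> (\<lambda>t. 2 - loop t) ` {0..1}"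
    unfolding dumbbell_def shifted_loop_image by auto
qed auto

section \<open>Identifying thread patterns with the plane graphs\<close>

context connected_threads begin

text \<open>The gluing criterion for one representative of each thread. Coincidences with a reversed
  thread then drop out, and it remains to see that each curve is injective up to its ends and that
  different curves meet at ends only. The relation \<open>P\<close> fixes an order for each pair of
  threads, so that each pair is checked once.\<close>

lemma homeomorphic_plane:
  fixes \<kappa> :: "'v \<times> 'v \<Rightarrow> real \<Rightarrow> 'a::t2_space"
  assumes J: "covering J" "finite J" and reps: "\<And>d. d \<in> J \<Longrightarrow> fin d \<Longrightarrow> rv d \<notin> J"
    and cont: "\<And>d. d \<in> J \<Longrightarrow> continuous_on {0..1} (\<kappa> d)"
    and K: "K = (\<Union>d\<in>J. \<kappa> d ` tdom d)"
    and missing: "\<And>d. d \<in> J \<Longrightarrow> \<not> fin d \<Longrightarrow> \<kappa> d 1 \<notin> K"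
    and self: "\<And>d s t. d \<in> J \<Longrightarrow> s \<in> tdom d \<Longrightarrow> t \<in> tdom d \<Longrightarrow>
      \<kappa> d s = \<kappa> d t \<longleftrightarrow> s = t \<or> s \<in> {0, 1} \<and> t \<in> {0, 1} \<and> ev d s = ev d t"
    and P: "\<And>d d'. d \<in> J \<Longrightarrow> d' \<in> J \<Longrightarrow> d \<noteq> d' \<Longrightarrow> (d, d') \<in> P \<or> (d', d) \<in> P"
    and cross: "\<And>d d' s t. (d, d') \<in> P \<Longrightarrow> s \<in> tdom d \<Longrightarrow> t \<in> tdom d' \<Longrightarrow>
      \<kappa> d s = \<kappa> d' t \<longleftrightarrow> s \<in> {0, 1} \<and> t \<in> {0, 1} \<and> ev d s = ev d' t"
  shows "X homeomorphic_space top_of_set K"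
proof (rule homeomorphic_glued_curves[OF J cont K missing])
  fix d d' s t assume d: "d \<in> J" "d' \<in> J" and st: "s \<in> tdom d" "t \<in> tdom d'"
  have D: "d \<in> D" "d' \<in> D"
    using J(1) d by (auto simp: covering_def)
  have "\<not> (fin d \<and> d' = rv d)"
    using reps d by blast
  then have *: "curve d s = curve d' t \<longleftrightarrow> d' = d \<and> t = s \<or> s \<in> {0, 1} \<and> t \<in> {0, 1} \<and> ev d s = ev d' t"
    using curve_eq_iff[OF D st] by blast
  consider "d' = d" | "d' \<noteq> d" "(d, d') \<in> P" | "d' \<noteq> d" "(d', d) \<in> P"
    using P[OF d] by blast
  then show "\<kappa> d s = \<kappa> d' t \<longleftrightarrow> curve d s = curve d' t"
  proof cases
    case 1
    show ?thesis
      unfolding * using self[OF d(1) st(1), of t] st(2) 1 by auto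
  next
    case 2
    then show ?thesis
      unfolding * using cross[OF 2(2) st] by simp
  next
    case 3
    then show ?thesis
      unfolding * using cross[OF 3(2) st(2,1)] by (simp add: eq_commute[of "\<kappa> d s"] conj_commute conj_left_commute eq_commute[of "ev d' t"])
  qed
qed

lemma ev_0: "ev d 0 = fst d" and ev_1: "ev d 1 = fst (rv d)"
  by (simp_all add: ev_def)

lemma mem_unit_segment: "z \<in> arc_graph \<longleftrightarrow> Im z = 0 \<and> 0 \<le> Re z \<and> Re z \<le> 1"
  using mem_real_segment[of 0 1 z] by (simp add: arc_graph_def)

lemma homeomorphic_arc:
  assumes "covering {d}" "fin d" "fst d \<noteq> fst (rv d)"
  shows "X homeomorphic_space top_of_set arc_graph"
proof (rule homeomorphic_plane[where J = "{d}" and P = "{}" and \<kappa> = "\<lambda>_. of_real"])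
  have "d \<in> D"
    using assms(1) by (simp add: covering_def)
  show "rv x \<notin> {d}" if "x \<in> {d}" "fin x" for x
    using that rv(6)[OF \<open>d \<in> D\<close>] by simp
  show "arc_graph = (\<Union>x\<in>{d}. complex_of_real ` tdom x)"
  proof (intro equalityI subsetI)
    fix z assume "z \<in> arc_graph"
    then show "z \<in> (\<Union>x\<in>{d}. complex_of_real ` tdom x)"
      using assms(2) by (auto simp: mem_unit_segment tdom_def complex_eq_iff intro!: image_eqI[of _ _ "Re z"])
  qed (use assms(2) in \<open>auto simp: mem_unit_segment tdom_def\<close>)
  show "complex_of_real s = of_real t \<longleftrightarrow> s = t \<or> s \<in> {0, 1} \<and> t \<in> {0, 1} \<and> ev x s = ev x t" if "x \<in> {d}" for x s t
    using that assms(3) by (auto simp: ev_0 ev_1)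
qed (use assms in \<open>auto intro!: continuous_intros\<close>)

lemma homeomorphic_half_open:
  assumes "covering {d}" "\<not> fin d"
  shows "X homeomorphic_space top_of_set (arc_graph - {1})"
proof (rule homeomorphic_plane[where J = "{d}" and P = "{}" and \<kappa> = "\<lambda>_. of_real"])
  show "arc_graph - {1} = (\<Union>x\<in>{d}. complex_of_real ` tdom x)"
  proof (intro equalityI subsetI)
    fix z assume z: "z \<in> arc_graph - {1}"
    then have "Re z \<noteq> 1"
      by (auto simp: mem_unit_segment complex_eq_iff)
    then show "z \<in> (\<Union>x\<in>{d}. complex_of_real ` tdom x)"
      using assms(2) z by (auto simp: mem_unit_segment tdom_def complex_eq_iff intro!: image_eqI[of _ _ "Re z"])
  qed (use assms(2) in \<open>auto simp: mem_unit_segment tdom_def\<close>)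
  show "complex_of_real s = of_real t \<longleftrightarrow> s = t \<or> s \<in> {0, 1} \<and> t \<in> {0, 1} \<and> ev x s = ev x t"
    if "x \<in> {d}" "s \<in> tdom x" "t \<in> tdom x" for x s t
    using that assms(2) by auto
qed (use assms in \<open>auto intro!: continuous_intros\<close>)

text \<open>The common vertex is placed at 1/2 and the two rays leave it in opposite
  directions.\<close>

lemma homeomorphic_open:
  assumes cov: "covering {d, d'}" and d: "d \<noteq> d'" "\<not> fin d" "\<not> fin d'" "fst d = fst d'"
  shows "X homeomorphic_space top_of_set (arc_graph - {0, 1})"
proof (rule homeomorphic_plane[where J = "{d, d'}" and P = "{(d, d')}"
      and \<kappa> = "\<lambda>x t. complex_of_real (if x = d then 1/2 + t/2 else 1/2 - t/2)"])
  have t: "tdom d = {0..<1}" "tdom d' = {0..<1}"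
    using d by (auto simp: tdom_def)
  show "continuous_on {0..1} (\<lambda>t. complex_of_real (if x = d then 1/2 + t/2 else 1/2 - t/2))" for x
    by (cases "x = d") (auto intro!: continuous_intros)
  show K: "arc_graph - {0, 1} = (\<Union>x\<in>{d, d'}. (\<lambda>t. complex_of_real (if x = d then 1/2 + t/2 else 1/2 - t/2)) ` tdom x)"
    (is "_ = ?R")
  proof (intro equalityI subsetI)
    fix z assume z: "z \<in> arc_graph - {0, 1}"
    then have r: "Im z = 0" "0 < Re z" "Re z < 1"
      by (auto simp: mem_unit_segment complex_eq_iff less_le)
    show "z \<in> ?R"
    proof (cases "Re z < 1/2")
      case True
      then have "z = complex_of_real (if d' = d then 1/2 + (1 - 2 * Re z)/2 else 1/2 - (1 - 2 * Re z)/2)"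
        using r d by (simp add: complex_eq_iff field_simps)
      moreover have "1 - 2 * Re z \<in> tdom d'"
        using r t True by simp
      ultimately show ?thesis
        by blast
    next
      case False
      then have "z = complex_of_real (if d = d then 1/2 + (2 * Re z - 1)/2 else 1/2 - (2 * Re z - 1)/2)"
        using r by (simp add: complex_eq_iff field_simps)
      moreover have "2 * Re z - 1 \<in> tdom d"
        using r t False by simp
      ultimately show ?thesis
        by blast
    qed
  next
    fix z assume "z \<in> ?R"
    then show "z \<in> arc_graph - {0, 1}"
      using t d by (auto simp: mem_unit_segment complex_eq_iff)
  qed
  show "complex_of_real (if x = d then 1/2 + 1/2 else 1/2 - 1/2) \<notin> arc_graph - {0, 1}" for x
    by simp
  show "complex_of_real (if x = d then 1/2 + s/2 else 1/2 - s/2) = of_real (if x = d then 1/2 + t/2 else 1/2 - t/2) \<longleftrightarrow>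
      s = t \<or> s \<in> {0, 1} \<and> t \<in> {0, 1} \<and> ev x s = ev x t"
    if "x \<in> {d, d'}" "s \<in> tdom x" "t \<in> tdom x" for x s t
    using that t by auto
  show "complex_of_real (if x = d then 1/2 + s/2 else 1/2 - s/2) = of_real (if y = d then 1/2 + u/2 else 1/2 - u/2) \<longleftrightarrow>
      s \<in> {0, 1} \<and> u \<in> {0, 1} \<and> ev x s = ev y u"
    if "(x, y) \<in> {(d, d')}" "s \<in> tdom x" "u \<in> tdom y" for x y s u
  proof -
    have "x = d" "y = d'"
      using that by auto
    then show ?thesis
      using that(2,3) t d by (auto simp: ev_0 simp del: of_real_add of_real_diff)
  qed
qed (use assms in auto)

lemma homeomorphic_circle:
  assumes "covering {d}" "fin d" "fst d = fst (rv d)"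
  shows "X homeomorphic_space top_of_set circle_graph"
proof (rule homeomorphic_plane[where J = "{d}" and P = "{}" and \<kappa> = "\<lambda>_. loop"])
  have "d \<in> D"
    using assms(1) by (simp add: covering_def)
  have t: "tdom d = {0..1}"
    using assms by (simp add: tdom_def)
  show "rv x \<notin> {d}" if "x \<in> {d}" "fin x" for x
    using that rv(6)[OF \<open>d \<in> D\<close>] by simp
  show "circle_graph = (\<Union>x\<in>{d}. loop ` tdom x)"
    using t loop_image(1) by (simp add: circle_graph_def)
  show "loop s = loop u \<longleftrightarrow> s = u \<or> s \<in> {0, 1} \<and> u \<in> {0, 1} \<and> ev x s = ev x u"
    if "x \<in> {d}" "s \<in> tdom x" "u \<in> tdom x" for x s u
  proof -
    have "ev x s = ev x u" if "s \<in> {0, 1}" "u \<in> {0, 1}"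
      using that \<open>x \<in> {d}\<close> assms(3) by (auto simp: ev_0 ev_1)
    then show ?thesis
      using loop_eq_iff[of s u] that t by auto
  qed
qed (use assms in \<open>auto intro!: continuous_intros\<close>)

text \<open>The thread \<open>a\<close> becomes the circle and \<open>d\<close> the stick; an
  infinite \<open>d\<close> leaves out exactly the endpoint 2.\<close>

lemma homeomorphic_lollipop:
  assumes cov: "covering {a, d}" and a: "fin a" "fst a = v" "fst (rv a) = v" and d: "fst d = v" "fin d \<Longrightarrow> fst (rv d) \<noteq> v"
    and ad: "a \<noteq> d" "rv a \<noteq> d"
  shows "X homeomorphic_space top_of_set (lollipop - (if fin d then {} else {2}))"
proof (rule homeomorphic_plane[where J = "{a, d}" and P = "{(a, d)}"
      and \<kappa> = "\<lambda>x t. if x = a then loop t else complex_of_real (1 + t)"])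
  let ?K = "lollipop - (if fin d then {} else {2})"
  have D: "a \<in> D" "d \<in> D"
    using cov by (auto simp: covering_def)
  have t: "tdom a = {0..1}"
    using a by (simp add: tdom_def)
  have td: "0 \<le> u" "u \<le> 1" "u = 1 \<Longrightarrow> fin d" if "u \<in> tdom d" for u
    using that by (auto simp: tdom_def split: if_splits)
  have lol: "z \<in> lollipop \<longleftrightarrow> norm z = 1 \<or> Im z = 0 \<and> 1 \<le> Re z \<and> Re z \<le> 2" for z
    using mem_real_segment[of 1 2 z] by (auto simp: lollipop_def)
  show "rv x \<notin> {a, d}" if "x \<in> {a, d}" "fin x" for x
    using that rv(6)[OF D(1)] rv(6)[OF D(2)] ad d a by auto
  show "continuous_on {0..1} (\<lambda>t. if x = a then loop t else complex_of_real (1 + t))" for x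
    by (cases "x = a") (auto intro!: continuous_intros)
  have K: "?K = loop ` tdom a \<union> (\<lambda>t. complex_of_real (1 + t)) ` tdom d"
  proof (intro equalityI subsetI)
    fix z assume z: "z \<in> ?K"
    show "z \<in> loop ` tdom a \<union> (\<lambda>t. complex_of_real (1 + t)) ` tdom d"
    proof (cases "norm z = 1")
      case True
      then show ?thesis
        unfolding t loop_image by simp
    next
      case False
      then have r: "Im z = 0" "1 \<le> Re z" "Re z \<le> 2"
        using z lol by auto
      have "Re z \<noteq> 2" if "\<not> fin d"
      proof
        assume "Re z = 2"
        then have "z = 2"
          using r by (simp add: complex_eq_iff)
        then show False
          using that z by simp
      qed
      then have "Re z - 1 \<in> tdom d"
        using r by (auto simp: tdom_def)
      moreover have "z = complex_of_real (1 + (Re z - 1))"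
        using r by (simp add: complex_eq_iff)
      ultimately show ?thesis
        by blast
    qed
  next
    fix z assume "z \<in> loop ` tdom a \<union> (\<lambda>t. complex_of_real (1 + t)) ` tdom d"
    then consider u where "z = loop u" | u where "u \<in> tdom d" "z = complex_of_real (1 + u)"
      by blast
    then show "z \<in> ?K"
    proof cases
      case 1
      then have "norm z = 1"
        by simp
      then show ?thesis
        using lol by auto
    next
      case (2 u)
      have "z \<noteq> 2" if "\<not> fin d"
        using td[OF 2(1)] that 2(2) by (auto simp: complex_eq_iff)
      then show ?thesis
        using td[OF 2(1)] 2(2) lol by auto
    qed
  qed
  then show "?K = (\<Union>x\<in>{a, d}. (\<lambda>t. if x = a then loop t else complex_of_real (1 + t)) ` tdom x)"
    using ad by auto
  show "(if x = a then loop 1 else complex_of_real (1 + 1)) \<notin> ?K" if "x \<in> {a, d}" "\<not> fin x" for x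
    using that a by auto
  show "(if x = a then loop s else complex_of_real (1 + s)) = (if x = a then loop u else complex_of_real (1 + u)) \<longleftrightarrow>
      s = u \<or> s \<in> {0, 1} \<and> u \<in> {0, 1} \<and> ev x s = ev x u"
    if x: "x \<in> {a, d}" "s \<in> tdom x" "u \<in> tdom x" for x s u
  proof (cases "x = a")
    case True
    have "ev a s = ev a u" if "s \<in> {0, 1}" "u \<in> {0, 1}"
      using that a by (auto simp: ev_0 ev_1)
    then show ?thesis
      using True x t loop_eq_iff[of s u] by auto
  next
    case False
    then have "s \<in> tdom d" "u \<in> tdom d" "x = d"
      using x by auto
    then show ?thesis
      using td[of s] td[of u] False d by (auto simp: ev_0 ev_1)
  qed
  show "(if x = a then loop s else complex_of_real (1 + s)) = (if y = a then loop u else complex_of_real (1 + u)) \<longleftrightarrow>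
      s \<in> {0, 1} \<and> u \<in> {0, 1} \<and> ev x s = ev y u"
    if xy: "(x, y) \<in> {(a, d)}" "s \<in> tdom x" "u \<in> tdom y" for x y s u
  proof -
    have e: "x = a" "y = d"
      using xy by auto
    have s: "s \<in> {0..1}" and u: "u \<in> tdom d"
      using xy e t by auto
    have "loop s = complex_of_real (1 + u) \<longleftrightarrow> s \<in> {0, 1} \<and> u = 0"
    proof
      assume eq: "loop s = complex_of_real (1 + u)"
      then have "norm (complex_of_real (1 + u)) = 1"
        by (metis norm_loop)
      then have "u = 0"
        using td(1)[OF u] by (simp only: norm_of_real)
      then show "s \<in> {0, 1} \<and> u = 0"
        using eq loop_eq_1_iff[OF s] by simp
    next
      assume "s \<in> {0, 1} \<and> u = 0"
      then show "loop s = complex_of_real (1 + u)"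
        by auto
    qed
    moreover have "s \<in> {0, 1} \<and> u = 0 \<longleftrightarrow> s \<in> {0, 1} \<and> u \<in> {0, 1} \<and> ev a s = ev d u"
      using td(3)[OF u] a d by (auto simp: ev_0 ev_1)
    ultimately show ?thesis
      using e ad by simp
  qed
qed (use cov ad in auto)

lemma homeomorphic_figure_of_eight:
  assumes cov: "covering {a, b}" and f: "fin a" "fin b" and v: "fst a = v" "fst (rv a) = v" "fst b = v" "fst (rv b) = v"
    and ab: "a \<noteq> b" "rv a \<noteq> b"
  shows "X homeomorphic_space top_of_set figure_of_eight"
proof (rule homeomorphic_plane[where J = "{a, b}" and P = "{(a, b)}"
      and \<kappa> = "\<lambda>x t. if x = a then 1 - loop t else -1 + loop t"])
  have D: "a \<in> D" "b \<in> D"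
    using cov by (auto simp: covering_def)
  have t: "tdom a = {0..1}" "tdom b = {0..1}"
    using f by (simp_all add: tdom_def)
  have evv: "ev x s = v" if "x \<in> {a, b}" for x s
    using that v by (auto simp: ev_def)
  show "rv x \<notin> {a, b}" if "x \<in> {a, b}" "fin x" for x
    using that rv(6)[OF D(1)] rv(6)[OF D(2)] rv(5)[OF D(2) f(2)] ab by auto
  show "continuous_on {0..1} (\<lambda>t. if x = a then 1 - loop t else -1 + loop t)" for x
    by (cases "x = a") (auto intro!: continuous_intros)
  show "figure_of_eight = (\<Union>x\<in>{a, b}. (\<lambda>t. if x = a then 1 - loop t else -1 + loop t) ` tdom x)"
    using ab t shifted_loop_image(2)[of 1] shifted_loop_image(1)[of "-1"] by (auto simp: figure_of_eight_def simp del: mem_sphere)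
  show "((if x = a then 1 - loop s else -1 + loop s) = (if x = a then 1 - loop u else -1 + loop u)) \<longleftrightarrow>
      s = u \<or> s \<in> {0, 1} \<and> u \<in> {0, 1} \<and> ev x s = ev x u"
    if "x \<in> {a, b}" "s \<in> tdom x" "u \<in> tdom x" for x s u
    using that t loop_eq_iff[of s u] evv[OF that(1)] by auto
  show "((if x = a then 1 - loop s else -1 + loop s) = (if y = a then 1 - loop u else -1 + loop u)) \<longleftrightarrow>
      s \<in> {0, 1} \<and> u \<in> {0, 1} \<and> ev x s = ev y u"
    if xy: "(x, y) \<in> {(a, b)}" "s \<in> tdom x" "u \<in> tdom y" for x y s u
  proof -
    have e: "x = a" "y = b" and su: "s \<in> {0..1}" "u \<in> {0..1}"
      using xy t by auto
    have "1 - loop s = -1 + loop u \<longleftrightarrow> s \<in> {0, 1} \<and> u \<in> {0, 1}"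
    proof
      assume eq: "1 - loop s = -1 + loop u"
      have "1 - loop s \<in> sphere 1 1"
        using su(1) shifted_loop_image(2)[of 1] by blast
      moreover have "-1 + loop u \<in> sphere (-1) 1"
        using su(2) shifted_loop_image(1)[of "-1"] by blast
      ultimately have "1 - loop s \<in> sphere (-1) 1 \<inter> sphere 1 1"
        unfolding eq by (intro IntI)
      then have "loop s = 1"
        unfolding figure_of_eight_shape by simp
      moreover from this have "loop u = 1"
        using eq by (simp add: eq_diff_eq)
      ultimately show "s \<in> {0, 1} \<and> u \<in> {0, 1}"
        using loop_eq_1_iff su by blast
    qed auto
    then show ?thesis
      using e ab evv by simp
  qed
qed (use cov ab f in auto)

text \<open>The loops at \<open>v\<close> and \<open>w\<close> are based at -1 and 1, the points of
  their circles that face each other, and \<open>c\<close> becomes the segment between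
  these.\<close>

lemma homeomorphic_dumbbell:
  assumes cov: "covering {a, b, c}" and f: "fin a" "fin b" "fin c"
    and v: "fst a = v" "fst (rv a) = v" "fst b = w" "fst (rv b) = w" "fst c = v" "fst (rv c) = w" "v \<noteq> w"
    and ac: "a \<noteq> c"
  shows "X homeomorphic_space top_of_set dumbbell"
proof (rule homeomorphic_plane[where J = "{a, b, c}" and P = "{(a, b), (a, c), (b, c)}"
      and \<kappa> = "\<lambda>x t. if x = a then -2 + loop t else if x = b then 2 - loop t else of_real (2 * t - 1)"])
  let ?k = "\<lambda>x t. if x = a then -2 + loop t else if x = b then 2 - loop t else of_real (2 * t - 1)"
  have D: "a \<in> D" "b \<in> D" "c \<in> D"
    using cov by (auto simp: covering_def)
  have neq: "a \<noteq> b" "b \<noteq> c" "b \<noteq> a" "c \<noteq> b" "c \<noteq> a"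
    using v ac by auto
  have t: "tdom a = {0..1}" "tdom b = {0..1}" "tdom c = {0..1}"
    using f by (simp_all add: tdom_def)
  have eva: "ev a s = v" and evb: "ev b s = w" for s
    using v by (auto simp: ev_def)
  have "rv a \<noteq> c" "rv c \<noteq> a" "rv b \<noteq> c" "rv c \<noteq> b" "rv a \<noteq> b" "rv b \<noteq> a"
    using v rv(5)[OF D(1) f(1)] rv(5)[OF D(2) f(2)] rv(5)[OF D(3) f(3)] by auto
  then show "rv x \<notin> {a, b, c}" if "x \<in> {a, b, c}" "fin x" for x
    using that rv(6)[OF D(1) f(1)] rv(6)[OF D(2) f(2)] rv(6)[OF D(3) f(3)] by auto
  show "continuous_on {0..1} (?k x)" for x
    by (cases "x = a"; cases "x = b") (auto intro!: continuous_intros)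
  have seg: "(\<lambda>t. complex_of_real (2 * t - 1)) ` {0..1} = closed_segment (-1) 1"
  proof (intro equalityI subsetI)
    fix z assume "z \<in> (\<lambda>t. complex_of_real (2 * t - 1)) ` {0..1}"
    then obtain t where "t \<in> {0..1}" "z = complex_of_real (2 * t - 1)"
      by blast
    then show "z \<in> closed_segment (-1) 1"
      using mem_real_segment[of "-1" 1 z] by simp
  next
    fix z :: complex assume "z \<in> closed_segment (-1) 1"
    then have "Im z = 0" "-1 \<le> Re z" "Re z \<le> 1"
      using mem_real_segment[of "-1" 1 z] by simp_all
    then show "z \<in> (\<lambda>t. complex_of_real (2 * t - 1)) ` {0..1}"
      by (intro image_eqI[of _ _ "(Re z + 1) / 2"]) (auto simp: complex_eq_iff field_simps)
  qed
  have "(\<Union>x\<in>{a, b, c}. ?k x ` tdom x) = (\<lambda>t. -2 + loop t) ` {0..1} \<union> (\<lambda>t. 2 - loop t) ` {0..1}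
      \<union> (\<lambda>t. complex_of_real (2 * t - 1)) ` {0..1}"
    using neq t by (simp add: Un_assoc)
  then show "dumbbell = (\<Union>x\<in>{a, b, c}. ?k x ` tdom x)"
    unfolding shifted_loop_image seg dumbbell_def by simp
  show "?k x s = ?k x u \<longleftrightarrow> s = u \<or> s \<in> {0, 1} \<and> u \<in> {0, 1} \<and> ev x s = ev x u"
    if x: "x \<in> {a, b, c}" "s \<in> tdom x" "u \<in> tdom x" for x s u
  proof (cases "x = c")
    case True
    then show ?thesis
      using neq ac v(5-7) by (auto simp: ev_0 ev_1)
  next
    case False
    then have "ev x s = ev x u" "s \<in> {0..1}" "u \<in> {0..1}"
      using x eva evb t by auto
    then show ?thesis
      using loop_eq_iff[of s u] False x(1) by auto
  qed
  have on: "-2 + loop s \<in> sphere (-2) 1" "2 - loop s \<in> sphere 2 1" for s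
    by (auto simp: dist_norm)
  have k1: "?k a s \<noteq> ?k b u" for s u
    using on[of s] on[of u] dumbbell_shape(1) neq by auto
  have k2: "?k a s = ?k c u \<longleftrightarrow> s \<in> {0, 1} \<and> u = 0" if "s \<in> {0..1}" "u \<in> {0..1}" for s u
  proof
    assume "?k a s = ?k c u"
    then have eq: "-2 + loop s = complex_of_real (2 * u - 1)"
      using neq ac by simp
    moreover have "complex_of_real (2 * u - 1) \<in> closed_segment (-1) 1"
      unfolding seg[symmetric] using that(2) by blast
    ultimately have "-2 + loop s \<in> sphere (-2) 1 \<inter> closed_segment (-1) 1"
      using on(1)[of s] by (intro IntI) (simp_all only:)
    then have e: "-2 + loop s = -1"
      unfolding dumbbell_shape by (rule singletonD)
    then have "loop s = 1"
      by (simp add: algebra_simps)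
    moreover have "complex_of_real (2 * u - 1) = of_real (-1)"
      using e eq by simp
    then have "u = 0"
      unfolding of_real_eq_iff by simp
    ultimately show "s \<in> {0, 1} \<and> u = 0"
      using loop_eq_1_iff[OF that(1)] by simp
  qed (use neq in auto)
  have k3: "?k b s = ?k c u \<longleftrightarrow> s \<in> {0, 1} \<and> u = 1" if "s \<in> {0..1}" "u \<in> {0..1}" for s u
  proof
    assume "?k b s = ?k c u"
    then have eq: "2 - loop s = complex_of_real (2 * u - 1)"
      using neq ac by simp
    moreover have "complex_of_real (2 * u - 1) \<in> closed_segment (-1) 1"
      unfolding seg[symmetric] using that(2) by blast
    ultimately have "2 - loop s \<in> sphere 2 1 \<inter> closed_segment (-1) 1"
      using on(2)[of s] by (intro IntI) (simp_all only:)
    then have e: "2 - loop s = 1"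
      unfolding dumbbell_shape by (rule singletonD)
    then have "loop s = 1"
      by (simp add: algebra_simps)
    moreover have "complex_of_real (2 * u - 1) = of_real 1"
      using e eq by simp
    then have "u = 1"
      unfolding of_real_eq_iff by simp
    ultimately show "s \<in> {0, 1} \<and> u = 1"
      using loop_eq_1_iff[OF that(1)] by simp
  qed (use neq in auto)
  show "?k x s = ?k y u \<longleftrightarrow> s \<in> {0, 1} \<and> u \<in> {0, 1} \<and> ev x s = ev y u"
    if xy: "(x, y) \<in> {(a, b), (a, c), (b, c)}" "s \<in> tdom x" "u \<in> tdom y" for x y s u
  proof -
    have su: "s \<in> {0..1}" "u \<in> {0..1}"
      using xy t by auto
    consider "x = a" "y = b" | "x = a" "y = c" | "x = b" "y = c"
      using xy(1) by auto
    then show ?thesis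
    proof cases
      case 1
      then show ?thesis
        using k1[of s u] eva evb v(7) by (simp only: simp_thms)
    next
      case c: 2
      have "u \<in> {0, 1} \<and> ev a s = ev c u \<longleftrightarrow> u = 0"
        using eva v by (auto simp: ev_0 ev_1)
      then show ?thesis
        using k2[OF su] c by (simp only:)
    next
      case c: 3
      have "u \<in> {0, 1} \<and> ev b s = ev c u \<longleftrightarrow> u = 1"
        using evb v by (auto simp: ev_0 ev_1)
      then show ?thesis
        using k3[OF su] c by (simp only:)
    qed
  qed
qed (use cov f in auto)

lemma homeomorphic_theta:
  assumes cov: "covering {a, b, c}" and f: "fin a" "fin b" "fin c"
    and v: "fst a = v" "fst (rv a) = w" "fst b = v" "fst (rv b) = w" "fst c = v" "fst (rv c) = w" "v \<noteq> w"
    and neq: "a \<noteq> b" "a \<noteq> c" "b \<noteq> c"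
  shows "X homeomorphic_space top_of_set theta_curve"
proof -
  obtain g h k :: "real \<Rightarrow> complex" where arcs: "arc g" "arc h" "arc k"
    and starts: "pathstart g = -1" "pathstart h = -1" "pathstart k = -1"
    and fins: "pathfinish g = 1" "pathfinish h = 1" "pathfinish k = 1"
    and meets: "path_image g \<inter> path_image h = {-1, 1}" "path_image g \<inter> path_image k = {-1, 1}"
      "path_image h \<inter> path_image k = {-1, 1}"
    and K: "theta_curve = path_image g \<union> path_image h \<union> path_image k"
    by (rule theta_curve_shape)
  have D: "a \<in> D" "b \<in> D" "c \<in> D"
    using cov by (auto simp: covering_def)
  have t: "tdom x = {0..1}" if "x \<in> {a, b, c}" for x
    using that f by (auto simp: tdom_def)
  have evx: "ev x 0 = v" "ev x 1 = w" if "x \<in> {a, b, c}" for x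
    using that v by (auto simp: ev_0 ev_1)
  define \<kappa> where "\<kappa> x = (if x = a then g else if x = b then h else k)" for x
  have \<kappa>: "\<kappa> a = g" "\<kappa> b = h" "\<kappa> c = k"
    using neq by (auto simp: \<kappa>_def)
  have arc\<kappa>: "arc (\<kappa> x)" "\<kappa> x 0 = -1" "\<kappa> x 1 = 1" for x
    using arcs starts fins by (auto simp: \<kappa>_def pathstart_def pathfinish_def)
  have inj\<kappa>: "\<kappa> x s = \<kappa> x u \<longleftrightarrow> s = u" if "s \<in> {0..1}" "u \<in> {0..1}" for x s u
    using arc\<kappa>(1)[of x] that unfolding arc_def inj_on_def by blast
  have cross: "\<kappa> x s = \<kappa> y u \<longleftrightarrow> s \<in> {0, 1} \<and> u = s"
    if "path_image (\<kappa> x) \<inter> path_image (\<kappa> y) = {-1, 1}" "s \<in> {0..1}" "u \<in> {0..1}" for x y s u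
  proof
    assume eq: "\<kappa> x s = \<kappa> y u"
    have "\<kappa> x s \<in> path_image (\<kappa> x)" "\<kappa> y u \<in> path_image (\<kappa> y)"
      unfolding path_image_def using that by blast+
    then have "\<kappa> x s \<in> {-1, 1}"
      unfolding that(1)[symmetric] using eq by simp
    then consider "\<kappa> x s = \<kappa> x 0" "\<kappa> y u = \<kappa> y 0" | "\<kappa> x s = \<kappa> x 1" "\<kappa> y u = \<kappa> y 1"
      using eq arc\<kappa>(2,3) by auto
    then show "s \<in> {0, 1} \<and> u = s"
    proof cases
      case 1
      then show ?thesis
        using inj\<kappa>[of s 0 x] inj\<kappa>[of u 0 y] that by simp
    next
      case 2
      then show ?thesis
        using inj\<kappa>[of s 1 x] inj\<kappa>[of u 1 y] that by simp
    qed
  qed (use arc\<kappa>(2,3)[of x] arc\<kappa>(2,3)[of y] in auto)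
  show ?thesis
  proof (rule homeomorphic_plane[where J = "{a, b, c}" and P = "{(a, b), (a, c), (b, c)}" and \<kappa> = \<kappa>])
    have "fst (rv x) \<noteq> fst y" if "x \<in> {a, b, c}" "y \<in> {a, b, c}" for x y
      using that v by auto
    then show "rv x \<notin> {a, b, c}" if "x \<in> {a, b, c}" "fin x" for x
      using that by metis
    show "continuous_on {0..1} (\<kappa> x)" for x
      using arc\<kappa>(1)[of x] by (simp add: arc_def path_def)
    show "theta_curve = (\<Union>x\<in>{a, b, c}. \<kappa> x ` tdom x)"
      unfolding K path_image_def using t \<kappa> by (simp add: Un_assoc)
    show "\<kappa> x s = \<kappa> x u \<longleftrightarrow> s = u \<or> s \<in> {0, 1} \<and> u \<in> {0, 1} \<and> ev x s = ev x u"
      if "x \<in> {a, b, c}" "s \<in> tdom x" "u \<in> tdom x" for x s u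
      using inj\<kappa>[of s u x] that(2,3) evx[OF that(1)] v(7) unfolding t[OF that(1)] by auto
    show "\<kappa> x s = \<kappa> y u \<longleftrightarrow> s \<in> {0, 1} \<and> u \<in> {0, 1} \<and> ev x s = ev y u"
      if xy: "(x, y) \<in> {(a, b), (a, c), (b, c)}" "s \<in> tdom x" "u \<in> tdom y" for x y s u
    proof -
      have J: "x \<in> {a, b, c}" "y \<in> {a, b, c}"
        using xy by auto
      have "path_image (\<kappa> x) \<inter> path_image (\<kappa> y) = {-1, 1}"
        using xy(1) meets \<kappa> by auto
      from cross[OF this, of s u] show ?thesis
        using xy(2,3) evx[OF J(1)] evx[OF J(2)] v(7) unfolding t[OF J(1)] t[OF J(2)] by auto
    qed
  qed (use cov f in auto)
qed

end

section \<open>Classification\<close>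

context graph_complex begin

text \<open>For a proper part \<open>Z\<close> the indicator function, constant along every edge,
  would be continuous with no values other than 0 and 1. An arc through a vertex of \<open>Z\<close>
  and a vertex outside would then have a disconnected image.\<close>

lemma connected_if_n_ac:
  assumes ac: "n_ac n X" and "2 \<le> n" and Z: "Z \<subseteq> V" "Z \<noteq> {}"
    and closed: "\<And>x y. x \<in> Z \<Longrightarrow> {x, y} \<in> E \<Longrightarrow> y \<in> Z"
  shows "Z = V"
proof (rule ccontr)
  assume "Z \<noteq> V"
  then obtain z v where zv: "z \<in> Z" "v \<in> V" "v \<notin> Z"
    using Z by blast
  define f :: "('v + 'v set) \<times> real \<Rightarrow> real" where
    "f x = (case fst x of Inl u \<Rightarrow> of_bool (u \<in> Z) | Inr e \<Rightarrow> of_bool (edge_start e \<in> Z))" for x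
  have "f (glue (Inr e, t)) = of_bool (edge_start e \<in> Z)" if e: "e \<in> E" for e t
  proof -
    obtain a b where ab: "e = {a, b}" "edge_start e = a" "edge_end e = b"
      using edge_ends(1)[OF graph e] by blast
    have "{a, b} \<in> E" "{b, a} \<in> E"
      using ab(1) e by (simp_all add: insert_commute)
    then have "a \<in> Z \<longleftrightarrow> b \<in> Z"
      using closed by metis
    then show ?thesis
      using ab(2,3) by (auto simp: f_def glue.simps(2))
  qed
  then have "continuous_map X euclideanreal f"
    by (intro continuous_map_from_X) auto
  moreover define S :: "(('v + 'v set) \<times> real) set" where "S = {(Inl z, 0), (Inl v, 0)}"
  have "S \<subseteq> topspace X" "finite S" "card S \<le> n"
    using vertex_in_X zv Z \<open>2 \<le> n\<close> by (auto simp: S_def card_insert_if)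
  then obtain A where A: "is_arc X A" "S \<subseteq> A"
    using ac unfolding n_ac_def by blast
  obtain g where "embedded_arc X g A"
    using is_arc_embedded[OF A(1) Hausdorff_X] .
  then have "connectedin X A"
    by (rule embedded_arc.A_connected)
  ultimately have "connectedin euclideanreal (f ` A)"
    by (rule connectedin_continuous_map_image)
  then have "is_interval (f ` A)"
    by (simp add: is_interval_connected_1)
  moreover have "f (Inl v, 0) = 0" "f (Inl z, 0) = 1" "(Inl v, 0) \<in> A" "(Inl z, 0) \<in> A"
    using A(2) zv by (auto simp: f_def S_def)
  then have "0 \<in> f ` A" "1 \<in> f ` A"
    by (metis imageI)+
  ultimately have "\<forall>x. 0 \<le> x \<and> x \<le> 1 \<longrightarrow> x \<in> f ` A"
    unfolding is_interval_1 by blast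
  then have "1/2 \<in> f ` A"
    by simp
  then show False
    by (auto simp: f_def of_bool_def split: sum.splits if_splits)
qed

end

context connected_threads begin

text \<open>The central inequality. The bound 7 is put on midpoints and not on half-threads, because
  the two halves of a thread share their midpoint and are caught by one point of the arc.
  Subtraction is truncated, so vertices with fewer than two chosen half-threads contribute
  nothing.\<close>

lemma thread_bound:
  assumes ac: "n_ac 7 X" and Q: "finite Q" "Q \<subseteq> nonleaf" "card ((\<lambda>d. curve d (1/2)) ` Q) \<le> 7"
  shows "(\<Sum>v\<in>fst ` Q. card {d \<in> Q. fst d = v} - 2) + card {d \<in> Q. dead d} \<le> 2"
proof -
  have "(\<lambda>d. curve d (1/2)) ` Q \<subseteq> topspace X"
    using Q(2) nonleaf_D curve_in_X open_dom by auto
  then obtain A where A: "is_arc X A" "(\<lambda>d. curve d (1/2)) ` Q \<subseteq> A"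
    using ac Q unfolding n_ac_def by (meson finite_imageI)
  obtain g where g: "embedded_arc X g A"
    using is_arc_embedded[OF A(1) Hausdorff_X] .
  interpret embedded_arc X g A
    by (rule g)
  interpret arc_in_complex V E M g A ..
  have "card {d \<in> Q. fst d = v} - 2 \<le> card {d \<in> Q. unused A d \<and> fst d = v}" for v
  proof -
    have "card {d \<in> Q. fst d = v \<and> \<not> unused A d} \<le> 2"
      using Q by (intro used_at_vertex) auto
    moreover have eq: "{d \<in> Q. fst d = v} = {d \<in> Q. unused A d \<and> fst d = v} \<union> {d \<in> Q. fst d = v \<and> \<not> unused A d}"
      by auto
    have "card {d \<in> Q. fst d = v} \<le> card {d \<in> Q. unused A d \<and> fst d = v} + card {d \<in> Q. fst d = v \<and> \<not> unused A d}"
      by (subst eq) (rule card_Un_le)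
    ultimately show ?thesis
      by simp
  qed
  then have "(\<Sum>v\<in>fst ` Q. card {d \<in> Q. fst d = v} - 2) \<le> (\<Sum>v\<in>fst ` Q. card {d \<in> Q. unused A d \<and> fst d = v})"
    by (rule sum_mono)
  also have "\<dots> = card (\<Union>v\<in>fst ` Q. {d \<in> Q. unused A d \<and> fst d = v})"
    using Q(1) by (intro card_UN_disjoint[symmetric]) auto
  also have "(\<Union>v\<in>fst ` Q. {d \<in> Q. unused A d \<and> fst d = v}) = {d \<in> Q. unused A d}"
    by auto
  finally show ?thesis
    using count_ends[OF Q(1,2)] A(2) by fastforce
qed

lemma tails_bij: "v \<in> M \<Longrightarrow> bij_betw snd {d \<in> D. fst d = v} (nbrs E v)"
  unfolding bij_betw_def
proof
  show "inj_on snd {d \<in> D. fst d = v}"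
    by (auto simp: inj_on_def)
  show "snd ` {d \<in> D. fst d = v} = nbrs E v" if "v \<in> M"
  proof (intro equalityI subsetI)
    fix w assume "w \<in> nbrs E v"
    then have "(v, w) \<in> {d \<in> D. fst d = v}"
      using that by (auto simp: D_def darts_def nbrs_def)
    then show "w \<in> snd ` {d \<in> D. fst d = v}"
      by force
  qed (auto simp: D_def darts_def nbrs_def)
qed

lemma card_tails: "v \<in> M \<Longrightarrow> card {d \<in> D. fst d = v} = card (nbrs E v)"
  using tails_bij bij_betw_same_card by blast

lemma finite_tails: "v \<in> M \<Longrightarrow> finite {d \<in> D. fst d = v} \<longleftrightarrow> finite (nbrs E v)"
  using tails_bij bij_betw_finite by blast

lemma mid_rv: "d \<in> D \<Longrightarrow> fin d \<Longrightarrow> curve (rv d) (1/2) = curve d (1/2)"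
  using curve_rv[of d "1/2"] by simp

lemma nbrs_nonempty: "v \<in> M \<Longrightarrow> nbrs E v \<noteq> {}"
  using noniso M_sub by (force simp: nbrs_def)

end

text \<open>The choice \<open>S = {}\<close> covers the six graphs themselves, so both alternatives
  of (c) are captured at once.\<close>

definition listed :: "'a topology \<Rightarrow> bool" where
  "listed Y \<longleftrightarrow> (\<exists>(K, R) \<in> six_graphs. \<exists>S \<subseteq> R. Y homeomorphic_space top_of_set (K - S))"

lemma listedI: "(K, R) \<in> six_graphs \<Longrightarrow> S \<subseteq> R \<Longrightarrow> Y homeomorphic_space top_of_set (K - S) \<Longrightarrow> listed Y"
  unfolding listed_def by blast

lemma listed_cases:
  fixes Y :: "'a topology"
  shows "Y homeomorphic_space top_of_set arc_graph \<Longrightarrow> listed Y"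
  "Y homeomorphic_space top_of_set (arc_graph - {1}) \<Longrightarrow> listed Y"
  "Y homeomorphic_space top_of_set (arc_graph - {0, 1}) \<Longrightarrow> listed Y"
  "Y homeomorphic_space top_of_set circle_graph \<Longrightarrow> listed Y"
  "Y homeomorphic_space top_of_set (lollipop - (if b then {} else {2})) \<Longrightarrow> listed Y"
  "Y homeomorphic_space top_of_set theta_curve \<Longrightarrow> listed Y"
  "Y homeomorphic_space top_of_set figure_of_eight \<Longrightarrow> listed Y"
  "Y homeomorphic_space top_of_set dumbbell \<Longrightarrow> listed Y"
  using
    listedI[of arc_graph "{0, 1}" "{}"] listedI[of arc_graph "{0, 1}" "{1}"] listedI[of arc_graph "{0, 1}" "{0, 1}"]
    listedI[of circle_graph "{}" "{}"] listedI[of lollipop "{2}" "if b then {} else {2}"]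
    listedI[of theta_curve "{}" "{}"] listedI[of figure_of_eight "{}" "{}"] listedI[of dumbbell "{}" "{}"]
  by (simp_all add: six_graphs_def split: if_splits)

section \<open>Graphs with a vertex of degree other than 2\<close>

locale branch_threads = connected_threads V E M for V :: "'v set" and E M +
  assumes marked: "\<And>v. v \<in> M \<Longrightarrow> card (nbrs E v) \<noteq> 2"
    and seven: "n_ac 7 (one_complex V E)"
begin

text \<open>Degree 2 is excluded by the marking and no vertex is isolated, so these are the vertices
  of degree at least 3, infinite degree included.\<close>

definition B :: "'v set" where "B = {v \<in> M. card (nbrs E v) \<noteq> 1}"

lemma nonleaf_eq: "nonleaf = {d \<in> D. fst d \<in> B}"
  using D_M by (auto simp: nonleaf_def B_def)

text \<open>A half-thread that is not dead ends at a branch vertex, so reversal pairs off such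
  half-threads among themselves. The parity of their number is what the case distinctions
  exploit.\<close>

lemma rv_not_dead:
  assumes "d \<in> nonleaf" "\<not> dead d" shows "fin d" "rv d \<in> nonleaf" "\<not> dead (rv d)" "rv (rv d) = d" "rv d \<noteq> d"
proof -
  have d: "d \<in> D" "fin d" "card (nbrs E (fst (rv d))) \<noteq> 1"
    using assms by (auto simp: nonleaf_def dead_def leaf_end_def)
  then show "fin d" "rv (rv d) = d" "rv d \<noteq> d"
    using rv by auto
  show "rv d \<in> nonleaf"
    using d rv(1)[OF d(1,2)] by (simp add: nonleaf_def)
  then show "\<not> dead (rv d)"
    using dead_rv assms(1) d(2) by blast
qed

text \<open>If no thread led from \<open>W\<close> to a branch vertex outside, the threads from
  \<open>W\<close> would cover all darts, among them one leaving some \<open>u\<close> in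
  \<open>B - W\<close>. That dart would be the beginning or the reversed end of such a thread, and
  neither is possible.\<close>

lemma link:
  assumes W: "W \<subseteq> B" "W \<noteq> {}" "W \<noteq> B"
  obtains d where "d \<in> nonleaf" "fst d \<in> W" "fin d" "rv d \<in> nonleaf" "fst (rv d) \<in> B" "fst (rv d) \<notin> W"
proof -
  have "\<exists>d\<in>D. fst d \<in> W \<and> fin d \<and> fst (rv d) \<in> B - W"
  proof (rule ccontr)
    assume none: "\<not> ?thesis"
    have cov: "covering {d \<in> D. fst d \<in> W}"
    proof (rule covering_from)
      show "W \<subseteq> M"
        using W by (auto simp: B_def)
      show "fst (rv d) \<in> W \<or> card (nbrs E (fst (rv d))) = 1" if "d \<in> D" "fst d \<in> W" "fin d" for d
        using none that D_M[OF rv(1)[OF that(1,3)]] by (auto simp: B_def)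
    qed (rule W(2))
    obtain u where u: "u \<in> B" "u \<notin> W"
      using W by blast
    then have "u \<in> M"
      by (simp add: B_def)
    then obtain y where "{u, y} \<in> E"
      using nbrs_nonempty by (auto simp: nbrs_def)
    then have \<delta>: "(u, y) \<in> darts E" "(u, y) \<in> D"
      using \<open>u \<in> M\<close> by (auto simp: darts_def D_def)
    obtain d i where di: "d \<in> D" "fst d \<in> W" "i \<in> idx d" "walk d i = (u, y) \<or> walk d i = prod.swap (u, y)"
      using coveringD[OF cov \<delta>(1)] by blast
    from di(4) show False
    proof
      assume "walk d i = (u, y)"
      then have "d = (u, y)"
        using walk_eq[OF di(1) \<delta>(2) di(3), of 0] by simp
      then show False
        using di(2) u by simp
    next
      assume "walk d i = prod.swap (u, y)"
      then have "fin d \<and> (u, y) = rv d"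
        using walk_swap[OF di(1) \<delta>(2) di(3), of 0] by simp
      then show False
        using none di u by (metis DiffI fst_conv)
    qed
  qed
  then show thesis
    using that W rv(1) nonleaf_eq by blast
qed

lemma covering_nonleaf: "B \<noteq> {} \<Longrightarrow> covering nonleaf"
  unfolding nonleaf_eq
proof (rule covering_from)
  show "fst (rv d) \<in> B \<or> card (nbrs E (fst (rv d))) = 1" if "d \<in> D" "fin d" for d
    using D_M[OF rv(1)[OF that]] by (auto simp: B_def)
qed (auto simp: B_def)

text \<open>Five half-threads at one vertex contribute 5 - 2 = 3 > 2. Choosing a subset of exactly
  five disposes of infinite degree as well.\<close>

lemma branch_degree:
  assumes "v \<in> B" shows "finite (nbrs E v)" "card (nbrs E v) = 3 \<or> card (nbrs E v) = 4"
proof -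
  have v: "v \<in> M" "card (nbrs E v) \<noteq> 1" "card (nbrs E v) \<noteq> 2"
    using assms marked by (auto simp: B_def)
  have no5: False if T: "T \<subseteq> {d \<in> D. fst d = v}" "card T = 5" for T
  proof -
    have "finite T"
      using T(2) by (metis card.infinite zero_neq_numeral)
    have "T \<noteq> {}"
      using T(2) by auto
    then have "fst ` T = {v}"
      using T(1) by force
    moreover have "{d \<in> T. fst d = v} = T"
      using T(1) by auto
    moreover have "T \<subseteq> nonleaf"
      using T(1) assms by (auto simp: nonleaf_eq)
    moreover have "card ((\<lambda>d. curve d (1/2)) ` T) \<le> 7"
      using card_image_le[OF \<open>finite T\<close>, of "\<lambda>d. curve d (1/2)"] T(2) by simp
    ultimately show False
      using thread_bound[OF seven \<open>finite T\<close>] T(2) by simp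
  qed
  show fin: "finite (nbrs E v)"
  proof (rule ccontr)
    assume "infinite (nbrs E v)"
    then have "infinite {d \<in> D. fst d = v}"
      using finite_tails[OF v(1)] by simp
    then show False
      using no5 infinite_arbitrarily_large by metis
  qed
  have "card (nbrs E v) < 5"
  proof (rule ccontr)
    assume "\<not> card (nbrs E v) < 5"
    then have "5 \<le> card {d \<in> D. fst d = v}"
      using card_tails[OF v(1)] by simp
    then show False
      using no5 by (meson obtain_subset_with_card_n)
  qed
  moreover have "card (nbrs E v) \<noteq> 0"
    using fin nbrs_nonempty[OF v(1)] by simp
  ultimately show "card (nbrs E v) = 3 \<or> card (nbrs E v) = 4"
    using v by arith
qed

lemma tails_B:
  assumes "v \<in> B"
  shows "finite {d \<in> D. fst d = v}" "card {d \<in> D. fst d = v} = card (nbrs E v)" "{d \<in> D. fst d = v} \<subseteq> nonleaf"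
proof -
  have "v \<in> M"
    using assms by (simp add: B_def)
  then show "finite {d \<in> D. fst d = v}" "card {d \<in> D. fst d = v} = card (nbrs E v)"
    using finite_tails card_tails branch_degree(1)[OF assms] by simp_all
  show "{d \<in> D. fst d = v} \<subseteq> nonleaf"
    using assms by (auto simp: nonleaf_eq)
qed

lemma bound_at_branches:
  assumes W: "finite W" "W \<subseteq> B" and card: "card ((\<lambda>d. curve d (1/2)) ` {d \<in> D. fst d \<in> W}) \<le> 7"
  shows "(\<Sum>v\<in>W. card (nbrs E v) - 2) + card {d \<in> D. fst d \<in> W \<and> dead d} \<le> 2"
proof -
  let ?Q = "{d \<in> D. fst d \<in> W}"
  have eq: "?Q = (\<Union>v\<in>W. {d \<in> D. fst d = v})"
    by auto
  have "finite ?Q"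
    unfolding eq using W tails_B(1) by blast
  moreover have "?Q \<subseteq> nonleaf"
    using W by (auto simp: nonleaf_eq)
  ultimately have *: "(\<Sum>v\<in>fst ` ?Q. card {d \<in> ?Q. fst d = v} - 2) + card {d \<in> ?Q. dead d} \<le> 2"
    using card by (intro thread_bound[OF seven])
  have "\<exists>d\<in>D. fst d = v" if "v \<in> W" for v
  proof -
    have "v \<in> B"
      using W that by blast
    then have "card {d \<in> D. fst d = v} \<noteq> 0"
      using tails_B(2)[of v] branch_degree(2)[of v] by auto
    then have "{d \<in> D. fst d = v} \<noteq> {}"
      by (metis card.empty)
    then show ?thesis
      by blast
  qed
  then have "fst ` ?Q = W"
    by force
  moreover have "card {d \<in> ?Q. fst d = v} = card (nbrs E v)" if "v \<in> W" for v
  proof -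
    have "{d \<in> ?Q. fst d = v} = {d \<in> D. fst d = v}"
      using that by auto
    moreover have "v \<in> B"
      using W that by blast
    ultimately show ?thesis
      using tails_B(2) by simp
  qed
  moreover have "{d \<in> ?Q. dead d} = {d \<in> D. fst d \<in> W \<and> dead d}"
    by auto
  ultimately show ?thesis
    using * by simp
qed

lemma card_tails_set:
  assumes "finite W" "W \<subseteq> B"
  shows "finite {d \<in> D. fst d \<in> W}" "card {d \<in> D. fst d \<in> W} = (\<Sum>v\<in>W. card (nbrs E v))"
proof -
  have eq: "{d \<in> D. fst d \<in> W} = (\<Union>v\<in>W. {d \<in> D. fst d = v})"
    by auto
  have f: "\<forall>v\<in>W. finite {d \<in> D. fst d = v}"
    using tails_B(1) assms(2) by blast
  then show "finite {d \<in> D. fst d \<in> W}"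
    unfolding eq using assms(1) by blast
  show "card {d \<in> D. fst d \<in> W} = (\<Sum>v\<in>W. card (nbrs E v))"
    unfolding eq using f assms tails_B(2) by (subst card_UN_disjoint) (auto intro!: sum.cong)
qed

text \<open>Four half-threads at \<open>v\<close> and three at \<open>w\<close> have at most seven
  midpoints, while (4 - 2) + (3 - 2) = 3 > 2.\<close>

lemma two_branches:
  assumes "v \<in> B" "w \<in> B" "v \<noteq> w" shows "card (nbrs E v) = 3"
proof (rule ccontr)
  assume "card (nbrs E v) \<noteq> 3"
  then have v4: "card {d \<in> D. fst d = v} = 4"
    using branch_degree[OF assms(1)] tails_B[OF assms(1)] by auto
  have "3 \<le> card {d \<in> D. fst d = w}"
    using branch_degree[OF assms(2)] tails_B[OF assms(2)] by auto
  then obtain T where T: "T \<subseteq> {d \<in> D. fst d = w}" "card T = 3" "finite T"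
    by (meson obtain_subset_with_card_n)
  let ?Q = "{d \<in> D. fst d = v} \<union> T"
  have Q: "finite ?Q" "?Q \<subseteq> nonleaf"
    using tails_B(1,3)[OF assms(1)] order_trans[OF T(1) tails_B(3)[OF assms(2)]] T(3) by simp_all
  have "card ?Q \<le> 7"
    using card_Un_le[of "{d \<in> D. fst d = v}" T] v4 T(2) by simp
  then have "card ((\<lambda>d. curve d (1/2)) ` ?Q) \<le> 7"
    using card_image_le[OF Q(1), of "\<lambda>d. curve d (1/2)"] by simp
  then have *: "(\<Sum>u\<in>fst ` ?Q. card {d \<in> ?Q. fst d = u} - 2) \<le> 2"
    using thread_bound[OF seven Q] by simp
  have "{d \<in> D. fst d = v} \<noteq> {}" "T \<noteq> {}"
    using v4 T(2) by (metis card.empty zero_neq_numeral, auto)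
  then have "fst ` ?Q = {v, w}"
    using T(1) by force
  moreover have "{d \<in> ?Q. fst d = v} = {d \<in> D. fst d = v}" "{d \<in> ?Q. fst d = w} = T"
    using T(1) assms(3) by auto
  ultimately show False
    using * v4 T(2) assms(3) by simp
qed

text \<open>Three branch vertices would give nine half-threads on at most seven threads.\<close>

lemma at_most_two_branches:
  assumes "v1 \<in> B" shows "\<exists>v2. B \<subseteq> {v1, v2}"
proof (rule ccontr)
  assume more: "\<not> ?thesis"
  then have "{v1} \<noteq> B"
    by auto
  then obtain d where d: "d \<in> nonleaf" "fst d = v1" "fin d" "rv d \<in> nonleaf" "fst (rv d) \<in> B" "fst (rv d) \<noteq> v1"
    using link[of "{v1}"] assms by auto
  define v2 where "v2 = fst (rv d)"
  have "{v1, v2} \<noteq> B"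
    using more by blast
  then obtain e where e: "e \<in> nonleaf" "fst e \<in> {v1, v2}" "fin e" "rv e \<in> nonleaf" "fst (rv e) \<in> B" "fst (rv e) \<notin> {v1, v2}"
    using link[of "{v1, v2}"] assms d by (auto simp: v2_def)
  define v3 where "v3 = fst (rv e)"
  have v: "v1 \<noteq> v2" "v1 \<noteq> v3" "v2 \<noteq> v3" "v2 \<in> B" "v3 \<in> B"
    using d e by (auto simp: v2_def v3_def)
  let ?W = "{v1, v2, v3}"
  let ?Q = "{d \<in> D. fst d \<in> ?W}"
  have W: "finite ?W" "?W \<subseteq> B"
    using assms v by auto
  have deg: "card (nbrs E u) = 3" if "u \<in> ?W" for u
    using that two_branches[of u v1] two_branches[of u v2] assms v by auto
  have "card ?Q = (\<Sum>u\<in>?W. card (nbrs E u))"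
    using card_tails_set(2)[OF W] .
  also have "\<dots> = 9"
    using deg v by simp
  finally have Q9: "card ?Q = 9" .
  \<comment> \<open>The two connecting threads are counted from both of their ends. Dropping one
    half of each loses no midpoint and leaves 9 - 2 = 7 half-threads.\<close>
  let ?R = "{rv d, rv e}"
  have D: "d \<in> D" "e \<in> D" "rv d \<in> D" "rv e \<in> D"
    using d e nonleaf_D by auto
  have R: "rv d \<noteq> rv e" "?R \<subseteq> ?Q"
    using D d(2) e(2) v unfolding v2_def v3_def by auto
  then have c7: "card (?Q - ?R) = 7"
    using Q9 by (subst card_Diff_subset) auto
  have "(\<lambda>d. curve d (1/2)) ` ?Q \<subseteq> (\<lambda>d. curve d (1/2)) ` (?Q - ?R)"
  proof
    fix x assume "x \<in> (\<lambda>d. curve d (1/2)) ` ?Q"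
    then obtain q where q: "q \<in> ?Q" "x = curve q (1/2)"
      by blast
    have dQ: "d \<in> ?Q - ?R"
      using D(1) d(2) v by (auto simp: v2_def v3_def)
    have "e \<noteq> rv d"
    proof
      assume "e = rv d"
      then have "rv e = d"
        using rv(5)[OF D(1) d(3)] by simp
      then show False
        using d(2) v(2) by (simp add: v3_def)
    qed
    then have eQ: "e \<in> ?Q - ?R"
      using D(2) e(2,3) rv(6)[OF D(2)] by auto
    consider "q = rv d" | "q = rv e" | "q \<in> ?Q - ?R"
      using q(1) by blast
    then show "x \<in> (\<lambda>d. curve d (1/2)) ` (?Q - ?R)"
    proof cases
      case 1
      then have "x = curve d (1/2)"
        using q(2) mid_rv[OF D(1) d(3)] by simp
      then show ?thesis
        using dQ by (rule image_eqI)
    next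
      case 2
      then have "x = curve e (1/2)"
        using q(2) mid_rv[OF D(2) e(3)] by simp
      then show ?thesis
        using eQ by (rule image_eqI)
    next
      case 3
      with q(2) show ?thesis
        by (rule image_eqI)
    qed
  qed
  moreover have "finite (?Q - ?R)"
    using card_tails_set(1)[OF W] by blast
  ultimately have "card ((\<lambda>d. curve d (1/2)) ` ?Q) \<le> 7"
    unfolding c7[symmetric] by (intro surj_card_le)
  from bound_at_branches[OF W this] have "(\<Sum>u\<in>?W. card (nbrs E u) - 2) \<le> 2"
    by simp
  then show False
    using deg v by simp
qed

text \<open>Without dead ends reversal pairs off the half-threads, so a third one brings a partner
  of its own.\<close>

lemma two_thread_pairs:
  assumes "3 \<le> card nonleaf" and nd: "\<And>d. d \<in> nonleaf \<Longrightarrow> \<not> dead d"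
  obtains a b where "a \<in> nonleaf" "b \<in> nonleaf" "b \<noteq> a" "b \<noteq> rv a" "{a, rv a, b, rv b} \<subseteq> nonleaf" "card {a, rv a, b, rv b} = 4"
proof -
  have "nonleaf \<noteq> {}"
    using assms(1) by auto
  then obtain a where a: "a \<in> nonleaf"
    by blast
  have "\<not> nonleaf \<subseteq> {a, rv a}"
  proof
    assume "nonleaf \<subseteq> {a, rv a}"
    then have "card nonleaf \<le> card {a, rv a}"
      by (intro card_mono) auto
    also have "\<dots> \<le> 2"
      by (simp add: card_insert_if)
    finally show False
      using assms(1) by simp
  qed
  then obtain b where b: "b \<in> nonleaf" "b \<noteq> a" "b \<noteq> rv a"
    by blast
  note ra = rv_not_dead[OF a nd[OF a]] and rb = rv_not_dead[OF b(1) nd[OF b(1)]]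
  have r: "rv b \<noteq> a" "rv b \<noteq> rv a"
    using b ra(4) rb(4) by metis+
  have "card {a, rv a, b, rv b} = 4"
    using b r ra(5) rb(5) by (simp add: card_insert_if)
  then show thesis
    using that[OF a b] a b(1) ra(2) rb(2) by simp
qed

text \<open>Degree 4 exhausts the bound, so nothing is dead and the four half-threads pair up to two
  loops. Degree 3 is odd, so some half-thread is dead; the bound allows only this one, and the other
  two form a loop.\<close>

lemma one_branch:
  assumes Bv: "B = {v}" shows "listed X"
proof -
  have v: "v \<in> B"
    using Bv by simp
  have DBv: "nonleaf = {d \<in> D. fst d = v}"
    using Bv by (simp add: nonleaf_eq)
  have fin_nonleaf: "finite nonleaf" and card_nonleaf: "card nonleaf = card (nbrs E v)"
    using tails_B[OF v] DBv by auto
  have tail: "fst d = v" if "d \<in> nonleaf" for d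
    using that DBv by simp
  have cov: "covering nonleaf"
    using covering_nonleaf Bv by simp
  have "card ((\<lambda>d. curve d (1/2)) ` {d \<in> D. fst d \<in> {v}}) \<le> 7"
    using card_image_le[OF fin_nonleaf, of "\<lambda>d. curve d (1/2)"] card_nonleaf branch_degree(2)[OF v] DBv by auto
  from bound_at_branches[OF _ _ this] have bound: "card (nbrs E v) - 2 + card {d \<in> nonleaf. dead d} \<le> 2"
    using v DBv by (simp add: conj_assoc)
  from branch_degree(2)[OF v] show ?thesis
  proof
    assume c4: "card (nbrs E v) = 4"
    then have "card {d \<in> nonleaf. dead d} = 0"
      using bound by simp
    moreover have "finite {d \<in> nonleaf. dead d}"
      using fin_nonleaf by simp
    ultimately have "{d \<in> nonleaf. dead d} = {}"
      by (simp only: card_0_eq)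
    then have nd: "\<not> dead d" if "d \<in> nonleaf" for d
      using that by blast
    have "3 \<le> card nonleaf"
      using card_nonleaf c4 by simp
    then obtain a b where ab: "a \<in> nonleaf" "b \<in> nonleaf" "b \<noteq> a" "b \<noteq> rv a"
      and sub: "{a, rv a, b, rv b} \<subseteq> nonleaf" "card {a, rv a, b, rv b} = 4"
      by (rule two_thread_pairs[OF _ nd])
    note ra = rv_not_dead[OF ab(1) nd[OF ab(1)]] and rb = rv_not_dead[OF ab(2) nd[OF ab(2)]]
    have "{a, rv a, b, rv b} = nonleaf"
      using sub fin_nonleaf card_nonleaf c4 by (intro card_subset_eq) simp_all
    then have reps: "d \<in> {a, b} \<or> fin d \<and> rv d \<in> {a, b}" if "d \<in> nonleaf" for d
      using that ra(3-4) rb(3-4) rv_not_dead(1)[OF that nd[OF that]] by blast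
    have "covering {a, b}"
      using ab(1,2) nonleaf_D reps by (intro covering_reps[OF cov]) auto
    then have "X homeomorphic_space top_of_set figure_of_eight"
      using ra(1) rb(1) tail[OF ab(1)] tail[OF ra(2)] tail[OF ab(2)] tail[OF rb(2)] ab(3)[symmetric] ab(4)[symmetric]
      by (rule homeomorphic_figure_of_eight)
    then show ?thesis
      by (rule listed_cases)
  next
    assume c3: "card (nbrs E v) = 3"
    have dead: "\<exists>d\<in>nonleaf. dead d"
    proof (rule ccontr)
      assume "\<not> ?thesis"
      then have nd: "\<not> dead d" if "d \<in> nonleaf" for d
        using that by blast
      have "3 \<le> card nonleaf"
        using card_nonleaf c3 by simp
      then obtain a b where "{a, rv a, b, rv b} \<subseteq> nonleaf" "card {a, rv a, b, rv b} = 4"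
        by (rule two_thread_pairs[OF _ nd])
      then have "4 \<le> card nonleaf"
        using card_mono[OF fin_nonleaf] by metis
      then show False
        using card_nonleaf c3 by simp
    qed
    then obtain d where d: "d \<in> nonleaf" "dead d"
      by blast
    have only: "x = d" if "x \<in> nonleaf" "dead x" for x
    proof -
      have "card {d \<in> nonleaf. dead d} \<le> Suc 0"
        using bound c3 by simp
      moreover have "finite {d \<in> nonleaf. dead d}"
        using fin_nonleaf by simp
      ultimately have "\<forall>x\<in>{d \<in> nonleaf. dead d}. \<forall>y\<in>{d \<in> nonleaf. dead d}. x = y"
        by (simp only: card_le_Suc0_iff_eq)
      then show ?thesis
        using that d by blast
    qed
    have "nonleaf \<noteq> {d}"
      using card_nonleaf c3 by auto
    then obtain a where a: "a \<in> nonleaf" "a \<noteq> d"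
      using d(1) by blast
    have nd: "\<not> dead a"
      using only a by blast
    note ra = rv_not_dead[OF a(1) nd]
    have rd: "rv a \<noteq> d"
      using ra(3) d(2) by metis
    then have "card {a, rv a, d} = 3"
      using a(2) ra(5) by (simp add: card_insert_if)
    then have "{a, rv a, d} = nonleaf"
      using a(1) d(1) ra(2) fin_nonleaf card_nonleaf c3 by (intro card_subset_eq) simp_all
    then have "x \<in> {a, d} \<or> fin x \<and> rv x \<in> {a, d}" if "x \<in> nonleaf" for x
      using that ra(4) rv_not_dead(1)[OF ra(2,3)] by blast
    then have "covering {a, d}"
      using a(1) d(1) nonleaf_D by (intro covering_reps[OF cov]) auto
    moreover have "fst (rv d) \<noteq> v" if "fin d"
      using that d(2) v by (auto simp: dead_def leaf_end_def B_def)
    ultimately have "X homeomorphic_space top_of_set (lollipop - (if fin d then {} else {2}))"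
      using homeomorphic_lollipop[OF _ ra(1) tail[OF a(1)] tail[OF ra(2)] tail[OF d(1)] _ a(2) rd] by blast
    then show ?thesis
      by (rule listed_cases)
  qed
qed

text \<open>Two vertices of degree 3 exhaust the bound, so the six half-threads are paired by
  reversal. Connectedness provides a thread \<open>c\<close> from \<open>v\<close> to
  \<open>w\<close>. The other two half-threads at \<open>v\<close> either belong to each other,
  which forces a loop at \<open>w\<close> too and gives the dumbbell, or both lead to
  \<open>w\<close> and give the theta-curve.\<close>

lemma two_branch_vertices:
  assumes Bvw: "B = {v, w}" "v \<noteq> w" shows "listed X"
proof -
  have vw: "v \<in> B" "w \<in> B"
    using Bvw by auto
  have c3: "card (nbrs E v) = 3" "card (nbrs E w) = 3"
    using two_branches vw Bvw(2) by auto
  define Dv where "Dv = {d \<in> D. fst d = v}"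
  define Dw where "Dw = {d \<in> D. fst d = w}"
  have DBvw: "nonleaf = Dv \<union> Dw"
    using Bvw by (auto simp: nonleaf_eq Dv_def Dw_def)
  have card_v: "finite Dv" "card Dv = 3" and card_w: "finite Dw" "card Dw = 3"
    using tails_B[OF vw(1)] tails_B[OF vw(2)] c3 by (auto simp: Dv_def Dw_def)
  have cov: "covering nonleaf"
    using covering_nonleaf Bvw by simp
  have nonleaf_set: "{d \<in> D. fst d \<in> {v, w}} = nonleaf"
    using Bvw by (simp add: nonleaf_eq)
  have "card nonleaf \<le> 7"
    using card_Un_le[of Dv Dw] card_v card_w DBvw by simp
  then have "card ((\<lambda>d. curve d (1/2)) ` {d \<in> D. fst d \<in> {v, w}}) \<le> 7"
    unfolding nonleaf_set using card_image_le[of nonleaf "\<lambda>d. curve d (1/2)"] card_v card_w DBvw by simp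
  from bound_at_branches[OF _ _ this] have "card {d \<in> D. fst d \<in> {v, w} \<and> dead d} = 0"
    using vw c3 Bvw(2) by simp
  moreover have "{d \<in> D. fst d \<in> {v, w} \<and> dead d} = {d \<in> nonleaf. dead d}"
    using nonleaf_set by blast
  moreover have "finite {d \<in> nonleaf. dead d}"
    using card_v card_w DBvw by simp
  ultimately have "{d \<in> nonleaf. dead d} = {}"
    by (simp only: card_0_eq)
  then have nd: "\<not> dead d" if "d \<in> nonleaf" for d
    using that by blast
  note rvd = rv_not_dead[OF _ nd]
  have "{v} \<subseteq> B" "{v} \<noteq> {}" "{v} \<noteq> B"
    using Bvw by auto
  then obtain c where "c \<in> nonleaf" "fst c \<in> {v}" "fin c" "rv c \<in> nonleaf" "fst (rv c) \<in> B" "fst (rv c) \<notin> {v}"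
    by (rule link)
  then have c: "c \<in> nonleaf" "fst c = v" "rv c \<in> nonleaf" "fst (rv c) = w"
    using Bvw(1) by auto
  have c_v: "c \<in> Dv" "rv c \<in> Dw"
    using c DBvw Bvw(2) by (auto simp: Dv_def Dw_def)
  have "card (Dv - {c}) = 2"
    using card_v c_v by simp
  then obtain a b where ab: "Dv - {c} = {a, b}" "a \<noteq> b"
    by (auto simp: card_2_iff)
  then have Dv_eq: "Dv = {a, b, c}" and neq: "a \<noteq> c" "b \<noteq> c"
    using c_v by auto
  have tails: "a \<in> nonleaf" "b \<in> nonleaf" "fst a = v" "fst b = v"
    using Dv_eq DBvw by (auto simp: Dv_def)
  note ra = rvd[OF tails(1) tails(1)] and rb = rvd[OF tails(2) tails(2)] and rc = rvd[OF c(1) c(1)]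
  have rv_side: "x \<in> Dv \<or> x \<in> Dw" "\<not> (x \<in> Dv \<and> x \<in> Dw)" if "x \<in> nonleaf" for x
    using that DBvw Bvw(2) by (auto simp: Dv_def Dw_def)
  have not_c: "rv a \<noteq> c" "rv b \<noteq> c"
    using ra rb rc rv_side(2) c_v Dv_eq by (metis insertCI)+
  show ?thesis
  proof (cases "rv a = b")
    case True
    have "card (Dw - {rv c}) = 2"
      using card_w c_v by simp
    then obtain p q where pq: "Dw - {rv c} = {p, q}" "p \<noteq> q"
      by (auto simp: card_2_iff)
    have Dw_eq: "Dw = {p, q, rv c}"
      using pq(1) c_v(2) by blast
    have "p \<in> Dw - {rv c}"
      unfolding pq(1) by simp
    then have p: "p \<in> nonleaf" "fst p = w" "p \<in> Dw" "p \<noteq> rv c"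
      using DBvw by (simp_all add: Dw_def)
    note rp = rvd[OF p(1) p(1)]
    \<comment> \<open>At \<open>v\<close> all partners are taken: \<open>a\<close> and
      \<open>b\<close> belong to each other, and \<open>c\<close> to \<open>rv c\<close>.\<close>
    have "rv p \<notin> Dv"
    proof
      assume "rv p \<in> Dv"
      then have "rv p = a \<or> rv p = b \<or> rv p = c"
        using Dv_eq by auto
      then have "p = rv a \<or> p = rv b \<or> p = rv c"
        using rp(4) by metis
      moreover have "rv a \<in> Dv" "rv b \<in> Dv"
        using True ra(4) Dv_eq by auto
      ultimately show False
        using p(3,4) rv_side(2)[OF p(1)] by metis
    qed
    then have "rv p \<in> Dw"
      using rv_side(1)[OF rp(2)] by blast
    moreover have "rv p \<noteq> rv c"
      using rp(4) rc(4) Bvw(2) p(2) c(2) by metis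
    ultimately have "rv p = q"
      using Dw_eq rp(5) by blast
    then have "nonleaf = {a, rv a, c, rv c, p, rv p}"
      unfolding DBvw Dv_eq Dw_eq True by blast
    then have "x \<in> {a, p, c} \<or> fin x \<and> rv x \<in> {a, p, c}" if "x \<in> nonleaf" for x
      using that ra(4) rp(4) rc(4) rvd(1)[OF that that] by blast
    then have "covering {a, p, c}"
      using tails(1) p(1) c(1) nonleaf_D by (intro covering_reps[OF cov]) auto
    moreover have "fst (rv a) = v" "fst (rv p) = w"
      using True tails \<open>rv p \<in> Dw\<close> by (auto simp: Dw_def)
    ultimately have "X homeomorphic_space top_of_set dumbbell"
      using homeomorphic_dumbbell[OF _ ra(1) rp(1) rc(1) tails(3) _ p(2) _ c(2,4) Bvw(2) neq(1)] by blast
    then show ?thesis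
      by (rule listed_cases)
  next
    case False
    have "rv b \<noteq> a"
      using False rb(4) by metis
    then have "rv a \<notin> Dv" "rv b \<notin> Dv"
      using False not_c ra(5) rb(5) Dv_eq by auto
    then have r: "rv a \<in> Dw" "rv b \<in> Dw"
      using rv_side(1)[OF ra(2)] rv_side(1)[OF rb(2)] by auto
    have "rv a \<noteq> rv b" "rv a \<noteq> rv c" "rv b \<noteq> rv c"
      using ra(4) rb(4) rc(4) ab(2) neq by metis+
    then have "card {rv a, rv b, rv c} = 3"
      by simp
    then have "{rv a, rv b, rv c} = Dw"
      using r c_v card_w by (intro card_subset_eq) auto
    then have "nonleaf = {a, b, c, rv a, rv b, rv c}"
      using DBvw Dv_eq by auto
    then have "x \<in> {a, b, c} \<or> fin x \<and> rv x \<in> {a, b, c}" if "x \<in> nonleaf" for x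
      using that ra(4) rb(4) rc(4) rvd(1)[OF that that] by blast
    then have "covering {a, b, c}"
      using tails(1,2) c(1) nonleaf_D by (intro covering_reps[OF cov]) auto
    then have "X homeomorphic_space top_of_set theta_curve"
      using homeomorphic_theta[OF _ ra(1) rb(1) rc(1) tails(3) _ tails(4) _ c(2,4) Bvw(2) ab(2) neq] r
      by (auto simp: Dw_def)
    then show ?thesis
      by (rule listed_cases)
  qed
qed

lemma branched: "B \<noteq> {} \<Longrightarrow> listed X"
proof -
  assume "B \<noteq> {}"
  then obtain v where v: "v \<in> B"
    by blast
  then obtain w where "B \<subseteq> {v, w}"
    using at_most_two_branches by blast
  then consider "B = {v}" | "B = {v, w}" "v \<noteq> w"
    using v by blast
  then show ?thesis
    using one_branch two_branch_vertices by cases auto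
qed

text \<open>Every marked vertex is a leaf. The only thread from one of them can end nowhere but at
  another leaf, so it already covers the graph.\<close>

lemma unbranched_leaf:
  assumes "B = {}" shows "listed X"
proof -
  obtain u where u: "u \<in> M"
    using M_nonempty by blast
  have leaf: "card (nbrs E x) = 1" if "x \<in> M" for x
    using assms that by (auto simp: B_def)
  obtain y where "{u, y} \<in> E"
    using nbrs_nonempty[OF u] by (auto simp: nbrs_def)
  then have "(u, y) \<in> D" "fst (u, y) = u"
    using u by (simp_all add: D_def darts_def)
  then obtain d where d: "d \<in> D" "fst d = u"
    by blast
  have only: "x = d" if "x \<in> D" "fst x = u" for x
    using leaf_dart_unique[OF that(1) d(1)] that(2) d(2) leaf[OF u] by simp
  have "covering {d \<in> D. fst d \<in> {u}}"
  proof (rule covering_from)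
    show "fst (rv x) \<in> {u} \<or> card (nbrs E (fst (rv x))) = 1" if "x \<in> D" "fin x" for x
      using leaf[OF D_M[OF rv(1)[OF that]]] by blast
  qed (use u in auto)
  moreover have "{d \<in> D. fst d \<in> {u}} = {d}"
    using only d by blast
  ultimately have cov: "covering {d}"
    by simp
  show ?thesis
  proof (cases "fin d")
    case True
    have "fst d \<noteq> fst (rv d)"
      using only[OF rv(1)[OF d(1) True]] rv(6)[OF d(1) True] d(2) by metis
    then have "X homeomorphic_space top_of_set arc_graph"
      using cov True by (intro homeomorphic_arc)
    then show ?thesis
      by (rule listed_cases)
  next
    case False
    then have "X homeomorphic_space top_of_set (arc_graph - {1})"
      using cov by (intro homeomorphic_half_open)
    then show ?thesis
      by (rule listed_cases)
  qed
qed

end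

text \<open>Two half-threads leave the only marked vertex. If one of them is finite it returns
  there, and the other is its reversal; otherwise both run to infinity.\<close>

lemma (in connected_threads) two_regular:
  assumes M: "M = {v}" and deg: "card (nbrs E v) = 2" shows "listed X"
proof -
  have "card {d \<in> D. fst d = v} = 2"
    using card_tails M deg by simp
  moreover have "{d \<in> D. fst d = v} = D"
    using D_M M by auto
  ultimately obtain a b where ab: "D = {a, b}" "a \<noteq> b"
    by (auto simp: card_2_iff)
  have D: "a \<in> D" "b \<in> D"
    using ab by auto
  have tails: "fst x = v" if "x \<in> D" for x
    using D_M[OF that] M by simp
  show ?thesis
  proof (cases "fin a \<or> fin b")
    case True
    then obtain d where d: "d \<in> D" "fin d"
      using D by blast
    note r = rv[OF d]
    have "D = {d, rv d}"
      using ab d(1) r(1) r(6) by auto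
    then have "covering {d}"
      using r d by (intro covering_reps[OF covering_D]) auto
    then have "X homeomorphic_space top_of_set circle_graph"
      using d(2) tails[OF d(1)] tails[OF r(1)] by (intro homeomorphic_circle) auto
    then show ?thesis
      by (rule listed_cases)
  next
    case False
    have "covering {a, b}"
      using covering_D ab by simp
    then have "X homeomorphic_space top_of_set (arc_graph - {0, 1})"
      using False ab(2) tails[OF D(1)] tails[OF D(2)] homeomorphic_open[of a b] by auto
    then show ?thesis
      by (rule listed_cases)
  qed
qed

text \<open>If all degrees are 2, threads would have nowhere to start, so one arbitrary vertex is
  marked. In all other cases exactly the vertices of degree other than 2 are marked.\<close>

lemma listed_if_7_ac:
  fixes V :: "'v set"
  assumes "graph V E" "nondegenerate V" "n_ac 7 (one_complex V E)"
  shows "listed (one_complex V E)"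
proof -
  interpret graph_complex V E
    by standard (rule assms)
  have "2 \<le> (7::nat)"
    by simp
  note conn = connected_if_n_ac[OF assms(3) this]
  let ?M = "{v \<in> V. card (nbrs E v) \<noteq> 2}"
  show ?thesis
  proof (cases "?M = {}")
    case True
    obtain v where v: "v \<in> V"
      using assms(2) by (auto simp: nondegenerate_def)
    then have deg: "card (nbrs E u) = 2" if "u \<in> V" for u
      using True that by auto
    interpret connected_threads V E "{v}"
    proof
      show "Z = V" if "Z \<subseteq> V" "Z \<noteq> {}" "\<And>x y. x \<in> Z \<Longrightarrow> {x, y} \<in> E \<Longrightarrow> y \<in> Z" for Z
        using that by (rule conn)
    qed (use v deg assms in auto)
    show ?thesis
      using two_regular[OF refl deg[OF v]] .
  next
    case False
    interpret branch_threads V E ?M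
    proof
      show "Z = V" if "Z \<subseteq> V" "Z \<noteq> {}" "\<And>x y. x \<in> Z \<Longrightarrow> {x, y} \<in> E \<Longrightarrow> y \<in> Z" for Z
        using that by (rule conn)
    qed (use False assms in auto)
    show ?thesis
      using branched unbranched_leaf by blast
  qed
qed

lemma omega_ac_if_listed:
  assumes "listed Y" shows "omega_ac Y"
proof -
  obtain K R S where K: "(K, R) \<in> six_graphs" "S \<subseteq> R" "Y homeomorphic_space top_of_set (K - S)"
    using assms unfolding listed_def by blast
  have "omega_ac (top_of_set (K - S))"
    using K(1,2) omega_ac_arc[of S] omega_ac_circle omega_ac_lollipop[of S] omega_ac_theta
      omega_ac_figure_of_eight omega_ac_dumbbell by (auto simp: six_graphs_def)
  then show ?thesis
    using omega_ac_homeomorphic K(3) homeomorphic_space_sym by blast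
qed

theorem theorem3p5p1:
  fixes V :: "'v set" and E :: "'v set set"
  assumes "graph V E" and "nondegenerate V"
  shows "(n_ac 7 (one_complex V E) \<longleftrightarrow> omega_ac (one_complex V E)) \<and>
    (omega_ac (one_complex V E) \<longleftrightarrow>
       (\<exists>(K, D) \<in> six_graphs. one_complex V E homeomorphic_space top_of_set K) \<or>
       (\<exists>(K, D) \<in> six_graphs. \<exists>S \<subseteq> D. one_complex V E homeomorphic_space top_of_set (K - S)))"
proof -
  let ?X = "one_complex V E"
  have "listed ?X" if "(K, D) \<in> six_graphs" "?X homeomorphic_space top_of_set K" for K D
    using that by (intro listedI[of K D "{}"]) auto
  then have "(\<exists>(K, D) \<in> six_graphs. ?X homeomorphic_space top_of_set K) \<or>
      (\<exists>(K, D) \<in> six_graphs. \<exists>S \<subseteq> D. ?X homeomorphic_space top_of_set (K - S)) \<longleftrightarrow> listed ?X"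
    unfolding listed_def by blast
  moreover have "n_ac 7 ?X \<Longrightarrow> listed ?X"
    using listed_if_7_ac assms by blast
  moreover have "omega_ac ?X \<Longrightarrow> n_ac 7 ?X"
    by (simp add: omega_ac_def)
  ultimately show ?thesis
    using omega_ac_if_listed by blast
qed

end
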